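(* Let $(\mathcal V,\sigma)$ be a braided tensor category, let $\mathcal C$ be a $\mathcal V$-central tensor category via a right exact functor $G:\mathcal V\to\mathcal Z(\mathcal C)$, and let $\mathcal M$ be a left $\mathcal C$-module category. Assume that $(F,c):\mathcal M\to\mathcal M$ is a $\mathcal C$-module functor and $(F,d):\mathcal M\to\mathcal M$ is a $\mathcal V$-module functor. If $c_{G(V),M}=d_{V,M}$ for all $V\in\mathcal V$, $M\in\mathcal M$, that is, if $(F,c,d)\in\mathcal C(\mathcal V,\mathcal M)$, then $$\mathcal Z_{\mathcal C}(\bar\rho)(F,c,d)\in\mathcal Z^{\mathcal V}(\mathcal C).$$ This defines a functor $\mathcal Z_{\mathcal C}(\bar\rho):\mathcal C(\mathcal V,\mathcal M)\to\mathcal Z^{\mathcal V}(\mathcal C)$.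
   Context: Conventions: $\Bbbk$ is an algebraically closed field; all categories are finite abelian $\Bbbk$-linear; monoidal categories are strict; tensor categories are finite, rigid, with simple unit $\mathbf 1$. Duals: $\mathrm{ev}_X:X^*\otimes X\to\mathbf 1$, $\mathrm{coev}_X:\mathbf 1\to X\otimes X^*$. Associativity isomorphisms of module categories are suppressed. Center: objects of $\mathcal Z(\mathcal C)$ are pairs $(A,\sigma_{A,-})$ with natural isomorphisms $\sigma_{A,X}:A\otimes X\to X\otimes A$, $\sigma_{A,X\otimes Y}=(\mathrm{id}_X\otimes\sigma_{A,Y})(\sigma_{A,X}\otimes\mathrm{id}_Y)$; the braiding is $\sigma_{A,B}$. $\mathcal C$ is $\mathcal V$-central if there is a faithful braided monoidal functor $G:\mathcal V\to\mathcal Z(\mathcal C)$; $\sigma_{G(V),X}:G(V)\otimes X\to X\otimes G(V)$ is the half-braiding of $G(V)$; identify $G(V^* )=G(V)^*$. The relative center $\mathcal Z^{\mathcal V}(\mathcal C)$ is the full subcategory of $\mathcal Z(\mathcal C)$ of objects $(A,\sigma_{A,-})$ with $\sigma_{G(V),A}\,\sigma_{A,G(V)}=\mathrm{id}_{A\otimes G(V)}$ for all $V\in\mathcal V$. A left $\mathcal C$-module category has an associative unital action $\triangleright$, bilinear and exact in each variable; it is a $\mathcal V$-module category via $V\blacktriangleright M:=G(V)\triangleright M$. Module functors are right exact $\Bbbk$-linear functors $F$ with natural isomorphisms $c_{X,M}:F(X\triangleright M)\to X\triangleright F(M)$ satisfying the usual axioms. $\mathrm{End}_{\mathcal V}(\mathcal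 M)$ is the category of $\mathcal V$-module endofunctors $(F,d)$, $d_{V,M}:F(V\blacktriangleright M)\to V\blacktriangleright F(M)$, with natural module transformations. It is a $\mathcal C$-bimodule category by $(X\triangleright F)(M)=X\triangleright F(M)$, $(F\triangleleft X)(M)=F(X\triangleright M)$, with $(X\triangleright d)_{V,M}=(\sigma_{G(V),X}^{-1}\triangleright\mathrm{id}_{F(M)})(\mathrm{id}_X\triangleright d_{V,M})$ and $(d\triangleleft X)_{V,M}=d_{V,X\triangleright M}F(\sigma_{G(V),X}^{-1}\triangleright\mathrm{id}_M)$. The functor $\rho:\mathcal C\to\mathrm{End}_{\mathcal V}(\mathcal M)$, $\rho(X)=X\triangleright-$ with $\mathcal V$-module structure $\sigma_{G(V),X}^{-1}\triangleright\mathrm{id}_M$, is a $\mathcal C$-bimodule functor. For a $\mathcal C$-bimodule category $\mathcal N$, $\mathcal Z_{\mathcal C}(\mathcal N)$ has objects $(N,\tau)$ with natural isomorphisms $\tau_X:N\triangleleft X\to X\triangleright N$ satisfying $\tau_{X\otimes Y}=(\mathrm{id}_X\triangleright\tau_Y)(\tau_X\triangleleft\mathrm{id}_Y)$; $\mathcal Z_{\mathcal C}(\mathcal C)=\mathcal Z(\mathcal C)$. Objects of $\mathcal Z_{\mathcal C}(\mathrm{End}_{\mathcal V}(\mathcal M))$ are triples $(F,c,d)$ with $(F,d)\in\mathrm{End}_{\mathcal V}(\mathcal M)$ and $(F,c)$ a $\mathcal C$-module functor such that each $c_X:F\triangleleft X\to X\triangleright F$ is a morphism in $\mathrm{End}_{\mathcal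 V}(\mathcal M)$. $\mathcal C(\mathcal V,\mathcal M)$ is the full subcategory of those with $c_{G(V),M}=d_{V,M}$ for all $V,M$. Internal Hom: $\underline{\mathrm{Hom}}(M,N)\in\mathcal C$ represents $\mathrm{Hom}_{\mathcal M}(-\triangleright M,N)$ with natural isomorphisms $\phi^X_{M,N}:\mathrm{Hom}_{\mathcal C}(X,\underline{\mathrm{Hom}}(M,N))\to\mathrm{Hom}_{\mathcal M}(X\triangleright M,N)$. Relative end: for a functor $S:\mathcal M^{\mathrm{op}}\times\mathcal M\to\mathcal A$ with a $\mathcal V$-prebalancing (natural isomorphism) $\beta^V_{M,N}:S(M,V\blacktriangleright N)\to S(V^*\blacktriangleright M,N)$, $\oint_{M\in\mathcal M}(S,\beta)$ is the universal object $E$ with dinatural $\pi_M:E\to S(M,M)$ satisfying $S(\mathrm{ev}_V\blacktriangleright\mathrm{id}_M,\mathrm{id}_M)\pi_M=\beta^V_{V\blacktriangleright M,M}\pi_{V\blacktriangleright M}$. The functor $\bar\rho$: for $(F,d)\in\mathrm{End}_{\mathcal V}(\mathcal M)$ and $f:X\triangleright M\to F(V\blacktriangleright N)$ put $\gamma^X_{V,M,N}(f)=(\mathrm{ev}_{G(V)}\triangleright\mathrm{id}_{F(N)})(\mathrm{id}_{G(V^* )}\triangleright d_{V,N}f)(\sigma_{G(V^* ),X}^{-1}\triangleright\mathrm{id}_M)$. With $E=\underline{\mathrm{Hom}}(M,F(V\blacktriangleright N))$, let $\beta^V_{M,N}:E\to\underline{\mathrm{Hom}}(V^*\blacktriangleright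 M,F(N))$ be the unique morphism with $\phi^E_{V^*\blacktriangleright M,F(N)}(\beta^V_{M,N})=\gamma^E_{V,M,N}(\phi^E_{M,F(V\blacktriangleright N)}(\mathrm{id}_E))$. Then $\bar\rho(F,d)=\oint_{M\in\mathcal M}(\underline{\mathrm{Hom}}(M,F(M)),\beta)$; it is right adjoint to $\rho$, with unit $h$ and counit $e$. It is a $\mathcal C$-bimodule functor with structure isomorphisms $r_{F,X}:\bar\rho(F\triangleleft X)\to\bar\rho(F)\otimes X$, $l_{X,F}:\bar\rho(X\triangleright F)\to X\otimes\bar\rho(F)$ given by $r_{F,X}^{-1}=\bar\rho(e_F\triangleleft\mathrm{id}_X)h_{\bar\rho(F)\otimes X}$, $l_{X,F}^{-1}=\bar\rho(\mathrm{id}_X\triangleright e_F)h_{X\otimes\bar\rho(F)}$. Finally $\mathcal Z_{\mathcal C}(\bar\rho):\mathcal Z_{\mathcal C}(\mathrm{End}_{\mathcal V}(\mathcal M))\to\mathcal Z(\mathcal C)$ sends $(F,c,d)$ to $\bar\rho(F,d)$ with half-braiding $\sigma_X=l_{X,F}\,\bar\rho(c_X)\,r_{F,X}^{-1}$. *)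

theory Defs
  imports Complex_Main "HOL-Library.FuncSet" "HOL-Computational_Algebra.Polynomial"
begin

section \<open>Categories\<close>

text \<open>
  A category has carriers of objects and of arrows. The sets \<open>Hom C A B\<close> are not required
  to be disjoint, so that an arrow of \<open>C\<close> can also serve as an arrow between several objects of
  the center of \<open>C\<close>. Values of structure maps outside the carriers are irrelevant.
\<close>

record ('o, 'm) cat =
  Ob :: "'o set"
  Hom :: "'o \<Rightarrow> 'o \<Rightarrow> 'm set"
  ident :: "'o \<Rightarrow> 'm"
  comp_arr :: "'m \<Rightarrow> 'm \<Rightarrow> 'm" (infixl "\<cdot>\<index>" 70)

record ('o, 'm, 'k) kcat = "('o, 'm) cat" +
  add_arr :: "'m \<Rightarrow> 'm \<Rightarrow> 'm" (infixl "\<oplus>\<index>" 65)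
  zero_arr :: "'o \<Rightarrow> 'o \<Rightarrow> 'm"
  scale_arr :: "'k \<Rightarrow> 'm \<Rightarrow> 'm" (infixr "\<odot>\<index>" 75)

record ('o, 'm, 'k) monoidal_cat = "('o, 'm, 'k) kcat" +
  tensor_ob :: "'o \<Rightarrow> 'o \<Rightarrow> 'o" (infixr "\<otimes>\<index>" 75)
  tensor_arr :: "'m \<Rightarrow> 'm \<Rightarrow> 'm" (infixr "\<otimes>\<^sub>a\<index>" 75)
  unit_ob :: "'o" ("\<one>\<index>")

text \<open>A monoidal category with a choice of left duals \<open>X\<^sup>*\<close>, \<open>ev\<^sub>X : X\<^sup>* \<otimes> X \<rightarrow> \<one>\<close>,
  \<open>coev\<^sub>X : \<one> \<rightarrow> X \<otimes> X\<^sup>*\<close>.\<close>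

record ('o, 'm, 'k) tensor_cat = "('o, 'm, 'k) monoidal_cat" +
  dual :: "'o \<Rightarrow> 'o"
  ev :: "'o \<Rightarrow> 'm"
  coev :: "'o \<Rightarrow> 'm"

locale category =
  fixes C :: "('o, 'm, 'z) cat_scheme" (structure)
  assumes ident_closed: "A \<in> Ob C \<Longrightarrow> ident C A \<in> Hom C A A"
    and comp_closed:
      "\<lbrakk>A \<in> Ob C; B \<in> Ob C; D \<in> Ob C; f \<in> Hom C A B; g \<in> Hom C B D\<rbrakk> \<Longrightarrow> g \<cdot> f \<in> Hom C A D"
    and ident_left: "\<lbrakk>A \<in> Ob C; B \<in> Ob C; f \<in> Hom C A B\<rbrakk> \<Longrightarrow> ident C B \<cdot> f = f"
    and ident_right: "\<lbrakk>A \<in> Ob C; B \<in> Ob C; f \<in> Hom C A B\<rbrakk> \<Longrightarrow> f \<cdot> ident C A = f"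
    and comp_assoc:
      "\<lbrakk>A \<in> Ob C; B \<in> Ob C; D \<in> Ob C; E \<in> Ob C; f \<in> Hom C A B; g \<in> Hom C B D; h \<in> Hom C D E\<rbrakk>
        \<Longrightarrow> h \<cdot> g \<cdot> f = h \<cdot> (g \<cdot> f)"

definition is_inverse :: "('o, 'm, 'z) cat_scheme \<Rightarrow> 'o \<Rightarrow> 'o \<Rightarrow> 'm \<Rightarrow> 'm \<Rightarrow> bool" where
  "is_inverse C A B f g \<longleftrightarrow> f \<in> Hom C A B \<and> g \<in> Hom C B A \<and>
     g \<cdot>\<^bsub>C\<^esub> f = ident C A \<and> f \<cdot>\<^bsub>C\<^esub> g = ident C B"

definition is_iso :: "('o, 'm, 'z) cat_scheme \<Rightarrow> 'o \<Rightarrow> 'o \<Rightarrow> 'm \<Rightarrow> bool" where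
  "is_iso C A B f \<longleftrightarrow> (\<exists>g. is_inverse C A B f g)"

definition inv_arr :: "('o, 'm, 'z) cat_scheme \<Rightarrow> 'o \<Rightarrow> 'o \<Rightarrow> 'm \<Rightarrow> 'm" where
  "inv_arr C A B f = (THE g. is_inverse C A B f g)"

definition isomorphic :: "('o, 'm, 'z) cat_scheme \<Rightarrow> 'o \<Rightarrow> 'o \<Rightarrow> bool" where
  "isomorphic C A B \<longleftrightarrow> (\<exists>f. is_iso C A B f)"

definition is_mono :: "('o, 'm, 'z) cat_scheme \<Rightarrow> 'o \<Rightarrow> 'o \<Rightarrow> 'm \<Rightarrow> bool" where
  "is_mono C A B f \<longleftrightarrow> f \<in> Hom C A B \<and>
     (\<forall>T \<in> Ob C. \<forall>g \<in> Hom C T A. \<forall>h \<in> Hom C T A. f \<cdot>\<^bsub>C\<^esub> g = f \<cdot>\<^bsub>C\<^esub> h \<longrightarrow> g = h)"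

definition is_epi :: "('o, 'm, 'z) cat_scheme \<Rightarrow> 'o \<Rightarrow> 'o \<Rightarrow> 'm \<Rightarrow> bool" where
  "is_epi C A B f \<longleftrightarrow> f \<in> Hom C A B \<and>
     (\<forall>T \<in> Ob C. \<forall>g \<in> Hom C B T. \<forall>h \<in> Hom C B T. g \<cdot>\<^bsub>C\<^esub> f = h \<cdot>\<^bsub>C\<^esub> f \<longrightarrow> g = h)"

definition full_subcategory ::
  "('o, 'm, 'z) cat_scheme \<Rightarrow> ('o \<Rightarrow> bool) \<Rightarrow> ('o, 'm, 'z) cat_scheme" where
  "full_subcategory C P = C\<lparr>Ob := {A \<in> Ob C. P A}\<rparr>"

record ('o, 'm, 'p, 'n) fctr =
  fob :: "'o \<Rightarrow> 'p"
  far :: "'m \<Rightarrow> 'n"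

definition is_functor :: "('o, 'm, 'z) cat_scheme \<Rightarrow> ('p, 'n, 'w) cat_scheme \<Rightarrow>
    ('o, 'm, 'p, 'n, 'y) fctr_scheme \<Rightarrow> bool" where
  "is_functor C D F \<longleftrightarrow>
     (\<forall>A \<in> Ob C. fob F A \<in> Ob D) \<and>
     (\<forall>A \<in> Ob C. \<forall>B \<in> Ob C. \<forall>f \<in> Hom C A B. far F f \<in> Hom D (fob F A) (fob F B)) \<and>
     (\<forall>A \<in> Ob C. far F (ident C A) = ident D (fob F A)) \<and>
     (\<forall>A \<in> Ob C. \<forall>B \<in> Ob C. \<forall>E \<in> Ob C. \<forall>f \<in> Hom C A B. \<forall>g \<in> Hom C B E.
        far F (g \<cdot>\<^bsub>C\<^esub> f) = far F g \<cdot>\<^bsub>D\<^esub> far F f)"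

definition faithful :: "('o, 'm, 'z) cat_scheme \<Rightarrow> ('o, 'm, 'p, 'n, 'y) fctr_scheme \<Rightarrow> bool" where
  "faithful C F \<longleftrightarrow> (\<forall>A \<in> Ob C. \<forall>B \<in> Ob C. inj_on (far F) (Hom C A B))"


section \<open>Finite abelian linear categories\<close>

locale linear_category = category C
  for C :: "('o, 'm, 'k::field, 'z) kcat_scheme" (structure) +
  assumes zero_closed: "\<lbrakk>A \<in> Ob C; B \<in> Ob C\<rbrakk> \<Longrightarrow> zero_arr C A B \<in> Hom C A B"
    and add_closed:
      "\<lbrakk>A \<in> Ob C; B \<in> Ob C; f \<in> Hom C A B; g \<in> Hom C A B\<rbrakk> \<Longrightarrow> f \<oplus> g \<in> Hom C A B"
    and scale_closed: "\<lbrakk>A \<in> Ob C; B \<in> Ob C; f \<in> Hom C A B\<rbrakk> \<Longrightarrow> a \<odot> f \<in> Hom C A B"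
    and add_assoc:
      "\<lbrakk>A \<in> Ob C; B \<in> Ob C; f \<in> Hom C A B; g \<in> Hom C A B; h \<in> Hom C A B\<rbrakk>
        \<Longrightarrow> f \<oplus> g \<oplus> h = f \<oplus> (g \<oplus> h)"
    and add_commute:
      "\<lbrakk>A \<in> Ob C; B \<in> Ob C; f \<in> Hom C A B; g \<in> Hom C A B\<rbrakk> \<Longrightarrow> f \<oplus> g = g \<oplus> f"
    and add_zero: "\<lbrakk>A \<in> Ob C; B \<in> Ob C; f \<in> Hom C A B\<rbrakk> \<Longrightarrow> zero_arr C A B \<oplus> f = f"
    and add_inverse:
      "\<lbrakk>A \<in> Ob C; B \<in> Ob C; f \<in> Hom C A B\<rbrakk> \<Longrightarrow> \<exists>g \<in> Hom C A B. f \<oplus> g = zero_arr C A B"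
    and scale_one: "\<lbrakk>A \<in> Ob C; B \<in> Ob C; f \<in> Hom C A B\<rbrakk> \<Longrightarrow> 1 \<odot> f = f"
    and scale_scale:
      "\<lbrakk>A \<in> Ob C; B \<in> Ob C; f \<in> Hom C A B\<rbrakk> \<Longrightarrow> a \<odot> (b \<odot> f) = (a * b) \<odot> f"
    and scale_add_left:
      "\<lbrakk>A \<in> Ob C; B \<in> Ob C; f \<in> Hom C A B\<rbrakk> \<Longrightarrow> (a + b) \<odot> f = a \<odot> f \<oplus> b \<odot> f"
    and scale_add_right:
      "\<lbrakk>A \<in> Ob C; B \<in> Ob C; f \<in> Hom C A B; g \<in> Hom C A B\<rbrakk>
        \<Longrightarrow> a \<odot> (f \<oplus> g) = a \<odot> f \<oplus> a \<odot> g"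
    and comp_add_right:
      "\<lbrakk>A \<in> Ob C; B \<in> Ob C; D \<in> Ob C; f \<in> Hom C A B; g \<in> Hom C A B; h \<in> Hom C B D\<rbrakk>
        \<Longrightarrow> h \<cdot> (f \<oplus> g) = h \<cdot> f \<oplus> h \<cdot> g"
    and comp_add_left:
      "\<lbrakk>A \<in> Ob C; B \<in> Ob C; D \<in> Ob C; f \<in> Hom C A B; g \<in> Hom C B D; h \<in> Hom C B D\<rbrakk>
        \<Longrightarrow> (g \<oplus> h) \<cdot> f = g \<cdot> f \<oplus> h \<cdot> f"
    and comp_scale_right:
      "\<lbrakk>A \<in> Ob C; B \<in> Ob C; D \<in> Ob C; f \<in> Hom C A B; g \<in> Hom C B D\<rbrakk>
        \<Longrightarrow> g \<cdot> (a \<odot> f) = a \<odot> (g \<cdot> f)"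
    and comp_scale_left:
      "\<lbrakk>A \<in> Ob C; B \<in> Ob C; D \<in> Ob C; f \<in> Hom C A B; g \<in> Hom C B D\<rbrakk>
        \<Longrightarrow> (a \<odot> g) \<cdot> f = a \<odot> (g \<cdot> f)"

definition zero_object :: "('o, 'm, 'k, 'z) kcat_scheme \<Rightarrow> 'o \<Rightarrow> bool" where
  "zero_object C Z \<longleftrightarrow> Z \<in> Ob C \<and>
     (\<forall>A \<in> Ob C. Hom C Z A = {zero_arr C Z A} \<and> Hom C A Z = {zero_arr C A Z})"

definition is_biproduct ::
  "('o, 'm, 'k, 'z) kcat_scheme \<Rightarrow> 'o \<Rightarrow> 'o \<Rightarrow> 'o \<Rightarrow> 'm \<Rightarrow> 'm \<Rightarrow> 'm \<Rightarrow> 'm \<Rightarrow> bool" where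
  "is_biproduct C A B P i j p q \<longleftrightarrow> P \<in> Ob C \<and>
     i \<in> Hom C A P \<and> j \<in> Hom C B P \<and> p \<in> Hom C P A \<and> q \<in> Hom C P B \<and>
     p \<cdot>\<^bsub>C\<^esub> i = ident C A \<and> q \<cdot>\<^bsub>C\<^esub> j = ident C B \<and>
     p \<cdot>\<^bsub>C\<^esub> j = zero_arr C B A \<and> q \<cdot>\<^bsub>C\<^esub> i = zero_arr C A B \<and>
     (i \<cdot>\<^bsub>C\<^esub> p) \<oplus>\<^bsub>C\<^esub> (j \<cdot>\<^bsub>C\<^esub> q) = ident C P"

definition is_kernel ::
  "('o, 'm, 'k, 'z) kcat_scheme \<Rightarrow> 'o \<Rightarrow> 'o \<Rightarrow> 'm \<Rightarrow> 'o \<Rightarrow> 'm \<Rightarrow> bool" where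
  "is_kernel C A B f K i \<longleftrightarrow> K \<in> Ob C \<and> f \<in> Hom C A B \<and> i \<in> Hom C K A \<and>
     f \<cdot>\<^bsub>C\<^esub> i = zero_arr C K B \<and>
     (\<forall>T \<in> Ob C. \<forall>g \<in> Hom C T A. f \<cdot>\<^bsub>C\<^esub> g = zero_arr C T B \<longrightarrow>
        (\<exists>!u. u \<in> Hom C T K \<and> i \<cdot>\<^bsub>C\<^esub> u = g))"

definition is_cokernel ::
  "('o, 'm, 'k, 'z) kcat_scheme \<Rightarrow> 'o \<Rightarrow> 'o \<Rightarrow> 'm \<Rightarrow> 'o \<Rightarrow> 'm \<Rightarrow> bool" where
  "is_cokernel C A B f Q p \<longleftrightarrow> Q \<in> Ob C \<and> f \<in> Hom C A B \<and> p \<in> Hom C B Q \<and>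
     p \<cdot>\<^bsub>C\<^esub> f = zero_arr C A Q \<and>
     (\<forall>T \<in> Ob C. \<forall>g \<in> Hom C B T. g \<cdot>\<^bsub>C\<^esub> f = zero_arr C A T \<longrightarrow>
        (\<exists>!u. u \<in> Hom C Q T \<and> u \<cdot>\<^bsub>C\<^esub> p = g))"

locale abelian_category = linear_category C
  for C :: "('o, 'm, 'k::field, 'z) kcat_scheme" (structure) +
  assumes ex_zero: "\<exists>Z. zero_object C Z"
    and ex_biproduct: "\<lbrakk>A \<in> Ob C; B \<in> Ob C\<rbrakk> \<Longrightarrow> \<exists>P i j p q. is_biproduct C A B P i j p q"
    and ex_kernel:
      "\<lbrakk>A \<in> Ob C; B \<in> Ob C; f \<in> Hom C A B\<rbrakk> \<Longrightarrow> \<exists>K i. is_kernel C A B f K i"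
    and ex_cokernel:
      "\<lbrakk>A \<in> Ob C; B \<in> Ob C; f \<in> Hom C A B\<rbrakk> \<Longrightarrow> \<exists>Q p. is_cokernel C A B f Q p"
    and mono_normal:
      "\<lbrakk>A \<in> Ob C; B \<in> Ob C; is_mono C A B f\<rbrakk> \<Longrightarrow> \<exists>D \<in> Ob C. \<exists>g. is_kernel C B D g A f"
    and epi_normal:
      "\<lbrakk>A \<in> Ob C; B \<in> Ob C; is_epi C A B f\<rbrakk> \<Longrightarrow> \<exists>D \<in> Ob C. \<exists>g. is_cokernel C D A g B f"

definition simple_object :: "('o, 'm, 'k, 'z) kcat_scheme \<Rightarrow> 'o \<Rightarrow> bool" where
  "simple_object C S \<longleftrightarrow> S \<in> Ob C \<and> \<not> zero_object C S \<and>
     (\<forall>A \<in> Ob C. \<forall>f. is_mono C A S f \<longrightarrow> zero_object C A \<or> is_iso C A S f)"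

inductive finite_length :: "('o, 'm, 'k, 'z) kcat_scheme \<Rightarrow> 'o \<Rightarrow> bool"
  for C :: "('o, 'm, 'k, 'z) kcat_scheme" where
  zero: "zero_object C Z \<Longrightarrow> finite_length C Z"
| extend: "\<lbrakk>finite_length C A; B \<in> Ob C; is_mono C A B i; is_cokernel C A B i S p;
            simple_object C S\<rbrakk> \<Longrightarrow> finite_length C B"

definition projective :: "('o, 'm, 'k, 'z) kcat_scheme \<Rightarrow> 'o \<Rightarrow> bool" where
  "projective C P \<longleftrightarrow> P \<in> Ob C \<and>
     (\<forall>A \<in> Ob C. \<forall>B \<in> Ob C. \<forall>g. is_epi C A B g \<longrightarrow>
        (\<forall>f \<in> Hom C P B. \<exists>h \<in> Hom C P A. g \<cdot>\<^bsub>C\<^esub> h = f))"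

definition lin_comb ::
  "('o, 'm, 'k, 'z) kcat_scheme \<Rightarrow> 'o \<Rightarrow> 'o \<Rightarrow> 'k list \<Rightarrow> 'm list \<Rightarrow> 'm" where
  "lin_comb C A B as fs =
     foldr (\<lambda>(a, f) s. (a \<odot>\<^bsub>C\<^esub> f) \<oplus>\<^bsub>C\<^esub> s) (zip as fs) (zero_arr C A B)"

text \<open>Equivalent to: \<open>C\<close> is equivalent to the category of finite dimensional modules over a
  finite dimensional algebra.\<close>

locale finite_abelian_category = abelian_category C
  for C :: "('o, 'm, 'k::field, 'z) kcat_scheme" (structure) +
  assumes hom_finite_dim: "\<lbrakk>A \<in> Ob C; B \<in> Ob C\<rbrakk> \<Longrightarrow>
      \<exists>fs. set fs \<subseteq> Hom C A B \<and>
        (\<forall>f \<in> Hom C A B. \<exists>as. length as = length fs \<and> f = lin_comb C A B as fs)"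
    and all_finite_length: "A \<in> Ob C \<Longrightarrow> finite_length C A"
    and enough_projectives: "A \<in> Ob C \<Longrightarrow> \<exists>P p. projective C P \<and> is_epi C P A p"
    and finitely_many_simples:
      "\<exists>S. finite S \<and> (\<forall>A. simple_object C A \<longrightarrow> (\<exists>B \<in> S. isomorphic C A B))"

definition linear_functor :: "('o, 'm, 'k, 'z) kcat_scheme \<Rightarrow> ('p, 'n, 'k, 'w) kcat_scheme \<Rightarrow>
    ('o, 'm, 'p, 'n, 'y) fctr_scheme \<Rightarrow> bool" where
  "linear_functor C D F \<longleftrightarrow> is_functor C D F \<and>
     (\<forall>A \<in> Ob C. \<forall>B \<in> Ob C. \<forall>f \<in> Hom C A B. \<forall>g \<in> Hom C A B.
        far F (f \<oplus>\<^bsub>C\<^esub> g) = far F f \<oplus>\<^bsub>D\<^esub> far F g) \<and>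
     (\<forall>A \<in> Ob C. \<forall>B \<in> Ob C. \<forall>f \<in> Hom C A B. \<forall>a.
        far F (a \<odot>\<^bsub>C\<^esub> f) = a \<odot>\<^bsub>D\<^esub> far F f)"

definition right_exact :: "('o, 'm, 'k, 'z) kcat_scheme \<Rightarrow> ('p, 'n, 'k, 'w) kcat_scheme \<Rightarrow>
    ('o, 'm, 'p, 'n, 'y) fctr_scheme \<Rightarrow> bool" where
  "right_exact C D F \<longleftrightarrow> linear_functor C D F \<and>
     (\<forall>A \<in> Ob C. \<forall>B \<in> Ob C. \<forall>f Q p. is_cokernel C A B f Q p \<longrightarrow>
        is_cokernel D (fob F A) (fob F B) (far F f) (fob F Q) (far F p))"

definition left_exact :: "('o, 'm, 'k, 'z) kcat_scheme \<Rightarrow> ('p, 'n, 'k, 'w) kcat_scheme \<Rightarrow>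
    ('o, 'm, 'p, 'n, 'y) fctr_scheme \<Rightarrow> bool" where
  "left_exact C D F \<longleftrightarrow> linear_functor C D F \<and>
     (\<forall>A \<in> Ob C. \<forall>B \<in> Ob C. \<forall>f K i. is_kernel C A B f K i \<longrightarrow>
        is_kernel D (fob F A) (fob F B) (far F f) (fob F K) (far F i))"

definition exact :: "('o, 'm, 'k, 'z) kcat_scheme \<Rightarrow> ('p, 'n, 'k, 'w) kcat_scheme \<Rightarrow>
    ('o, 'm, 'p, 'n, 'y) fctr_scheme \<Rightarrow> bool" where
  "exact C D F \<longleftrightarrow> left_exact C D F \<and> right_exact C D F"


section \<open>Tensor categories and centers\<close>

locale strict_monoidal_category = linear_category C
  for C :: "('o, 'm, 'k::field, 'z) monoidal_cat_scheme" (structure) +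
  assumes unit_closed: "\<one> \<in> Ob C"
    and tensor_ob_closed: "\<lbrakk>A \<in> Ob C; B \<in> Ob C\<rbrakk> \<Longrightarrow> A \<otimes> B \<in> Ob C"
    and tensor_arr_closed:
      "\<lbrakk>A \<in> Ob C; A' \<in> Ob C; B \<in> Ob C; B' \<in> Ob C; f \<in> Hom C A A'; g \<in> Hom C B B'\<rbrakk>
        \<Longrightarrow> f \<otimes>\<^sub>a g \<in> Hom C (A \<otimes> B) (A' \<otimes> B')"
    and tensor_ident:
      "\<lbrakk>A \<in> Ob C; B \<in> Ob C\<rbrakk> \<Longrightarrow> ident C A \<otimes>\<^sub>a ident C B = ident C (A \<otimes> B)"
    and tensor_comp:
      "\<lbrakk>A \<in> Ob C; A' \<in> Ob C; A'' \<in> Ob C; B \<in> Ob C; B' \<in> Ob C; B'' \<in> Ob C;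
        f \<in> Hom C A A'; f' \<in> Hom C A' A''; g \<in> Hom C B B'; g' \<in> Hom C B' B''\<rbrakk>
        \<Longrightarrow> (f' \<cdot> f) \<otimes>\<^sub>a (g' \<cdot> g) = (f' \<otimes>\<^sub>a g') \<cdot> (f \<otimes>\<^sub>a g)"
    and tensor_ob_assoc:
      "\<lbrakk>A \<in> Ob C; B \<in> Ob C; D \<in> Ob C\<rbrakk> \<Longrightarrow> (A \<otimes> B) \<otimes> D = A \<otimes> (B \<otimes> D)"
    and tensor_arr_assoc:
      "\<lbrakk>A \<in> Ob C; A' \<in> Ob C; B \<in> Ob C; B' \<in> Ob C; D \<in> Ob C; D' \<in> Ob C;
        f \<in> Hom C A A'; g \<in> Hom C B B'; h \<in> Hom C D D'\<rbrakk>
        \<Longrightarrow> (f \<otimes>\<^sub>a g) \<otimes>\<^sub>a h = f \<otimes>\<^sub>a (g \<otimes>\<^sub>a h)"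
    and unit_ob_left: "A \<in> Ob C \<Longrightarrow> \<one> \<otimes> A = A"
    and unit_ob_right: "A \<in> Ob C \<Longrightarrow> A \<otimes> \<one> = A"
    and unit_arr_left:
      "\<lbrakk>A \<in> Ob C; B \<in> Ob C; f \<in> Hom C A B\<rbrakk> \<Longrightarrow> ident C \<one> \<otimes>\<^sub>a f = f"
    and unit_arr_right:
      "\<lbrakk>A \<in> Ob C; B \<in> Ob C; f \<in> Hom C A B\<rbrakk> \<Longrightarrow> f \<otimes>\<^sub>a ident C \<one> = f"
    and tensor_add_left:
      "\<lbrakk>A \<in> Ob C; A' \<in> Ob C; B \<in> Ob C; B' \<in> Ob C;
        f \<in> Hom C A A'; f' \<in> Hom C A A'; g \<in> Hom C B B'\<rbrakk>
        \<Longrightarrow> (f \<oplus> f') \<otimes>\<^sub>a g = (f \<otimes>\<^sub>a g) \<oplus> (f' \<otimes>\<^sub>a g)"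
    and tensor_add_right:
      "\<lbrakk>A \<in> Ob C; A' \<in> Ob C; B \<in> Ob C; B' \<in> Ob C;
        f \<in> Hom C A A'; g \<in> Hom C B B'; g' \<in> Hom C B B'\<rbrakk>
        \<Longrightarrow> f \<otimes>\<^sub>a (g \<oplus> g') = (f \<otimes>\<^sub>a g) \<oplus> (f \<otimes>\<^sub>a g')"
    and tensor_scale_left:
      "\<lbrakk>A \<in> Ob C; A' \<in> Ob C; B \<in> Ob C; B' \<in> Ob C; f \<in> Hom C A A'; g \<in> Hom C B B'\<rbrakk>
        \<Longrightarrow> (a \<odot> f) \<otimes>\<^sub>a g = a \<odot> (f \<otimes>\<^sub>a g)"
    and tensor_scale_right:
      "\<lbrakk>A \<in> Ob C; A' \<in> Ob C; B \<in> Ob C; B' \<in> Ob C; f \<in> Hom C A A'; g \<in> Hom C B B'\<rbrakk>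
        \<Longrightarrow> f \<otimes>\<^sub>a (a \<odot> g) = a \<odot> (f \<otimes>\<^sub>a g)"

definition is_left_dual ::
  "('o, 'm, 'k, 'z) monoidal_cat_scheme \<Rightarrow> 'o \<Rightarrow> 'o \<Rightarrow> 'm \<Rightarrow> 'm \<Rightarrow> bool" where
  "is_left_dual C X D e b \<longleftrightarrow> D \<in> Ob C \<and>
     e \<in> Hom C (D \<otimes>\<^bsub>C\<^esub> X) \<one>\<^bsub>C\<^esub> \<and> b \<in> Hom C \<one>\<^bsub>C\<^esub> (X \<otimes>\<^bsub>C\<^esub> D) \<and>
     (ident C X \<otimes>\<^sub>a\<^bsub>C\<^esub> e) \<cdot>\<^bsub>C\<^esub> (b \<otimes>\<^sub>a\<^bsub>C\<^esub> ident C X) = ident C X \<and>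
     (e \<otimes>\<^sub>a\<^bsub>C\<^esub> ident C D) \<cdot>\<^bsub>C\<^esub> (ident C D \<otimes>\<^sub>a\<^bsub>C\<^esub> b) = ident C D"

text \<open>A right dual of \<open>X\<close> is an object of which \<open>X\<close> is a left dual.\<close>

locale tensor_category = strict_monoidal_category C + finite_abelian_category C
  for C :: "('o, 'm, 'k::alg_closed_field, 'z) tensor_cat_scheme" (structure) +
  assumes left_dual: "X \<in> Ob C \<Longrightarrow> is_left_dual C X (dual C X) (ev C X) (coev C X)"
    and right_dual: "X \<in> Ob C \<Longrightarrow> \<exists>D \<in> Ob C. \<exists>e b. is_left_dual C D X e b"
    and unit_simple: "simple_object C \<one>"

locale braided_tensor_category = tensor_category C
  for C :: "('o, 'm, 'k::alg_closed_field, 'z) tensor_cat_scheme" (structure)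
    and br :: "'o \<Rightarrow> 'o \<Rightarrow> 'm" +
  assumes br_iso: "\<lbrakk>A \<in> Ob C; B \<in> Ob C\<rbrakk> \<Longrightarrow> is_iso C (A \<otimes> B) (B \<otimes> A) (br A B)"
    and br_natural:
      "\<lbrakk>A \<in> Ob C; A' \<in> Ob C; B \<in> Ob C; B' \<in> Ob C; f \<in> Hom C A A'; g \<in> Hom C B B'\<rbrakk>
        \<Longrightarrow> (g \<otimes>\<^sub>a f) \<cdot> br A B = br A' B' \<cdot> (f \<otimes>\<^sub>a g)"
    and br_tensor_left:
      "\<lbrakk>A \<in> Ob C; B \<in> Ob C; D \<in> Ob C\<rbrakk>
        \<Longrightarrow> br (A \<otimes> B) D = (br A D \<otimes>\<^sub>a ident C B) \<cdot> (ident C A \<otimes>\<^sub>a br B D)"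
    and br_tensor_right:
      "\<lbrakk>A \<in> Ob C; B \<in> Ob C; D \<in> Ob C\<rbrakk>
        \<Longrightarrow> br A (B \<otimes> D) = (ident C B \<otimes>\<^sub>a br A D) \<cdot> (br A B \<otimes>\<^sub>a ident C D)"

definition half_braiding ::
  "('o, 'm, 'k, 'z) monoidal_cat_scheme \<Rightarrow> 'o \<Rightarrow> ('o \<Rightarrow> 'm) \<Rightarrow> bool" where
  "half_braiding C A s \<longleftrightarrow> s \<in> extensional (Ob C) \<and>
     (\<forall>X \<in> Ob C. is_iso C (A \<otimes>\<^bsub>C\<^esub> X) (X \<otimes>\<^bsub>C\<^esub> A) (s X)) \<and>
     (\<forall>X \<in> Ob C. \<forall>Y \<in> Ob C. \<forall>f \<in> Hom C X Y.
        (f \<otimes>\<^sub>a\<^bsub>C\<^esub> ident C A) \<cdot>\<^bsub>C\<^esub> s X = s Y \<cdot>\<^bsub>C\<^esub> (ident C A \<otimes>\<^sub>a\<^bsub>C\<^esub> f)) \<and>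
     (\<forall>X \<in> Ob C. \<forall>Y \<in> Ob C.
        s (X \<otimes>\<^bsub>C\<^esub> Y) = (ident C X \<otimes>\<^sub>a\<^bsub>C\<^esub> s Y) \<cdot>\<^bsub>C\<^esub> (s X \<otimes>\<^sub>a\<^bsub>C\<^esub> ident C Y))"

text \<open>The center as a (linear, strict) monoidal category; the half-braiding of
  \<open>A \<otimes> B\<close> is \<open>(\<sigma>\<^sub>A \<otimes> B)(A \<otimes> \<sigma>\<^sub>B)\<close>.\<close>

definition center :: "('o, 'm, 'k, 'z) monoidal_cat_scheme \<Rightarrow>
    ('o \<times> ('o \<Rightarrow> 'm), 'm, 'k) monoidal_cat" where
  "center C = \<lparr>
     Ob = {(A, s). A \<in> Ob C \<and> half_braiding C A s},
     Hom = (\<lambda>(A, s) (B, t). {f \<in> Hom C A B. \<forall>X \<in> Ob C.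
        (ident C X \<otimes>\<^sub>a\<^bsub>C\<^esub> f) \<cdot>\<^bsub>C\<^esub> s X = t X \<cdot>\<^bsub>C\<^esub> (f \<otimes>\<^sub>a\<^bsub>C\<^esub> ident C X)}),
     ident = (\<lambda>(A, s). ident C A),
     comp_arr = comp_arr C,
     add_arr = add_arr C,
     zero_arr = (\<lambda>(A, s) (B, t). zero_arr C A B),
     scale_arr = scale_arr C,
     tensor_ob = (\<lambda>(A, s) (B, t). (A \<otimes>\<^bsub>C\<^esub> B,
        (\<lambda>X \<in> Ob C. (s X \<otimes>\<^sub>a\<^bsub>C\<^esub> ident C B) \<cdot>\<^bsub>C\<^esub> (ident C A \<otimes>\<^sub>a\<^bsub>C\<^esub> t X)))),
     tensor_arr = tensor_arr C,
     unit_ob = (\<one>\<^bsub>C\<^esub>, (\<lambda>X \<in> Ob C. ident C X))\<rparr>"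

definition center_braiding ::
  "'o \<times> ('o \<Rightarrow> 'm) \<Rightarrow> 'o \<times> ('o \<Rightarrow> 'm) \<Rightarrow> 'm" where
  "center_braiding A B = snd A (fst B)"

text \<open>Strong monoidal functors: \<open>mu V W : G V \<otimes> G W \<rightarrow> G (V \<otimes> W)\<close> and
  \<open>eps : \<one> \<rightarrow> G \<one>\<close>.\<close>

record ('o, 'm, 'p, 'n) mon_fctr = "('o, 'm, 'p, 'n) fctr" +
  mu :: "'o \<Rightarrow> 'o \<Rightarrow> 'n"
  eps :: "'n"

definition monoidal_functor ::
  "('o, 'm, 'k, 'z) monoidal_cat_scheme \<Rightarrow> ('p, 'n, 'l, 'w) monoidal_cat_scheme \<Rightarrow>
    ('o, 'm, 'p, 'n, 'y) mon_fctr_scheme \<Rightarrow> bool" where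
  "monoidal_functor V D G \<longleftrightarrow> is_functor V D G \<and>
     (\<forall>X \<in> Ob V. \<forall>Y \<in> Ob V.
        is_iso D (fob G X \<otimes>\<^bsub>D\<^esub> fob G Y) (fob G (X \<otimes>\<^bsub>V\<^esub> Y)) (mu G X Y)) \<and>
     is_iso D \<one>\<^bsub>D\<^esub> (fob G \<one>\<^bsub>V\<^esub>) (eps G) \<and>
     (\<forall>X \<in> Ob V. \<forall>X' \<in> Ob V. \<forall>Y \<in> Ob V. \<forall>Y' \<in> Ob V. \<forall>f \<in> Hom V X X'. \<forall>g \<in> Hom V Y Y'.
        far G (f \<otimes>\<^sub>a\<^bsub>V\<^esub> g) \<cdot>\<^bsub>D\<^esub> mu G X Y = mu G X' Y' \<cdot>\<^bsub>D\<^esub> (far G f \<otimes>\<^sub>a\<^bsub>D\<^esub> far G g)) \<and>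
     (\<forall>X \<in> Ob V. \<forall>Y \<in> Ob V. \<forall>Z \<in> Ob V.
        mu G (X \<otimes>\<^bsub>V\<^esub> Y) Z \<cdot>\<^bsub>D\<^esub> (mu G X Y \<otimes>\<^sub>a\<^bsub>D\<^esub> ident D (fob G Z)) =
        mu G X (Y \<otimes>\<^bsub>V\<^esub> Z) \<cdot>\<^bsub>D\<^esub> (ident D (fob G X) \<otimes>\<^sub>a\<^bsub>D\<^esub> mu G Y Z)) \<and>
     (\<forall>X \<in> Ob V.
        mu G \<one>\<^bsub>V\<^esub> X \<cdot>\<^bsub>D\<^esub> (eps G \<otimes>\<^sub>a\<^bsub>D\<^esub> ident D (fob G X)) = ident D (fob G X) \<and>
        mu G X \<one>\<^bsub>V\<^esub> \<cdot>\<^bsub>D\<^esub> (ident D (fob G X) \<otimes>\<^sub>a\<^bsub>D\<^esub> eps G) = ident D (fob G X))"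

definition braided_functor ::
  "('o, 'm, 'k, 'z) monoidal_cat_scheme \<Rightarrow> ('o \<Rightarrow> 'o \<Rightarrow> 'm) \<Rightarrow>
    ('p, 'n, 'l, 'w) monoidal_cat_scheme \<Rightarrow> ('p \<Rightarrow> 'p \<Rightarrow> 'n) \<Rightarrow>
    ('o, 'm, 'p, 'n, 'y) mon_fctr_scheme \<Rightarrow> bool" where
  "braided_functor V brV D brD G \<longleftrightarrow> monoidal_functor V D G \<and>
     (\<forall>X \<in> Ob V. \<forall>Y \<in> Ob V.
        far G (brV X Y) \<cdot>\<^bsub>D\<^esub> mu G X Y = mu G Y X \<cdot>\<^bsub>D\<^esub> brD (fob G X) (fob G Y))"

definition central_via ::
  "('vo, 'vm, 'k, 'z) monoidal_cat_scheme \<Rightarrow> ('vo \<Rightarrow> 'vo \<Rightarrow> 'vm) \<Rightarrow>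
    ('co, 'cm, 'k, 'w) monoidal_cat_scheme \<Rightarrow>
    ('vo, 'vm, 'co \<times> ('co \<Rightarrow> 'cm), 'cm) mon_fctr \<Rightarrow> bool" where
  "central_via V br C G \<longleftrightarrow> braided_functor V br (center C) center_braiding G \<and> faithful V G"

definition relative_center ::
  "('vo, 'vm, 'k, 'z) monoidal_cat_scheme \<Rightarrow> ('co, 'cm, 'k, 'w) monoidal_cat_scheme \<Rightarrow>
    ('vo, 'vm, 'co \<times> ('co \<Rightarrow> 'cm), 'cm) mon_fctr \<Rightarrow>
    ('co \<times> ('co \<Rightarrow> 'cm), 'cm, 'k) monoidal_cat" where
  "relative_center V C G = full_subcategory (center C) (\<lambda>A. \<forall>v \<in> Ob V.
     center_braiding (fob G v) A \<cdot>\<^bsub>C\<^esub> center_braiding A (fob G v)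
       = ident C (fst A \<otimes>\<^bsub>C\<^esub> fst (fob G v)))"


section \<open>Module categories and module functors\<close>

text \<open>The associativity isomorphism \<open>massoc X Y m : (X \<otimes> Y) \<rhd> m \<rightarrow> X \<rhd> (Y \<rhd> m)\<close> and the unit
  isomorphism \<open>munit m : \<one> \<rhd> m \<rightarrow> m\<close> are part of the data.\<close>

record ('co, 'cm, 'mo, 'mm) action =
  act_ob :: "'co \<Rightarrow> 'mo \<Rightarrow> 'mo" (infixr "\<rhd>\<index>" 75)
  act_arr :: "'cm \<Rightarrow> 'mm \<Rightarrow> 'mm" (infixr "\<rhd>\<^sub>a\<index>" 75)
  massoc :: "'co \<Rightarrow> 'co \<Rightarrow> 'mo \<Rightarrow> 'mm"
  munit :: "'mo \<Rightarrow> 'mm"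

definition act_by :: "('co, 'cm, 'z) cat_scheme \<Rightarrow> ('co, 'cm, 'mo, 'mm) action \<Rightarrow> 'co \<Rightarrow>
    ('mo, 'mm, 'mo, 'mm) fctr" where
  "act_by C a X = \<lparr>fob = (\<lambda>m. X \<rhd>\<^bsub>a\<^esub> m), far = (\<lambda>f. ident C X \<rhd>\<^sub>a\<^bsub>a\<^esub> f)\<rparr>"

definition act_on :: "('mo, 'mm, 'z) cat_scheme \<Rightarrow> ('co, 'cm, 'mo, 'mm) action \<Rightarrow> 'mo \<Rightarrow>
    ('co, 'cm, 'mo, 'mm) fctr" where
  "act_on M a m = \<lparr>fob = (\<lambda>X. X \<rhd>\<^bsub>a\<^esub> m), far = (\<lambda>g. g \<rhd>\<^sub>a\<^bsub>a\<^esub> ident M m)\<rparr>"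

text \<open>Linearity in each variable is part of exactness.\<close>

locale module_category = finite_abelian_category M
  for C :: "('co, 'cm, 'k::field, 'z) monoidal_cat_scheme"
    and M :: "('mo, 'mm, 'k, 'w) kcat_scheme"
    and a :: "('co, 'cm, 'mo, 'mm) action" (structure) +
  assumes act_ob_closed: "\<lbrakk>X \<in> Ob C; m \<in> Ob M\<rbrakk> \<Longrightarrow> X \<rhd> m \<in> Ob M"
    and act_arr_closed:
      "\<lbrakk>X \<in> Ob C; Y \<in> Ob C; m \<in> Ob M; n \<in> Ob M; g \<in> Hom C X Y; f \<in> Hom M m n\<rbrakk>
        \<Longrightarrow> g \<rhd>\<^sub>a f \<in> Hom M (X \<rhd> m) (Y \<rhd> n)"
    and act_ident:
      "\<lbrakk>X \<in> Ob C; m \<in> Ob M\<rbrakk> \<Longrightarrow> ident C X \<rhd>\<^sub>a ident M m = ident M (X \<rhd> m)"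
    and act_comp:
      "\<lbrakk>X \<in> Ob C; X' \<in> Ob C; X'' \<in> Ob C; m \<in> Ob M; m' \<in> Ob M; m'' \<in> Ob M;
        g \<in> Hom C X X'; g' \<in> Hom C X' X''; f \<in> Hom M m m'; f' \<in> Hom M m' m''\<rbrakk>
        \<Longrightarrow> (g' \<cdot>\<^bsub>C\<^esub> g) \<rhd>\<^sub>a (f' \<cdot>\<^bsub>M\<^esub> f) = (g' \<rhd>\<^sub>a f') \<cdot>\<^bsub>M\<^esub> (g \<rhd>\<^sub>a f)"
    and act_by_exact: "X \<in> Ob C \<Longrightarrow> exact M M (act_by C a X)"
    and act_on_exact: "m \<in> Ob M \<Longrightarrow> exact C M (act_on M a m)"
    and massoc_iso:
      "\<lbrakk>X \<in> Ob C; Y \<in> Ob C; m \<in> Ob M\<rbrakk>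
        \<Longrightarrow> is_iso M ((X \<otimes>\<^bsub>C\<^esub> Y) \<rhd> m) (X \<rhd> (Y \<rhd> m)) (massoc a X Y m)"
    and massoc_natural:
      "\<lbrakk>X \<in> Ob C; X' \<in> Ob C; Y \<in> Ob C; Y' \<in> Ob C; m \<in> Ob M; m' \<in> Ob M;
        g \<in> Hom C X X'; h \<in> Hom C Y Y'; f \<in> Hom M m m'\<rbrakk>
        \<Longrightarrow> massoc a X' Y' m' \<cdot>\<^bsub>M\<^esub> ((g \<otimes>\<^sub>a\<^bsub>C\<^esub> h) \<rhd>\<^sub>a f) = (g \<rhd>\<^sub>a (h \<rhd>\<^sub>a f)) \<cdot>\<^bsub>M\<^esub> massoc a X Y m"
    and munit_iso: "m \<in> Ob M \<Longrightarrow> is_iso M (\<one>\<^bsub>C\<^esub> \<rhd> m) m (munit a m)"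
    and munit_natural:
      "\<lbrakk>m \<in> Ob M; n \<in> Ob M; f \<in> Hom M m n\<rbrakk>
        \<Longrightarrow> munit a n \<cdot>\<^bsub>M\<^esub> (ident C \<one>\<^bsub>C\<^esub> \<rhd>\<^sub>a f) = f \<cdot>\<^bsub>M\<^esub> munit a m"
    and pentagon:
      "\<lbrakk>X \<in> Ob C; Y \<in> Ob C; Z \<in> Ob C; m \<in> Ob M\<rbrakk>
        \<Longrightarrow> (ident C X \<rhd>\<^sub>a massoc a Y Z m) \<cdot>\<^bsub>M\<^esub> massoc a X (Y \<otimes>\<^bsub>C\<^esub> Z) m
          = massoc a X Y (Z \<rhd> m) \<cdot>\<^bsub>M\<^esub> massoc a (X \<otimes>\<^bsub>C\<^esub> Y) Z m"
    and triangle: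
      "\<lbrakk>X \<in> Ob C; m \<in> Ob M\<rbrakk>
        \<Longrightarrow> (ident C X \<rhd>\<^sub>a munit a m) \<cdot>\<^bsub>M\<^esub> massoc a X \<one>\<^bsub>C\<^esub> m = ident M (X \<rhd> m)"

definition module_functor ::
  "('co, 'cm, 'k, 'z) monoidal_cat_scheme \<Rightarrow> ('mo, 'mm, 'k, 'w) kcat_scheme \<Rightarrow>
    ('co, 'cm, 'mo, 'mm) action \<Rightarrow> ('mo, 'mm, 'mo, 'mm) fctr \<Rightarrow>
    ('co \<Rightarrow> 'mo \<Rightarrow> 'mm) \<Rightarrow> bool" where
  "module_functor C M a F c \<longleftrightarrow> right_exact M M F \<and>
     (\<forall>X \<in> Ob C. \<forall>m \<in> Ob M. is_iso M (fob F (X \<rhd>\<^bsub>a\<^esub> m)) (X \<rhd>\<^bsub>a\<^esub> fob F m) (c X m)) \<and>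
     (\<forall>X \<in> Ob C. \<forall>Y \<in> Ob C. \<forall>m \<in> Ob M. \<forall>n \<in> Ob M. \<forall>g \<in> Hom C X Y. \<forall>f \<in> Hom M m n.
        c Y n \<cdot>\<^bsub>M\<^esub> far F (g \<rhd>\<^sub>a\<^bsub>a\<^esub> f) = (g \<rhd>\<^sub>a\<^bsub>a\<^esub> far F f) \<cdot>\<^bsub>M\<^esub> c X m) \<and>
     (\<forall>X \<in> Ob C. \<forall>Y \<in> Ob C. \<forall>m \<in> Ob M.
        massoc a X Y (fob F m) \<cdot>\<^bsub>M\<^esub> c (X \<otimes>\<^bsub>C\<^esub> Y) m
          = (ident C X \<rhd>\<^sub>a\<^bsub>a\<^esub> c Y m) \<cdot>\<^bsub>M\<^esub> c X (Y \<rhd>\<^bsub>a\<^esub> m) \<cdot>\<^bsub>M\<^esub> far F (massoc a X Y m)) \<and>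
     (\<forall>m \<in> Ob M. munit a (fob F m) \<cdot>\<^bsub>M\<^esub> c \<one>\<^bsub>C\<^esub> m = far F (munit a m))"


section \<open>Internal Homs and relative ends\<close>

text \<open>\<open>phi X m n : Hom\<^sub>C(X, H m n) \<rightarrow> Hom\<^sub>M(X \<rhd> m, n)\<close>, natural in \<open>X\<close>. Naturality in \<open>m\<close> and \<open>n\<close>
  holds by definition of the action of \<open>H\<close> on arrows, see \<open>ihom_cov\<close> and \<open>ihom_con\<close>.\<close>

definition internal_hom ::
  "('co, 'cm, 'k, 'z) monoidal_cat_scheme \<Rightarrow> ('mo, 'mm, 'k, 'w) kcat_scheme \<Rightarrow>
    ('co, 'cm, 'mo, 'mm) action \<Rightarrow> ('mo \<Rightarrow> 'mo \<Rightarrow> 'co) \<Rightarrow>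
    ('co \<Rightarrow> 'mo \<Rightarrow> 'mo \<Rightarrow> 'cm \<Rightarrow> 'mm) \<Rightarrow> bool" where
  "internal_hom C M a H phi \<longleftrightarrow> (\<forall>m \<in> Ob M. \<forall>n \<in> Ob M. H m n \<in> Ob C \<and>
     (\<forall>X \<in> Ob C. bij_betw (phi X m n) (Hom C X (H m n)) (Hom M (X \<rhd>\<^bsub>a\<^esub> m) n)) \<and>
     (\<forall>X \<in> Ob C. \<forall>Y \<in> Ob C. \<forall>g \<in> Hom C Y X. \<forall>f \<in> Hom C X (H m n).
        phi Y m n (f \<cdot>\<^bsub>C\<^esub> g) = phi X m n f \<cdot>\<^bsub>M\<^esub> (g \<rhd>\<^sub>a\<^bsub>a\<^esub> ident M m)))"

text \<open>
  In the following two definitions a functor \<open>S : M\<^sup>o\<^sup>p \<times> M \<rightarrow> A\<close> is given by its values \<open>S m n\<close> on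
  objects and by its actions on arrows in each variable,
  \<open>Scon m' m n g : S m n \<rightarrow> S m' n\<close> for \<open>g : m' \<rightarrow> m\<close> and
  \<open>Scov m n n' f : S m n \<rightarrow> S m n'\<close> for \<open>f : n \<rightarrow> n'\<close>.
  The arrows \<open>evact v m : v\<^sup>* \<rhd> (v \<rhd> m) \<rightarrow> m\<close> are \<open>ev\<^sub>v \<rhd> id\<^sub>m\<close>, and the prebalancing consists of
  \<open>\<beta> v m n : S m (v \<rhd> n) \<rightarrow> S (v\<^sup>* \<rhd> m) n\<close>. The universal property makes sense for arbitrary
  families \<open>\<beta>\<close>; that \<open>\<beta>\<close> is a natural isomorphism is not part of the definitions.
\<close>

definition relative_wedge ::
  "('vo, 'vm, 'k, 'z) tensor_cat_scheme \<Rightarrow> ('mo, 'mm, 'k, 'w) kcat_scheme \<Rightarrow>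
    ('vo, 'vm, 'mo, 'mm) action \<Rightarrow> ('vo \<Rightarrow> 'mo \<Rightarrow> 'mm) \<Rightarrow> ('ao, 'am, 'k, 'u) kcat_scheme \<Rightarrow>
    ('mo \<Rightarrow> 'mo \<Rightarrow> 'ao) \<Rightarrow> ('mo \<Rightarrow> 'mo \<Rightarrow> 'mo \<Rightarrow> 'mm \<Rightarrow> 'am) \<Rightarrow>
    ('mo \<Rightarrow> 'mo \<Rightarrow> 'mo \<Rightarrow> 'mm \<Rightarrow> 'am) \<Rightarrow> ('vo \<Rightarrow> 'mo \<Rightarrow> 'mo \<Rightarrow> 'am) \<Rightarrow>
    'ao \<Rightarrow> ('mo \<Rightarrow> 'am) \<Rightarrow> bool" where
  "relative_wedge V M a evact A S Scon Scov \<beta> E p \<longleftrightarrow> E \<in> Ob A \<and>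
     (\<forall>m \<in> Ob M. p m \<in> Hom A E (S m m)) \<and>
     (\<forall>m \<in> Ob M. \<forall>n \<in> Ob M. \<forall>f \<in> Hom M m n.
        Scov m m n f \<cdot>\<^bsub>A\<^esub> p m = Scon m n n f \<cdot>\<^bsub>A\<^esub> p n) \<and>
     (\<forall>v \<in> Ob V. \<forall>m \<in> Ob M.
        Scon (dual V v \<rhd>\<^bsub>a\<^esub> (v \<rhd>\<^bsub>a\<^esub> m)) m m (evact v m) \<cdot>\<^bsub>A\<^esub> p m
          = \<beta> v (v \<rhd>\<^bsub>a\<^esub> m) m \<cdot>\<^bsub>A\<^esub> p (v \<rhd>\<^bsub>a\<^esub> m))"

definition relative_end ::
  "('vo, 'vm, 'k, 'z) tensor_cat_scheme \<Rightarrow> ('mo, 'mm, 'k, 'w) kcat_scheme \<Rightarrow>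
    ('vo, 'vm, 'mo, 'mm) action \<Rightarrow> ('vo \<Rightarrow> 'mo \<Rightarrow> 'mm) \<Rightarrow> ('ao, 'am, 'k, 'u) kcat_scheme \<Rightarrow>
    ('mo \<Rightarrow> 'mo \<Rightarrow> 'ao) \<Rightarrow> ('mo \<Rightarrow> 'mo \<Rightarrow> 'mo \<Rightarrow> 'mm \<Rightarrow> 'am) \<Rightarrow>
    ('mo \<Rightarrow> 'mo \<Rightarrow> 'mo \<Rightarrow> 'mm \<Rightarrow> 'am) \<Rightarrow> ('vo \<Rightarrow> 'mo \<Rightarrow> 'mo \<Rightarrow> 'am) \<Rightarrow>
    'ao \<Rightarrow> ('mo \<Rightarrow> 'am) \<Rightarrow> bool" where
  "relative_end V M a evact A S Scon Scov \<beta> E p \<longleftrightarrow>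
     relative_wedge V M a evact A S Scon Scov \<beta> E p \<and>
     (\<forall>E' p'. relative_wedge V M a evact A S Scon Scov \<beta> E' p' \<longrightarrow>
        (\<exists>!u. u \<in> Hom A E' E \<and> (\<forall>m \<in> Ob M. p' m = p m \<cdot>\<^bsub>A\<^esub> u)))"


section \<open>The functor \<open>\<rho>\<close>-bar and its lift to centers\<close>

text \<open>
  An object of \<open>End\<^sub>V(M)\<close> is a pair \<open>(F, d)\<close>, and an arrow is a triple \<open>(A, \<alpha>, B)\<close> of its source,
  its family of components, and its target. The values of \<open>F\<close> and \<open>d\<close> outside the carriers are
  not normalised; this only produces isomorphic copies of objects.
\<close>

type_synonym ('vo, 'mo, 'mm) vfun = "('mo, 'mm, 'mo, 'mm) fctr \<times> ('vo \<Rightarrow> 'mo \<Rightarrow> 'mm)"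

type_synonym ('vo, 'mo, 'mm) varr =
  "('vo, 'mo, 'mm) vfun \<times> ('mo \<Rightarrow> 'mm) \<times> ('vo, 'mo, 'mm) vfun"

type_synonym ('co, 'vo, 'mo, 'mm) cvfun =
  "('mo, 'mm, 'mo, 'mm) fctr \<times> ('co \<Rightarrow> 'mo \<Rightarrow> 'mm) \<times> ('vo \<Rightarrow> 'mo \<Rightarrow> 'mm)"

type_synonym ('co, 'vo, 'mo, 'mm) cvarr =
  "('co, 'vo, 'mo, 'mm) cvfun \<times> ('mo \<Rightarrow> 'mm) \<times> ('co, 'vo, 'mo, 'mm) cvfun"

context
  fixes V :: "('vo, 'vm, 'k) tensor_cat"
    and C :: "('co, 'cm, 'k) tensor_cat"
    and G :: "('vo, 'vm, 'co \<times> ('co \<Rightarrow> 'cm), 'cm) mon_fctr"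
    and M :: "('mo, 'mm, 'k) kcat"
    and a :: "('co, 'cm, 'mo, 'mm) action"
begin

abbreviation (input) gob :: "'vo \<Rightarrow> 'co" where
  "gob v \<equiv> fst (fob G v)"

text \<open>The action \<open>v \<rhd> m = G(v) \<rhd> m\<close>; as \<open>G\<close> is only strong monoidal, its associativity and unit
  isomorphisms involve \<open>mu\<close> and \<open>eps\<close>.\<close>

definition V_action :: "('vo, 'vm, 'mo, 'mm) action" where
  "V_action = \<lparr>
     act_ob = (\<lambda>v m. gob v \<rhd>\<^bsub>a\<^esub> m),
     act_arr = (\<lambda>g f. far G g \<rhd>\<^sub>a\<^bsub>a\<^esub> f),
     massoc = (\<lambda>v w m. massoc a (gob v) (gob w) m \<cdot>\<^bsub>M\<^esub>
       (inv_arr C (gob v \<otimes>\<^bsub>C\<^esub> gob w) (gob (v \<otimes>\<^bsub>V\<^esub> w)) (mu G v w) \<rhd>\<^sub>a\<^bsub>a\<^esub> ident M m)),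
     munit = (\<lambda>m. munit a m \<cdot>\<^bsub>M\<^esub>
       (inv_arr C \<one>\<^bsub>C\<^esub> (gob \<one>\<^bsub>V\<^esub>) (eps G) \<rhd>\<^sub>a\<^bsub>a\<^esub> ident M m))\<rparr>"

text \<open>\<open>\<sigma>\<^sub>G\<^sub>(\<^sub>v\<^sub>)\<^sub>,\<^sub>X\<^sup>-\<^sup>1 \<rhd> id\<^sub>m\<close>, as an arrow \<open>X \<rhd> (G(v) \<rhd> m) \<rightarrow> G(v) \<rhd> (X \<rhd> m)\<close>.\<close>

definition swap :: "'vo \<Rightarrow> 'co \<Rightarrow> 'mo \<Rightarrow> 'mm" where
  "swap v X m = massoc a (gob v) X m \<cdot>\<^bsub>M\<^esub>
     (inv_arr C (gob v \<otimes>\<^bsub>C\<^esub> X) (X \<otimes>\<^bsub>C\<^esub> gob v) (snd (fob G v) X) \<rhd>\<^sub>a\<^bsub>a\<^esub> ident M m) \<cdot>\<^bsub>M\<^esub>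
     inv_arr M ((X \<otimes>\<^bsub>C\<^esub> gob v) \<rhd>\<^bsub>a\<^esub> m) (X \<rhd>\<^bsub>a\<^esub> (gob v \<rhd>\<^bsub>a\<^esub> m)) (massoc a X (gob v) m)"

text \<open>Under the identification \<open>G(v\<^sup>*) = G(v)\<^sup>*\<close>, the evaluation of \<open>G(v)\<close> is the image of
  \<open>ev\<^sub>v\<close>: \<open>G(v\<^sup>*) \<otimes> G(v) \<rightarrow> G(v\<^sup>* \<otimes> v) \<rightarrow> G(\<one>) \<rightarrow> \<one>\<close>.\<close>

definition ev_G :: "'vo \<Rightarrow> 'cm" where
  "ev_G v = inv_arr C \<one>\<^bsub>C\<^esub> (gob \<one>\<^bsub>V\<^esub>) (eps G) \<cdot>\<^bsub>C\<^esub> far G (ev V v) \<cdot>\<^bsub>C\<^esub> mu G (dual V v) v"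

text \<open>\<open>ev\<^sub>G\<^sub>(\<^sub>v\<^sub>) \<rhd> id\<^sub>m\<close>, as an arrow \<open>G(v\<^sup>*) \<rhd> (G(v) \<rhd> m) \<rightarrow> m\<close>.\<close>

definition ev_act :: "'vo \<Rightarrow> 'mo \<Rightarrow> 'mm" where
  "ev_act v m = munit a m \<cdot>\<^bsub>M\<^esub> (ev_G v \<rhd>\<^sub>a\<^bsub>a\<^esub> ident M m) \<cdot>\<^bsub>M\<^esub>
     inv_arr M ((gob (dual V v) \<otimes>\<^bsub>C\<^esub> gob v) \<rhd>\<^bsub>a\<^esub> m) (gob (dual V v) \<rhd>\<^bsub>a\<^esub> (gob v \<rhd>\<^bsub>a\<^esub> m))
       (massoc a (gob (dual V v)) (gob v) m)"

definition End_V :: "(('vo, 'mo, 'mm) vfun, ('vo, 'mo, 'mm) varr) cat" where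
  "End_V = \<lparr>
     Ob = {(F, d). module_functor V M V_action F d},
     Hom = (\<lambda>A B. {(A, \<alpha>, B) | \<alpha>. \<alpha> \<in> extensional (Ob M) \<and>
       (\<forall>m \<in> Ob M. \<alpha> m \<in> Hom M (fob (fst A) m) (fob (fst B) m)) \<and>
       (\<forall>m \<in> Ob M. \<forall>n \<in> Ob M. \<forall>f \<in> Hom M m n.
          \<alpha> n \<cdot>\<^bsub>M\<^esub> far (fst A) f = far (fst B) f \<cdot>\<^bsub>M\<^esub> \<alpha> m) \<and>
       (\<forall>v \<in> Ob V. \<forall>m \<in> Ob M.
          snd B v m \<cdot>\<^bsub>M\<^esub> \<alpha> (gob v \<rhd>\<^bsub>a\<^esub> m) = (ident C (gob v) \<rhd>\<^sub>a\<^bsub>a\<^esub> \<alpha> m) \<cdot>\<^bsub>M\<^esub> snd A v m)}),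
     ident = (\<lambda>A. (A, (\<lambda>m \<in> Ob M. ident M (fob (fst A) m)), A)),
     comp_arr = (\<lambda>(B', \<beta>, D) (A, \<alpha>, B). (A, (\<lambda>m \<in> Ob M. \<beta> m \<cdot>\<^bsub>M\<^esub> \<alpha> m), D))\<rparr>"

text \<open>The \<open>C\<close>-bimodule structure \<open>X \<rhd> (F, d)\<close> and \<open>(F, d) \<lhd> X\<close> on \<open>End\<^sub>V(M)\<close>, and
  \<open>\<rho> : C \<rightarrow> End\<^sub>V(M)\<close> (on objects).\<close>

definition left_act :: "'co \<Rightarrow> ('vo, 'mo, 'mm) vfun \<Rightarrow> ('vo, 'mo, 'mm) vfun" where
  "left_act X = (\<lambda>(F, d).
     (\<lparr>fob = (\<lambda>m. X \<rhd>\<^bsub>a\<^esub> fob F m), far = (\<lambda>f. ident C X \<rhd>\<^sub>a\<^bsub>a\<^esub> far F f)\<rparr>,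
      \<lambda>v m. swap v X (fob F m) \<cdot>\<^bsub>M\<^esub> (ident C X \<rhd>\<^sub>a\<^bsub>a\<^esub> d v m)))"

definition right_act :: "('vo, 'mo, 'mm) vfun \<Rightarrow> 'co \<Rightarrow> ('vo, 'mo, 'mm) vfun" where
  "right_act = (\<lambda>(F, d) X.
     (\<lparr>fob = (\<lambda>m. fob F (X \<rhd>\<^bsub>a\<^esub> m)), far = (\<lambda>f. far F (ident C X \<rhd>\<^sub>a\<^bsub>a\<^esub> f))\<rparr>,
      \<lambda>v m. d v (X \<rhd>\<^bsub>a\<^esub> m) \<cdot>\<^bsub>M\<^esub> far F (swap v X m)))"

definition rho :: "'co \<Rightarrow> ('vo, 'mo, 'mm) vfun" where
  "rho X = (act_by C a X, \<lambda>v m. swap v X m)"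

text \<open>An object of \<open>Z\<^sub>C(End\<^sub>V(M))\<close> is written as a triple \<open>(F, c, d)\<close>; its half-braiding is the family
  of arrows \<open>c X : (F, d) \<lhd> X \<rightarrow> X \<rhd> (F, d)\<close> of \<open>End\<^sub>V(M)\<close>, whose multiplicativity is the
  associativity axiom of the \<open>C\<close>-module functor \<open>(F, c)\<close>.\<close>

definition Z_End ::
  "(('co, 'vo, 'mo, 'mm) cvfun, ('co, 'vo, 'mo, 'mm) cvarr) cat" where
  "Z_End = \<lparr>
     Ob = {(F, c, d). (F, d) \<in> Ob End_V \<and> module_functor C M a F c \<and>
       (\<forall>X \<in> Ob C. (right_act (F, d) X, restrict (c X) (Ob M), left_act X (F, d))
          \<in> Hom End_V (right_act (F, d) X) (left_act X (F, d)))},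
     Hom = (\<lambda>(F, c, d) (F', c', d'). {((F, c, d), \<alpha>, (F', c', d')) | \<alpha>.
       ((F, d), \<alpha>, (F', d')) \<in> Hom End_V (F, d) (F', d') \<and>
       (\<forall>X \<in> Ob C. \<forall>m \<in> Ob M.
          c' X m \<cdot>\<^bsub>M\<^esub> \<alpha> (X \<rhd>\<^bsub>a\<^esub> m) = (ident C X \<rhd>\<^sub>a\<^bsub>a\<^esub> \<alpha> m) \<cdot>\<^bsub>M\<^esub> c X m)}),
     ident = (\<lambda>A. (A, (\<lambda>m \<in> Ob M. ident M (fob (fst A) m)), A)),
     comp_arr = (\<lambda>(B', \<beta>, D) (A, \<alpha>, B). (A, (\<lambda>m \<in> Ob M. \<beta> m \<cdot>\<^bsub>M\<^esub> \<alpha> m), D))\<rparr>"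

definition C_VM ::
  "(('co, 'vo, 'mo, 'mm) cvfun, ('co, 'vo, 'mo, 'mm) cvarr) cat" where
  "C_VM = full_subcategory Z_End
     (\<lambda>(F, c, d). \<forall>v \<in> Ob V. \<forall>m \<in> Ob M. c (gob v) m = d v m)"

context
  fixes H :: "'mo \<Rightarrow> 'mo \<Rightarrow> 'co"
    and phi :: "'co \<Rightarrow> 'mo \<Rightarrow> 'mo \<Rightarrow> 'cm \<Rightarrow> 'mm"
begin

definition phi_inv :: "'co \<Rightarrow> 'mo \<Rightarrow> 'mo \<Rightarrow> 'mm \<Rightarrow> 'cm" where
  "phi_inv X m n = the_inv_into (Hom C X (H m n)) (phi X m n)"

text \<open>The arrow \<open>H m n \<rhd> m \<rightarrow> n\<close> corresponding to the identity, and the functoriality of \<open>H\<close>.\<close>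

definition ihom_ev :: "'mo \<Rightarrow> 'mo \<Rightarrow> 'mm" where
  "ihom_ev m n = phi (H m n) m n (ident C (H m n))"

definition ihom_cov :: "'mo \<Rightarrow> 'mo \<Rightarrow> 'mo \<Rightarrow> 'mm \<Rightarrow> 'cm" where
  "ihom_cov m n n' f = phi_inv (H m n) m n' (f \<cdot>\<^bsub>M\<^esub> ihom_ev m n)"

definition ihom_con :: "'mo \<Rightarrow> 'mo \<Rightarrow> 'mo \<Rightarrow> 'mm \<Rightarrow> 'cm" where
  "ihom_con m' m n g =
     phi_inv (H m n) m' n (ihom_ev m n \<cdot>\<^bsub>M\<^esub> (ident C (H m n) \<rhd>\<^sub>a\<^bsub>a\<^esub> g))"

definition gamma :: "('vo, 'mo, 'mm) vfun \<Rightarrow> 'co \<Rightarrow> 'vo \<Rightarrow> 'mo \<Rightarrow> 'mo \<Rightarrow> 'mm \<Rightarrow> 'mm" where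
  "gamma = (\<lambda>(F, d) X v m n f.
     ev_act v (fob F n) \<cdot>\<^bsub>M\<^esub> (ident C (gob (dual V v)) \<rhd>\<^sub>a\<^bsub>a\<^esub> (d v n \<cdot>\<^bsub>M\<^esub> f)) \<cdot>\<^bsub>M\<^esub>
     swap (dual V v) X m)"

definition beta :: "('vo, 'mo, 'mm) vfun \<Rightarrow> 'vo \<Rightarrow> 'mo \<Rightarrow> 'mo \<Rightarrow> 'cm" where
  "beta = (\<lambda>(F, d) v m n.
     let E = H m (fob F (gob v \<rhd>\<^bsub>a\<^esub> n)) in
     phi_inv E (gob (dual V v) \<rhd>\<^bsub>a\<^esub> m) (fob F n)
       (gamma (F, d) E v m n (phi E m (fob F (gob v \<rhd>\<^bsub>a\<^esub> n)) (ident C E))))"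

definition is_rhobar :: "('vo, 'mo, 'mm) vfun \<Rightarrow> 'co \<Rightarrow> ('mo \<Rightarrow> 'cm) \<Rightarrow> bool" where
  "is_rhobar = (\<lambda>(F, d). relative_end V M V_action ev_act C
     (\<lambda>m n. H m (fob F n))
     (\<lambda>m' m n g. ihom_con m' m (fob F n) g)
     (\<lambda>m n n' f. ihom_cov m (fob F n) (fob F n') (far F f))
     (beta (F, d)))"

context
  fixes R :: "('vo, 'mo, 'mm) vfun \<Rightarrow> 'co"
    and p :: "('vo, 'mo, 'mm) vfun \<Rightarrow> 'mo \<Rightarrow> 'cm"
begin

text \<open>Here \<open>R A\<close>, with the dinatural family \<open>p A\<close>, is the chosen relative end for
  each \<open>A\<close> in \<open>End\<^sub>V(M)\<close>. The action on arrows is the one induced by the universal property.\<close>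

definition rhobar_arr :: "('vo, 'mo, 'mm) varr \<Rightarrow> 'cm" where
  "rhobar_arr = (\<lambda>(A, \<alpha>, B). THE u. u \<in> Hom C (R A) (R B) \<and>
     (\<forall>m \<in> Ob M. p B m \<cdot>\<^bsub>C\<^esub> u =
        ihom_cov m (fob (fst A) m) (fob (fst B) m) (\<alpha> m) \<cdot>\<^bsub>C\<^esub> p A m))"

text \<open>
  The adjunction is the composite of
  \<open>Hom(X, R (F, d)) \<cong> {wedges X \<rightarrow> H m (F m)} \<cong> Hom(\<rho> X, (F, d))\<close>, where a wedge is sent to the
  family of its images under \<open>phi X m (F m)\<close>. Hence its unit \<open>X \<rightarrow> R (\<rho> X)\<close> is given by the wedge
  corresponding to the identities of \<open>X \<rhd> m\<close>, and its counit \<open>\<rho> (R (F, d)) \<rightarrow> (F, d)\<close> by the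
  images of \<open>p (F, d)\<close>.
\<close>

definition adj_unit :: "'co \<Rightarrow> 'cm" where
  "adj_unit X = (THE u. u \<in> Hom C X (R (rho X)) \<and>
     (\<forall>m \<in> Ob M. p (rho X) m \<cdot>\<^bsub>C\<^esub> u = phi_inv X m (X \<rhd>\<^bsub>a\<^esub> m) (ident M (X \<rhd>\<^bsub>a\<^esub> m))))"

definition counit_at :: "('vo, 'mo, 'mm) vfun \<Rightarrow> 'mo \<Rightarrow> 'mm" where
  "counit_at A m = phi (R A) m (fob (fst A) m) (p A m)"

text \<open>\<open>r\<^sup>-\<^sup>1 : R A \<otimes> X \<rightarrow> R (A \<lhd> X)\<close> and \<open>l\<^sup>-\<^sup>1 : X \<otimes> R A \<rightarrow> R (X \<rhd> A)\<close>; the associativity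
  isomorphisms identify \<open>\<rho>(R A \<otimes> X)\<close> with \<open>\<rho>(R A) \<lhd> X\<close> and \<open>\<rho>(X \<otimes> R A)\<close> with \<open>X \<rhd> \<rho>(R A)\<close>.\<close>

definition r_inv :: "('vo, 'mo, 'mm) vfun \<Rightarrow> 'co \<Rightarrow> 'cm" where
  "r_inv A X =
     rhobar_arr (rho (R A \<otimes>\<^bsub>C\<^esub> X),
       (\<lambda>m \<in> Ob M. counit_at A (X \<rhd>\<^bsub>a\<^esub> m) \<cdot>\<^bsub>M\<^esub> massoc a (R A) X m),
       right_act A X)
     \<cdot>\<^bsub>C\<^esub> adj_unit (R A \<otimes>\<^bsub>C\<^esub> X)"

definition l_inv :: "'co \<Rightarrow> ('vo, 'mo, 'mm) vfun \<Rightarrow> 'cm" where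
  "l_inv X A =
     rhobar_arr (rho (X \<otimes>\<^bsub>C\<^esub> R A),
       (\<lambda>m \<in> Ob M. (ident C X \<rhd>\<^sub>a\<^bsub>a\<^esub> counit_at A m) \<cdot>\<^bsub>M\<^esub> massoc a X (R A) m),
       left_act X A)
     \<cdot>\<^bsub>C\<^esub> adj_unit (X \<otimes>\<^bsub>C\<^esub> R A)"

definition l_iso :: "'co \<Rightarrow> ('vo, 'mo, 'mm) vfun \<Rightarrow> 'cm" where
  "l_iso X A = inv_arr C (X \<otimes>\<^bsub>C\<^esub> R A) (R (left_act X A)) (l_inv X A)"

definition Z_rhobar ::
  "(('co, 'vo, 'mo, 'mm) cvfun, ('co, 'vo, 'mo, 'mm) cvarr, 'co \<times> ('co \<Rightarrow> 'cm), 'cm) fctr" where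
  "Z_rhobar = \<lparr>
     fob = (\<lambda>(F, c, d). (R (F, d),
       (\<lambda>X \<in> Ob C. l_iso X (F, d) \<cdot>\<^bsub>C\<^esub>
          rhobar_arr (right_act (F, d) X, restrict (c X) (Ob M), left_act X (F, d)) \<cdot>\<^bsub>C\<^esub>
          r_inv (F, d) X))),
     far = (\<lambda>((F, c, d), \<alpha>, (F', c', d')). rhobar_arr ((F, d), \<alpha>, (F', d')))\<rparr>"

end

end

end

end

theory Submission
  imports Defs
begin

text \<open>
  Put \<open>E = R (F, d)\<close>, and let \<open>eps m : E \<rhd> m \<rightarrow> F m\<close> be the counit, obtained from the legs of the
  relative end. Under the internal Hom adjunction, and by the snake identity for \<open>G v\<close>, wedges from \<open>X\<close>
  correspond to transformations \<open>\<rho> X \<rightarrow> (F, d)\<close> of \<open>V\<close>-module functors, so an arrow \<open>u : X \<rightarrow> E\<close> is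
  determined by the arrows \<open>eps m \<circ> (u \<rhd> m)\<close>. Transposing along the dual of \<open>X\<close>, the same holds for
  arrows into \<open>X \<otimes> E\<close>. In these terms the half-braiding is the unique solution \<open>\<sigma> X : E \<otimes> X \<rightarrow> X \<otimes> E\<close> of
  \<open>(X \<rhd> eps m) \<circ> (\<sigma> X \<rhd> m) = c X m \<circ> eps (X \<rhd> m)\<close>, and its naturality and hexagon are inherited from
  those of \<open>c\<close>. For \<open>X = G v\<close> and \<open>c (G v) = d v\<close>, the equation says that \<open>eps\<close> is a transformation of
  \<open>V\<close>-module functors with \<open>\<sigma> (G v)\<close> in place of the inverse half-braiding of \<open>G v\<close>; as \<open>eps\<close> is such a
  transformation for the latter, the two agree.
\<close>

section \<open>Typed arrows\<close>

text \<open>The half-braiding is given as l after R(c) after the inverse of r, while the definitions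
  provide only the inverses of l and r. To evaluate it, the inverse of l has to be inverted; this is
  why arrows into X \<otimes> E are needed with existence as well as uniqueness. The inverse of r
  enters as it stands, and the invertibility of \<sigma> X is recovered by rotating \<sigma> D along
  a duality. A second constraint is that R A is a relative end only for A in \<open>End_V\<close>: X
  \<rhd> A and A \<lhd> X must be seen to be V-module functors, and each c X a transformation
  between them. The latter is not given but follows from c (G v) = d v, since both V-structures then
  come from values of c on X \<otimes> G v and on G v \<otimes> X, which are compared by naturality
  along the half-braiding. As G is only strong monoidal and M has its own associativity
  isomorphisms, half-braidings act on M only between associators; the pentagon computations show
  that they still obey the rules of half-braidings.\<close>

text \<open>The sets \<open>Hom C A B\<close> need not be disjoint. Packing an arrow with its source and target makes
  typing conditions computable by rewriting, so that associativity becomes a simplification rule.\<close>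

datatype ('o, 'm) ar = Ar (src: 'o) (arr: 'm) (tgt: 'o)

definition is_ar :: "('o, 'm, 'z) cat_scheme \<Rightarrow> ('o, 'm) ar \<Rightarrow> bool" where
  "is_ar C f \<longleftrightarrow> src f \<in> Ob C \<and> tgt f \<in> Ob C \<and> arr f \<in> Hom C (src f) (tgt f)"

definition id_ar :: "('o, 'm, 'z) cat_scheme \<Rightarrow> 'o \<Rightarrow> ('o, 'm) ar" where
  "id_ar C A = Ar A (ident C A) A"

text \<open>Total on purpose: source and target are read off the outer ends, and nothing checks that
  the inner ends agree. Composability appears only as a hypothesis of the lemmas.\<close>

definition comp_ar ::
  "('o, 'm, 'z) cat_scheme \<Rightarrow> ('o, 'm) ar \<Rightarrow> ('o, 'm) ar \<Rightarrow> ('o, 'm) ar" where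
  "comp_ar C g f = Ar (src f) (arr g \<cdot>\<^bsub>C\<^esub> arr f) (tgt g)"

definition iso_ar :: "('o, 'm, 'z) cat_scheme \<Rightarrow> ('o, 'm) ar \<Rightarrow> bool" where
  "iso_ar C f \<longleftrightarrow> src f \<in> Ob C \<and> tgt f \<in> Ob C \<and> is_iso C (src f) (tgt f) (arr f)"

definition inv_ar :: "('o, 'm, 'z) cat_scheme \<Rightarrow> ('o, 'm) ar \<Rightarrow> ('o, 'm) ar" where
  "inv_ar C f = Ar (tgt f) (inv_arr C (src f) (tgt f) (arr f)) (src f)"

definition map_ar :: "('o, 'm, 'p, 'n, 'y) fctr_scheme \<Rightarrow> ('o, 'm) ar \<Rightarrow> ('p, 'n) ar" where
  "map_ar F f = Ar (fob F (src f)) (far F (arr f)) (fob F (tgt f))"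

definition tensor_ar ::
  "('o, 'm, 'k, 'z) monoidal_cat_scheme \<Rightarrow> ('o, 'm) ar \<Rightarrow> ('o, 'm) ar \<Rightarrow> ('o, 'm) ar" where
  "tensor_ar C f g =
     Ar (src f \<otimes>\<^bsub>C\<^esub> src g) (arr f \<otimes>\<^sub>a\<^bsub>C\<^esub> arr g) (tgt f \<otimes>\<^bsub>C\<^esub> tgt g)"

definition act_ar ::
  "('co, 'cm, 'mo, 'mm) action \<Rightarrow> ('co, 'cm) ar \<Rightarrow> ('mo, 'mm) ar \<Rightarrow> ('mo, 'mm) ar" where
  "act_ar a g f = Ar (src g \<rhd>\<^bsub>a\<^esub> src f) (arr g \<rhd>\<^sub>a\<^bsub>a\<^esub> arr f) (tgt g \<rhd>\<^bsub>a\<^esub> tgt f)"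

lemma src_tgt_simps [simp]:
  "src (id_ar C A) = A" "tgt (id_ar C A) = A"
  "src (comp_ar C g f) = src f" "tgt (comp_ar C g f) = tgt g"
  "src (inv_ar C f) = tgt f" "tgt (inv_ar C f) = src f"
  "src (map_ar F f) = fob F (src f)" "tgt (map_ar F f) = fob F (tgt f)"
  "src (tensor_ar D f g) = src f \<otimes>\<^bsub>D\<^esub> src g" "tgt (tensor_ar D f g) = tgt f \<otimes>\<^bsub>D\<^esub> tgt g"
  "src (act_ar a h k) = src h \<rhd>\<^bsub>a\<^esub> src k" "tgt (act_ar a h k) = tgt h \<rhd>\<^bsub>a\<^esub> tgt k"
  by (simp_all add: id_ar_def comp_ar_def inv_ar_def map_ar_def tensor_ar_def act_ar_def)

lemma is_ar_Ar [simp]: "is_ar C (Ar A f B) \<longleftrightarrow> A \<in> Ob C \<and> B \<in> Ob C \<and> f \<in> Hom C A B"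
  by (simp add: is_ar_def)

lemma is_ar_ob [simp]: "is_ar C f \<Longrightarrow> src f \<in> Ob C" "is_ar C f \<Longrightarrow> tgt f \<in> Ob C"
  by (simp_all add: is_ar_def)

section \<open>Calculus of typed arrows and their inverses\<close>

context category
begin

lemma is_ar_id [simp]: "A \<in> Ob C \<Longrightarrow> is_ar C (id_ar C A)"
  unfolding is_ar_def by (simp add: id_ar_def ident_closed)

lemma is_ar_comp [simp]:
  "\<lbrakk>is_ar C f; is_ar C g; tgt f = src g\<rbrakk> \<Longrightarrow> is_ar C (comp_ar C g f)"
  using comp_closed[of "src f" "tgt f" "tgt g" "arr f" "arr g"]
  unfolding is_ar_def by (simp add: comp_ar_def)

lemma comp_ar_assoc [simp]:
  "\<lbrakk>is_ar C f; is_ar C g; is_ar C h; tgt f = src g; tgt g = src h\<rbrakk>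
    \<Longrightarrow> comp_ar C (comp_ar C h g) f = comp_ar C h (comp_ar C g f)"
  using comp_assoc[of "src f" "tgt f" "tgt g" "tgt h" "arr f" "arr g" "arr h"]
  unfolding is_ar_def by (simp add: comp_ar_def)

lemma comp_ar_id_left [simp]: "\<lbrakk>is_ar C f; tgt f = B\<rbrakk> \<Longrightarrow> comp_ar C (id_ar C B) f = f"
  using ident_left[of "src f" "tgt f" "arr f"]
  unfolding is_ar_def by (auto simp: comp_ar_def id_ar_def intro: ar.expand)

lemma comp_ar_id_right [simp]: "\<lbrakk>is_ar C f; src f = A\<rbrakk> \<Longrightarrow> comp_ar C f (id_ar C A) = f"
  using ident_right[of "src f" "tgt f" "arr f"]
  unfolding is_ar_def by (auto simp: comp_ar_def id_ar_def intro: ar.expand)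

lemma is_inverse_unique:
  assumes "A \<in> Ob C" "B \<in> Ob C" "is_inverse C A B f g" "is_inverse C A B f h"
  shows "g = h"
proof -
  have "g = g \<cdot> (f \<cdot> h)"
    using assms ident_right[of B A g] by (simp add: is_inverse_def)
  also have "\<dots> = g \<cdot> f \<cdot> h"
    using assms comp_assoc[of B A B A h f g] by (simp add: is_inverse_def)
  also have "\<dots> = h"
    using assms ident_left[of B A h] by (simp add: is_inverse_def)
  finally show ?thesis .
qed

lemma inv_arr_eq:
  "\<lbrakk>A \<in> Ob C; B \<in> Ob C; is_inverse C A B f g\<rbrakk> \<Longrightarrow> inv_arr C A B f = g"
  unfolding inv_arr_def by (blast intro: is_inverse_unique)

lemma is_inverse_inv_arr:
  "\<lbrakk>A \<in> Ob C; B \<in> Ob C; is_iso C A B f\<rbrakk> \<Longrightarrow> is_inverse C A B f (inv_arr C A B f)"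
  by (metis inv_arr_eq is_iso_def)

lemma iso_ar_imp_is_ar [simp]: "iso_ar C f \<Longrightarrow> is_ar C f"
  unfolding iso_ar_def is_ar_def by (auto simp: is_iso_def is_inverse_def)

lemma is_ar_inv [simp]: "iso_ar C f \<Longrightarrow> is_ar C (inv_ar C f)"
  using is_inverse_inv_arr[of "src f" "tgt f" "arr f"]
  unfolding iso_ar_def is_ar_def by (auto simp: inv_ar_def is_inverse_def)

lemma inv_ar_left [simp]: "iso_ar C f \<Longrightarrow> comp_ar C (inv_ar C f) f = id_ar C (src f)"
  using is_inverse_inv_arr[of "src f" "tgt f" "arr f"]
  unfolding iso_ar_def by (auto simp: comp_ar_def id_ar_def inv_ar_def is_inverse_def)

lemma inv_ar_right [simp]: "iso_ar C f \<Longrightarrow> comp_ar C f (inv_ar C f) = id_ar C (tgt f)"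
  using is_inverse_inv_arr[of "src f" "tgt f" "arr f"]
  unfolding iso_ar_def by (auto simp: comp_ar_def id_ar_def inv_ar_def is_inverse_def)

text \<open>\<open>inv_arr\<close> is a definite description, so exhibiting a two-sided inverse
  settles two questions at once: that the arrow is invertible, and which arrow its inverse
  is.\<close>

lemma iso_arI:
  assumes "is_ar C f" "is_ar C g" "src g = tgt f" "tgt g = src f"
    "comp_ar C g f = id_ar C (src f)" "comp_ar C f g = id_ar C (tgt f)"
  shows "iso_ar C f" "inv_ar C f = g"
proof -
  have "is_inverse C (src f) (tgt f) (arr f) (arr g)"
    using assms unfolding is_ar_def by (simp add: is_inverse_def comp_ar_def id_ar_def)
  then show "iso_ar C f" "inv_ar C f = g"
    using assms inv_arr_eq[of "src f" "tgt f" "arr f" "arr g"]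
    unfolding iso_ar_def is_ar_def by (auto simp: is_iso_def inv_ar_def intro: ar.expand)
qed

lemma iso_ar_inv [simp]: "iso_ar C f \<Longrightarrow> iso_ar C (inv_ar C f)"
  by (rule iso_arI(1)[of _ f]) simp_all

lemma iso_ar_id [simp]: "A \<in> Ob C \<Longrightarrow> iso_ar C (id_ar C A)"
  by (rule iso_arI(1)[of _ "id_ar C A"]) simp_all

text \<open>Composites are kept nested to the right, hence an equation between composites of two
  arrows does not match inside a longer one. This is the equation with a tail \<open>x\<close>; the
  primed and \<open>_extend\<close> variants further on serve the same purpose.\<close>

lemma comp_ar_extend:
  assumes "comp_ar C g f = h" "is_ar C f" "is_ar C g" "tgt f = src g" "is_ar C x" "tgt x = src f"
  shows "comp_ar C g (comp_ar C f x) = comp_ar C h x"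
  using assms by (simp flip: comp_ar_assoc)

lemma inv_ar_left' [simp]:
  "\<lbrakk>iso_ar C f; is_ar C x; tgt x = src f\<rbrakk> \<Longrightarrow> comp_ar C (inv_ar C f) (comp_ar C f x) = x"
  by (simp flip: comp_ar_assoc)

lemma inv_ar_right' [simp]:
  "\<lbrakk>iso_ar C f; is_ar C x; tgt x = tgt f\<rbrakk> \<Longrightarrow> comp_ar C f (comp_ar C (inv_ar C f) x) = x"
  by (simp flip: comp_ar_assoc)

lemma iso_ar_comp [simp]:
  assumes "iso_ar C f" "iso_ar C g" "tgt f = src g"
  shows "iso_ar C (comp_ar C g f)"
  using assms by (intro iso_arI(1)[of _ "comp_ar C (inv_ar C f) (inv_ar C g)"]) simp_all

lemma iso_ar_cancel_right:
  assumes "comp_ar C g f = comp_ar C h f"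
    "iso_ar C f" "is_ar C g" "is_ar C h" "src g = tgt f" "src h = tgt f"
  shows "g = h"
proof -
  have "comp_ar C (comp_ar C g f) (inv_ar C f) = comp_ar C (comp_ar C h f) (inv_ar C f)"
    by (simp only: assms(1))
  then show ?thesis using assms(2-) by simp
qed

lemma iso_ar_cancel_left:
  assumes "comp_ar C f g = comp_ar C f h"
    "iso_ar C f" "is_ar C g" "is_ar C h" "tgt g = src f" "tgt h = src f"
  shows "g = h"
proof -
  have "comp_ar C (inv_ar C f) (comp_ar C f g) = comp_ar C (inv_ar C f) (comp_ar C f h)"
    by (simp only: assms(1))
  then show ?thesis using assms(2-) by simp
qed

end

section \<open>Module categories and central objects\<close>

locale action_setting =
  C: strict_monoidal_category C + M: module_category C M a
  for C :: "('co, 'cm, 'k::field, 'z) monoidal_cat_scheme"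
    and M :: "('mo, 'mm, 'k, 'w) kcat_scheme"
    and a :: "('co, 'cm, 'mo, 'mm) action"
begin

abbreviation tensC_ob (infixr "\<otimes>\<^sub>o" 75) where "X \<otimes>\<^sub>o Y \<equiv> X \<otimes>\<^bsub>C\<^esub> Y"
abbreviation unitC ("\<one>\<^sub>o") where "\<one>\<^sub>o \<equiv> \<one>\<^bsub>C\<^esub>"
abbreviation actM_ob (infixr "\<diamond>" 75) where "X \<diamond> m \<equiv> X \<rhd>\<^bsub>a\<^esub> m"
abbreviation compC (infixr "\<diamondop>" 55) where "g \<diamondop> f \<equiv> comp_ar C g f"
abbreviation compM (infixr "\<bullet>" 55) where "g \<bullet> f \<equiv> comp_ar M g f"
abbreviation tensC (infixr "\<bowtie>" 75) where "f \<bowtie> g \<equiv> tensor_ar C f g"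
abbreviation actM (infixr "\<star>" 75) where "g \<star> f \<equiv> act_ar a g f"
abbreviation idC ("\<I>") where "\<I> \<equiv> id_ar C"
abbreviation idM ("\<J>") where "\<J> \<equiv> id_ar M"

lemma ob_closed [simp]:
  "\<one>\<^sub>o \<in> Ob C"
  "\<lbrakk>X \<in> Ob C; Y \<in> Ob C\<rbrakk> \<Longrightarrow> X \<otimes>\<^sub>o Y \<in> Ob C"
  "\<lbrakk>X \<in> Ob C; m \<in> Ob M\<rbrakk> \<Longrightarrow> X \<diamond> m \<in> Ob M"
  by (simp_all add: C.unit_closed C.tensor_ob_closed M.act_ob_closed)

lemma tensor_ob_strict [simp]:
  "\<lbrakk>X \<in> Ob C; Y \<in> Ob C; Z \<in> Ob C\<rbrakk> \<Longrightarrow> (X \<otimes>\<^sub>o Y) \<otimes>\<^sub>o Z = X \<otimes>\<^sub>o Y \<otimes>\<^sub>o Z"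
  "X \<in> Ob C \<Longrightarrow> \<one>\<^sub>o \<otimes>\<^sub>o X = X" "X \<in> Ob C \<Longrightarrow> X \<otimes>\<^sub>o \<one>\<^sub>o = X"
  by (simp_all add: C.tensor_ob_assoc C.unit_ob_left C.unit_ob_right)

lemma is_ar_tensor [simp]: "\<lbrakk>is_ar C f; is_ar C g\<rbrakk> \<Longrightarrow> is_ar C (f \<bowtie> g)"
  unfolding is_ar_def by (simp add: tensor_ar_def C.tensor_arr_closed)

lemma is_ar_act [simp]: "\<lbrakk>is_ar C g; is_ar M f\<rbrakk> \<Longrightarrow> is_ar M (g \<star> f)"
  unfolding is_ar_def by (simp add: act_ar_def M.act_arr_closed)

lemma tensor_id [simp]: "\<lbrakk>X \<in> Ob C; Y \<in> Ob C\<rbrakk> \<Longrightarrow> \<I> X \<bowtie> \<I> Y = \<I> (X \<otimes>\<^sub>o Y)"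
  by (simp add: tensor_ar_def id_ar_def C.tensor_ident)

lemma act_id [simp]: "\<lbrakk>X \<in> Ob C; m \<in> Ob M\<rbrakk> \<Longrightarrow> \<I> X \<star> \<J> m = \<J> (X \<diamond> m)"
  by (simp add: act_ar_def id_ar_def M.act_ident)

text \<open>Interchange law, oriented so that adjacent arrows merge factor by factor. Identities
  then vanish by simplification, and two orders of applying arrows to disjoint factors become the
  same term.\<close>

lemma tensor_comp:
  "\<lbrakk>is_ar C f; is_ar C f'; is_ar C g; is_ar C g'; tgt f = src f'; tgt g = src g'\<rbrakk>
    \<Longrightarrow> (f' \<bowtie> g') \<diamondop> (f \<bowtie> g) = (f' \<diamondop> f) \<bowtie> (g' \<diamondop> g)"
  using C.tensor_comp[of "src f" "tgt f" "tgt f'" "src g" "tgt g" "tgt g'"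
      "arr f" "arr f'" "arr g" "arr g'"]
  unfolding is_ar_def by (simp add: tensor_ar_def comp_ar_def)

lemma act_comp:
  "\<lbrakk>is_ar C g; is_ar C g'; is_ar M f; is_ar M f'; tgt f = src f'; tgt g = src g'\<rbrakk>
    \<Longrightarrow> (g' \<star> f') \<bullet> (g \<star> f) = (g' \<diamondop> g) \<star> (f' \<bullet> f)"
  using M.act_comp[of "src g" "tgt g" "tgt g'" "src f" "tgt f" "tgt f'"
      "arr g" "arr g'" "arr f" "arr f'"]
  unfolding is_ar_def by (simp add: act_ar_def comp_ar_def)

lemma tensor_comp_extend:
  assumes "is_ar C f" "is_ar C f'" "is_ar C g" "is_ar C g'" "tgt f = src f'" "tgt g = src g'"
    "is_ar C x" "tgt x = src f \<otimes>\<^sub>o src g"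
  shows "(f' \<bowtie> g') \<diamondop> (f \<bowtie> g) \<diamondop> x = ((f' \<diamondop> f) \<bowtie> (g' \<diamondop> g)) \<diamondop> x"
  using assms by (intro C.comp_ar_extend tensor_comp) simp_all

lemma act_comp_extend:
  assumes "is_ar C g" "is_ar C g'" "is_ar M f" "is_ar M f'" "tgt f = src f'" "tgt g = src g'"
    "is_ar M x" "tgt x = src g \<diamond> src f"
  shows "(g' \<star> f') \<bullet> (g \<star> f) \<bullet> x = ((g' \<diamondop> g) \<star> (f' \<bullet> f)) \<bullet> x"
  using assms by (intro M.comp_ar_extend act_comp) simp_all

lemma tensor_strict [simp]:
  "\<lbrakk>is_ar C f; is_ar C g; is_ar C h\<rbrakk> \<Longrightarrow> (f \<bowtie> g) \<bowtie> h = f \<bowtie> g \<bowtie> h"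
  "is_ar C f \<Longrightarrow> \<I> \<one>\<^sub>o \<bowtie> f = f" "is_ar C f \<Longrightarrow> f \<bowtie> \<I> \<one>\<^sub>o = f"
  using C.tensor_arr_assoc[of "src f" "tgt f" "src g" "tgt g" "src h" "tgt h" "arr f" "arr g" "arr h"]
    C.unit_arr_left[of "src f" "tgt f" "arr f"] C.unit_arr_right[of "src f" "tgt f" "arr f"]
  unfolding is_ar_def by (auto simp: tensor_ar_def id_ar_def intro: ar.expand)

lemma iso_ar_tensor [simp]: 
  assumes "iso_ar C f" "iso_ar C g"
  shows "iso_ar C (f \<bowtie> g)"
  by (rule C.iso_arI(1)[of _ "inv_ar C f \<bowtie> inv_ar C g"])
    (use assms in \<open>simp_all add: tensor_comp\<close>)

lemma iso_ar_act [simp]: 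
  assumes "iso_ar C g" "iso_ar M f"
  shows "iso_ar M (g \<star> f)"
  by (rule M.iso_arI(1)[of _ "inv_ar C g \<star> inv_ar M f"])
    (use assms in \<open>simp_all add: act_comp\<close>)

definition ass where
  "ass X Y m = Ar ((X \<otimes>\<^sub>o Y) \<diamond> m) (massoc a X Y m) (X \<diamond> Y \<diamond> m)"

definition uni where
  "uni m = Ar (\<one>\<^sub>o \<diamond> m) (munit a m) m"

lemma src_tgt_ass [simp]:
  "src (ass X Y m) = (X \<otimes>\<^sub>o Y) \<diamond> m" "tgt (ass X Y m) = X \<diamond> Y \<diamond> m"
  "src (uni m) = \<one>\<^sub>o \<diamond> m" "tgt (uni m) = m"
  by (simp_all add: ass_def uni_def)

lemma iso_ass [simp]: "\<lbrakk>X \<in> Ob C; Y \<in> Ob C; m \<in> Ob M\<rbrakk> \<Longrightarrow> iso_ar M (ass X Y m)"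
  by (simp add: ass_def iso_ar_def M.massoc_iso)

lemma iso_uni [simp]: "m \<in> Ob M \<Longrightarrow> iso_ar M (uni m)"
  by (simp add: uni_def iso_ar_def M.munit_iso)

lemma ass_natural:
  assumes "is_ar C g" "is_ar C h" "is_ar M f"
    "X' = tgt g" "Y' = tgt h" "m' = tgt f"
  shows "ass X' Y' m' \<bullet> ((g \<bowtie> h) \<star> f) = (g \<star> h \<star> f) \<bullet> ass (src g) (src h) (src f)"
  using assms 
  using M.massoc_natural[of "src g" "tgt g" "src h" "tgt h" "src f" "tgt f" "arr g" "arr h" "arr f"]
  unfolding is_ar_def by (simp add: ass_def act_ar_def tensor_ar_def comp_ar_def)

lemma ass_natural':
  assumes "is_ar C g" "is_ar C h" "is_ar M f"
    "X' = tgt g" "Y' = tgt h" "m' = tgt f" "is_ar M x" "tgt x = (src g \<otimes>\<^sub>o src h) \<diamond> src f"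
  shows "ass X' Y' m' \<bullet> ((g \<bowtie> h) \<star> f) \<bullet> x
    = (g \<star> h \<star> f) \<bullet> ass (src g) (src h) (src f) \<bullet> x"
  using M.comp_ar_extend[OF ass_natural[OF assms(1-6)] _ _ _ assms(7)] assms by simp

lemma uni_natural:
  assumes "is_ar M f"
  shows "uni (tgt f) \<bullet> (\<I> \<one>\<^sub>o \<star> f) = f \<bullet> uni (src f)"
  using assms M.munit_natural[of "src f" "tgt f" "arr f"]
  unfolding is_ar_def by (simp add: uni_def act_ar_def comp_ar_def id_ar_def)

lemma pentagon:
  assumes "X \<in> Ob C" "Y \<in> Ob C" "Z \<in> Ob C" "m \<in> Ob M"
  shows "(\<I> X \<star> ass Y Z m) \<bullet> ass X (Y \<otimes>\<^sub>o Z) m = ass X Y (Z \<diamond> m) \<bullet> ass (X \<otimes>\<^sub>o Y) Z m"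
  using assms M.pentagon[OF assms]
  by (auto simp: ass_def act_ar_def comp_ar_def id_ar_def)

lemma pentagon':
  assumes "X \<in> Ob C" "Y \<in> Ob C" "Z \<in> Ob C" "m \<in> Ob M" "is_ar M x" "tgt x = (X \<otimes>\<^sub>o Y \<otimes>\<^sub>o Z) \<diamond> m"
  shows "(\<I> X \<star> ass Y Z m) \<bullet> ass X (Y \<otimes>\<^sub>o Z) m \<bullet> x
    = ass X Y (Z \<diamond> m) \<bullet> ass (X \<otimes>\<^sub>o Y) Z m \<bullet> x"
  using assms by (simp add: M.comp_ar_extend[OF pentagon[OF assms(1-4)]])

lemma triangle:
  assumes "X \<in> Ob C" "m \<in> Ob M"
  shows "(\<I> X \<star> uni m) \<bullet> ass X \<one>\<^sub>o m = \<J> (X \<diamond> m)"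
  using assms M.triangle[OF assms]
  by (auto simp: ass_def uni_def act_ar_def comp_ar_def id_ar_def C.unit_ob_right)

text \<open>By naturality the invertible unit isomorphism conjugates the action of the unit object
  into the identity functor.\<close>

lemma unit_act_faithful:
  assumes "\<I> \<one>\<^sub>o \<star> f = \<I> \<one>\<^sub>o \<star> g" "is_ar M f" "is_ar M g" "src f = src g" "tgt f = tgt g"
  shows "f = g"
proof (rule M.iso_ar_cancel_right[of _ "uni (src f)"])
  show "f \<bullet> uni (src f) = g \<bullet> uni (src f)"
    using uni_natural[of f] uni_natural[of g] assms by simp
qed (use assms in simp_all)

text \<open>Kelly's argument. The axioms contain only the triangle with the unit in the second
  tensor factor; the pentagon at \<open>\<one>, \<one>, Y\<close> turns it into the other triangle
  acted upon by the unit object, and that action is faithful.\<close>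

lemma triangle_left:
  assumes "Y \<in> Ob C" "m \<in> Ob M"
  shows "uni (Y \<diamond> m) \<bullet> ass \<one>\<^sub>o Y m = \<J> (Y \<diamond> m)"
proof (rule unit_act_faithful)
  have "(\<I> \<one>\<^sub>o \<star> uni (Y \<diamond> m)) \<bullet> (\<I> \<one>\<^sub>o \<star> ass \<one>\<^sub>o Y m) = \<J> (\<one>\<^sub>o \<diamond> Y \<diamond> m)"
  proof (rule M.iso_ar_cancel_right[of _ "ass \<one>\<^sub>o Y m"])
    have "((\<I> \<one>\<^sub>o \<star> uni (Y \<diamond> m)) \<bullet> (\<I> \<one>\<^sub>o \<star> ass \<one>\<^sub>o Y m)) \<bullet> ass \<one>\<^sub>o Y m
      = (\<I> \<one>\<^sub>o \<star> uni (Y \<diamond> m)) \<bullet> ass \<one>\<^sub>o \<one>\<^sub>o (Y \<diamond> m) \<bullet> ass \<one>\<^sub>o Y m"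
      using assms pentagon[of "\<one>\<^sub>o" "\<one>\<^sub>o" Y m] by simp
    also have "\<dots> = \<J> (\<one>\<^sub>o \<diamond> Y \<diamond> m) \<bullet> ass \<one>\<^sub>o Y m"
      by (rule M.comp_ar_extend[OF triangle]) (use assms in simp_all)
    finally show "((\<I> \<one>\<^sub>o \<star> uni (Y \<diamond> m)) \<bullet> (\<I> \<one>\<^sub>o \<star> ass \<one>\<^sub>o Y m)) \<bullet> ass \<one>\<^sub>o Y m
      = \<J> (\<one>\<^sub>o \<diamond> Y \<diamond> m) \<bullet> ass \<one>\<^sub>o Y m" .
  qed (use assms in simp_all)
  then show "\<I> \<one>\<^sub>o \<star> (uni (Y \<diamond> m) \<bullet> ass \<one>\<^sub>o Y m) = \<I> \<one>\<^sub>o \<star> \<J> (Y \<diamond> m)"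
    using assms by (simp add: act_comp)
qed (use assms in simp_all)

section \<open>Half-braidings and arrows of the center\<close>

definition hb where
  "hb z X = Ar (fst z \<otimes>\<^sub>o X) (snd z X) (X \<otimes>\<^sub>o fst z)"

abbreviation hb_inv where "hb_inv z X \<equiv> inv_ar C (hb z X)"

text \<open>A typed arrow \<open>h\<close> remembers only underlying objects of \<open>C\<close>, so
  the half-braidings between which it is an arrow of the center are carried separately by
  \<open>z\<close> and \<open>w\<close>.\<close>

definition central :: "'co \<times> ('co \<Rightarrow> 'cm) \<Rightarrow> 'co \<times> ('co \<Rightarrow> 'cm) \<Rightarrow> ('co, 'cm) ar \<Rightarrow> bool" where
  "central z w h \<longleftrightarrow> z \<in> Ob (center C) \<and> w \<in> Ob (center C) \<and> is_ar C h \<and> src h = fst z \<and>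
     tgt h = fst w \<and> (\<forall>X \<in> Ob C. (\<I> X \<bowtie> h) \<diamondop> hb z X = hb w X \<diamondop> (h \<bowtie> \<I> X))"

lemma src_tgt_hb [simp]: "src (hb z X) = fst z \<otimes>\<^sub>o X" "tgt (hb z X) = X \<otimes>\<^sub>o fst z"
  by (simp_all add: hb_def)

lemma center_ob [simp]: "z \<in> Ob (center C) \<Longrightarrow> fst z \<in> Ob C"
  by (auto simp: center_def)

lemma center_ob_iff: "z \<in> Ob (center C) \<longleftrightarrow> fst z \<in> Ob C \<and> half_braiding C (fst z) (snd z)"
  by (cases z) (simp add: center_def)

lemma iso_hb [simp]: "\<lbrakk>z \<in> Ob (center C); X \<in> Ob C\<rbrakk> \<Longrightarrow> iso_ar C (hb z X)"
  unfolding center_ob_iff half_braiding_def iso_ar_def by (simp add: hb_def)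

lemma hb_natural:
  "\<lbrakk>z \<in> Ob (center C); is_ar C f\<rbrakk>
    \<Longrightarrow> (f \<bowtie> \<I> (fst z)) \<diamondop> hb z (src f) = hb z (tgt f) \<diamondop> (\<I> (fst z) \<bowtie> f)"
  unfolding center_ob_iff half_braiding_def is_ar_def
  by (simp add: hb_def comp_ar_def tensor_ar_def id_ar_def)

lemma hb_tensor:
  "\<lbrakk>z \<in> Ob (center C); X \<in> Ob C; Y \<in> Ob C\<rbrakk>
    \<Longrightarrow> hb z (X \<otimes>\<^sub>o Y) = (\<I> X \<bowtie> hb z Y) \<diamondop> (hb z X \<bowtie> \<I> Y)"
  unfolding center_ob_iff half_braiding_def
  by (simp add: hb_def comp_ar_def tensor_ar_def id_ar_def)

lemma central_iff:
  "central z w (Ar (fst z) h (fst w)) \<longleftrightarrow>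
    z \<in> Ob (center C) \<and> w \<in> Ob (center C) \<and> h \<in> Hom (center C) z w"
proof -
  have "h \<in> Hom (center C) z w \<longleftrightarrow> h \<in> Hom C (fst z) (fst w) \<and>
      (\<forall>X \<in> Ob C. (ident C X \<otimes>\<^sub>a\<^bsub>C\<^esub> h) \<cdot>\<^bsub>C\<^esub> snd z X = snd w X \<cdot>\<^bsub>C\<^esub> (h \<otimes>\<^sub>a\<^bsub>C\<^esub> ident C X))"
    by (simp add: center_def split_beta)
  then show ?thesis
    by (auto simp: central_def hb_def comp_ar_def tensor_ar_def id_ar_def)
qed

lemma centralD:
  assumes "central z w h"
  shows "z \<in> Ob (center C)" "w \<in> Ob (center C)" "is_ar C h" "src h = fst z" "tgt h = fst w"
    "X \<in> Ob C \<Longrightarrow> (\<I> X \<bowtie> h) \<diamondop> hb z X = hb w X \<diamondop> (h \<bowtie> \<I> X)"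
  using assms by (simp_all add: central_def)

text \<open>Turns around a square with two invertible opposite sides. Naturality of
  \<open>hb\<close> in either argument thus yields that of \<open>hb_inv\<close>, the direction in
  which half-braidings enter the V-structures.\<close>

lemma inverse_square:
  assumes "iso_ar C f" "iso_ar C g" "is_ar C h" "is_ar C k" "tgt f = src h" "tgt h = tgt g"
    "src f = src k" "tgt k = src g" "h \<diamondop> f = g \<diamondop> k"
  shows "k \<diamondop> inv_ar C f = inv_ar C g \<diamondop> h"
proof (rule C.iso_ar_cancel_right[OF C.iso_ar_cancel_left])
  show "g \<diamondop> ((k \<diamondop> inv_ar C f) \<diamondop> f) = g \<diamondop> ((inv_ar C g \<diamondop> h) \<diamondop> f)"
    using assms by simp
qed (use assms in simp_all)

lemma hb_inv_natural:
  assumes "z \<in> Ob (center C)" "is_ar C f"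
  shows "(\<I> (fst z) \<bowtie> f) \<diamondop> hb_inv z (src f) = hb_inv z (tgt f) \<diamondop> (f \<bowtie> \<I> (fst z))"
  by (rule inverse_square) (use assms in \<open>simp_all add: hb_natural\<close>)

lemma hb_inv_central:
  assumes "central z w h" "X \<in> Ob C"
  shows "(h \<bowtie> \<I> X) \<diamondop> hb_inv z X = hb_inv w X \<diamondop> (\<I> X \<bowtie> h)"
  by (rule inverse_square) (use assms in \<open>simp_all add: centralD\<close>)

lemma hb_inv_tensor:
  assumes "z \<in> Ob (center C)" "X \<in> Ob C" "Y \<in> Ob C"
  shows "hb_inv z (X \<otimes>\<^sub>o Y) = (hb_inv z X \<bowtie> \<I> Y) \<diamondop> (\<I> X \<bowtie> hb_inv z Y)"
proof (rule C.iso_arI(2))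
  show "((hb_inv z X \<bowtie> \<I> Y) \<diamondop> (\<I> X \<bowtie> hb_inv z Y)) \<diamondop> hb z (X \<otimes>\<^sub>o Y)
      = \<I> (src (hb z (X \<otimes>\<^sub>o Y)))"
    using assms by (simp add: hb_tensor tensor_comp tensor_comp_extend)
  show "hb z (X \<otimes>\<^sub>o Y) \<diamondop> (hb_inv z X \<bowtie> \<I> Y) \<diamondop> (\<I> X \<bowtie> hb_inv z Y)
      = \<I> (tgt (hb z (X \<otimes>\<^sub>o Y)))"
    using assms by (simp add: hb_tensor tensor_comp tensor_comp_extend)
qed (use assms in simp_all)

text \<open>Multiplicativity at \<open>\<one>, \<one>\<close> makes the arrow idempotent, and an
  invertible idempotent is the identity.\<close>

lemma hb_unit:
  assumes "z \<in> Ob (center C)"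
  shows "hb z \<one>\<^sub>o = \<I> (fst z)"
proof (rule C.iso_ar_cancel_left[symmetric])
  show "hb z \<one>\<^sub>o \<diamondop> \<I> (fst z) = hb z \<one>\<^sub>o \<diamondop> hb z \<one>\<^sub>o"
    using hb_tensor[OF assms, of "\<one>\<^sub>o" "\<one>\<^sub>o"] assms by simp
qed (use assms in simp_all)

lemma hb_inv_unit:
  assumes "z \<in> Ob (center C)"
  shows "hb_inv z \<one>\<^sub>o = \<I> (fst z)"
  by (rule C.iso_arI(2)) (use assms in \<open>simp_all add: hb_unit\<close>)

lemma fst_center_tensor [simp]: "fst (z \<otimes>\<^bsub>center C\<^esub> w) = fst z \<otimes>\<^sub>o fst w"
  by (simp add: center_def split_beta)

lemma fst_center_unit [simp]: "fst \<one>\<^bsub>center C\<^esub> = \<one>\<^sub>o"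
  by (simp add: center_def)

lemma hb_center_tensor:
  assumes "z \<in> Ob (center C)" "w \<in> Ob (center C)" "X \<in> Ob C"
  shows "hb (z \<otimes>\<^bsub>center C\<^esub> w) X = (hb z X \<bowtie> \<I> (fst w)) \<diamondop> (\<I> (fst z) \<bowtie> hb w X)"
proof -
  have "snd (z \<otimes>\<^bsub>center C\<^esub> w) X = (snd z X \<otimes>\<^sub>a\<^bsub>C\<^esub> ident C (fst w)) \<cdot>\<^bsub>C\<^esub> (ident C (fst z) \<otimes>\<^sub>a\<^bsub>C\<^esub> snd w X)"
    using assms(3) by (simp add: center_def split_beta)
  then show ?thesis
    using assms by (simp add: hb_def comp_ar_def tensor_ar_def id_ar_def)
qed

lemma hb_center_unit: "X \<in> Ob C \<Longrightarrow> hb \<one>\<^bsub>center C\<^esub> X = \<I> X"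
  by (simp add: hb_def id_ar_def center_def)

lemma hb_inv_center_tensor:
  assumes "z \<in> Ob (center C)" "w \<in> Ob (center C)" "X \<in> Ob C"
  shows "hb_inv (z \<otimes>\<^bsub>center C\<^esub> w) X
    = (\<I> (fst z) \<bowtie> hb_inv w X) \<diamondop> (hb_inv z X \<bowtie> \<I> (fst w))"
  by (rule C.iso_arI(2))
    (use assms in \<open>simp_all add: hb_center_tensor tensor_comp tensor_comp_extend\<close>)

lemma hb_inv_center_unit:
  assumes "X \<in> Ob C"
  shows "hb_inv \<one>\<^bsub>center C\<^esub> X = \<I> X"
  by (rule C.iso_arI(2)) (use assms in \<open>simp_all add: hb_center_unit\<close>)

lemma center_unit_ob [simp]: "\<one>\<^bsub>center C\<^esub> \<in> Ob (center C)"
proof -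
  have "f \<cdot>\<^bsub>C\<^esub> ident C X = ident C Y \<cdot>\<^bsub>C\<^esub> f" if "X \<in> Ob C" "Y \<in> Ob C" "f \<in> Hom C X Y" for X Y f
    using that by (metis C.ident_left C.ident_right)
  moreover have "is_iso C X X (ident C X)" if "X \<in> Ob C" for X
    using C.iso_ar_id[OF that] by (simp add: iso_ar_def id_ar_def)
  ultimately show ?thesis
    unfolding center_ob_iff half_braiding_def
    by (auto simp: center_def C.unit_ob_left C.unit_ob_right C.unit_arr_left C.unit_arr_right
        C.tensor_ident C.ident_left[OF _ _ C.ident_closed] C.ident_closed C.tensor_ob_closed)
qed

section \<open>Exchanging a central object with an object acting on \<open>M\<close>\<close>

definition sw where
  "sw z X m = ass (fst z) X m \<bullet> (hb_inv z X \<star> \<J> m) \<bullet> inv_ar M (ass X (fst z) m)"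

lemma src_tgt_sw [simp]:
  "src (sw z X m) = X \<diamond> fst z \<diamond> m" "tgt (sw z X m) = fst z \<diamond> X \<diamond> m"
  by (simp_all add: sw_def)

lemma iso_sw [simp]:
  "\<lbrakk>z \<in> Ob (center C); X \<in> Ob C; m \<in> Ob M\<rbrakk> \<Longrightarrow> iso_ar M (sw z X m)"
  by (simp add: sw_def)

text \<open>\<open>sw\<close> is the inverse half-braiding acting between two associators. Composed
  with one of them it becomes a plain action of \<open>hb_inv\<close>; the main rules for
  \<open>sw\<close> are therefore proved after cancelling an invertible arrow on the right.\<close>

lemma sw_ass:
  "\<lbrakk>z \<in> Ob (center C); X \<in> Ob C; m \<in> Ob M\<rbrakk>
    \<Longrightarrow> sw z X m \<bullet> ass X (fst z) m = ass (fst z) X m \<bullet> (hb_inv z X \<star> \<J> m)"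
  by (simp add: sw_def)

lemma sw_ass':
  "\<lbrakk>z \<in> Ob (center C); X \<in> Ob C; m \<in> Ob M; is_ar M x; tgt x = (X \<otimes>\<^sub>o fst z) \<diamond> m\<rbrakk>
    \<Longrightarrow> sw z X m \<bullet> ass X (fst z) m \<bullet> x = ass (fst z) X m \<bullet> (hb_inv z X \<star> \<J> m) \<bullet> x"
  by (simp add: M.comp_ar_extend[OF sw_ass])

lemma sw_natural:
  assumes "central z w h" "is_ar C g" "is_ar M f"
  shows "sw w (tgt g) (tgt f) \<bullet> (g \<star> h \<star> f) = (h \<star> g \<star> f) \<bullet> sw z (src g) (src f)"
proof (rule M.iso_ar_cancel_right[of _ "ass (src g) (fst z) (src f)"])
  note [simp] = assms centralD(1-5)[OF assms(1)]
  have "(sw w (tgt g) (tgt f) \<bullet> (g \<star> h \<star> f)) \<bullet> ass (src g) (fst z) (src f)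
    = sw w (tgt g) (tgt f) \<bullet> ass (tgt g) (fst w) (tgt f) \<bullet> ((g \<bowtie> h) \<star> f)"
    by (simp add: ass_natural)
  also have "\<dots> = ass (fst w) (tgt g) (tgt f) \<bullet> ((hb_inv w (tgt g) \<diamondop> (g \<bowtie> h)) \<star> f)"
    by (simp add: sw_ass' act_comp)
  also have "hb_inv w (tgt g) \<diamondop> (g \<bowtie> h) = (h \<bowtie> g) \<diamondop> hb_inv z (src g)"
  proof -
    \<comment> \<open>The two factors are moved separately: \<open>g\<close> by naturality of the
      half-braiding of \<open>w\<close>, which holds for every arrow of \<open>C\<close>, and
      \<open>h\<close> because it is an arrow of the center.\<close>
    have "g \<bowtie> h = (g \<bowtie> \<I> (fst w)) \<diamondop> (\<I> (src g) \<bowtie> h)"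
      by (simp add: tensor_comp)
    then have "hb_inv w (tgt g) \<diamondop> (g \<bowtie> h)
        = (\<I> (fst w) \<bowtie> g) \<diamondop> hb_inv w (src g) \<diamondop> (\<I> (src g) \<bowtie> h)"
      using C.comp_ar_extend[OF hb_inv_natural[of w g, symmetric], of "\<I> (src g) \<bowtie> h"] by simp
    also have "\<dots> = (\<I> (fst w) \<bowtie> g) \<diamondop> (h \<bowtie> \<I> (src g)) \<diamondop> hb_inv z (src g)"
      by (simp add: hb_inv_central[OF assms(1), symmetric])
    also have "\<dots> = (h \<bowtie> g) \<diamondop> hb_inv z (src g)"
      by (simp add: tensor_comp_extend)
    finally show ?thesis .
  qed
  also have "ass (fst w) (tgt g) (tgt f) \<bullet> (((h \<bowtie> g) \<diamondop> hb_inv z (src g)) \<star> f)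
     = ass (fst w) (tgt g) (tgt f) \<bullet> ((h \<bowtie> g) \<star> f) \<bullet> (hb_inv z (src g) \<star> \<J> (src f))"
    by (simp add: act_comp)
  also have "\<dots> = (h \<star> g \<star> f) \<bullet> ass (fst z) (src g) (src f) \<bullet> (hb_inv z (src g) \<star> \<J> (src f))"
    by (simp add: ass_natural')
  also have "\<dots> = ((h \<star> g \<star> f) \<bullet> sw z (src g) (src f)) \<bullet> ass (src g) (fst z) (src f)"
    by (simp add: sw_ass)
  finally show "(sw w (tgt g) (tgt f) \<bullet> (g \<star> h \<star> f)) \<bullet> ass (src g) (fst z) (src f)
    = ((h \<star> g \<star> f) \<bullet> sw z (src g) (src f)) \<bullet> ass (src g) (fst z) (src f)" .
qed (use assms centralD[OF assms(1)] in simp_all)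

text \<open>The usual passage from a strict hexagon to one with associators: once an associator is
  cancelled, the pentagon is used for each position of the central object, to the left of, between
  and to the right of \<open>X\<close> and \<open>Y\<close>.\<close>

lemma sw_tensor:
  assumes "z \<in> Ob (center C)" "X \<in> Ob C" "Y \<in> Ob C" "m \<in> Ob M"
  shows "(\<I> (fst z) \<star> ass X Y m) \<bullet> sw z (X \<otimes>\<^sub>o Y) m
    = sw z X (Y \<diamond> m) \<bullet> (\<I> X \<star> sw z Y m) \<bullet> ass X Y (fst z \<diamond> m)"
proof (rule M.iso_ar_cancel_right[of _ "ass (X \<otimes>\<^sub>o Y) (fst z) m"])
  note [simp] = assms
  let ?Z = "fst z"
  have "((\<I> ?Z \<star> ass X Y m) \<bullet> sw z (X \<otimes>\<^sub>o Y) m) \<bullet> ass (X \<otimes>\<^sub>o Y) ?Z m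
    = (\<I> ?Z \<star> ass X Y m) \<bullet> ass ?Z (X \<otimes>\<^sub>o Y) m \<bullet> (hb_inv z (X \<otimes>\<^sub>o Y) \<star> \<J> m)"
    using sw_ass[of z "X \<otimes>\<^sub>o Y" m] by simp
  also have "\<dots> = ass ?Z X (Y \<diamond> m) \<bullet> ass (?Z \<otimes>\<^sub>o X) Y m \<bullet> (hb_inv z (X \<otimes>\<^sub>o Y) \<star> \<J> m)"
    by (simp add: pentagon')
  also have "\<dots> = ass ?Z X (Y \<diamond> m) \<bullet> ass (?Z \<otimes>\<^sub>o X) Y m \<bullet>
      ((hb_inv z X \<bowtie> \<I> Y) \<star> \<J> m) \<bullet> ((\<I> X \<bowtie> hb_inv z Y) \<star> \<J> m)"
    by (simp add: hb_inv_tensor act_comp)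
  also have "\<dots> = ass ?Z X (Y \<diamond> m) \<bullet> (hb_inv z X \<star> \<J> (Y \<diamond> m)) \<bullet> ass (X \<otimes>\<^sub>o ?Z) Y m \<bullet>
      ((\<I> X \<bowtie> hb_inv z Y) \<star> \<J> m)"
    by (simp add: ass_natural')
  also have "\<dots> = sw z X (Y \<diamond> m) \<bullet> ass X ?Z (Y \<diamond> m) \<bullet> ass (X \<otimes>\<^sub>o ?Z) Y m \<bullet>
      ((\<I> X \<bowtie> hb_inv z Y) \<star> \<J> m)"
    by (simp add: sw_ass')
  also have "\<dots> = sw z X (Y \<diamond> m) \<bullet> (\<I> X \<star> ass ?Z Y m) \<bullet> ass X (?Z \<otimes>\<^sub>o Y) m \<bullet>
      ((\<I> X \<bowtie> hb_inv z Y) \<star> \<J> m)"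
    by (simp add: pentagon')
  also have "\<dots> = sw z X (Y \<diamond> m) \<bullet> (\<I> X \<star> (ass ?Z Y m \<bullet> (hb_inv z Y \<star> \<J> m))) \<bullet>
      ass X (Y \<otimes>\<^sub>o ?Z) m"
    by (simp add: ass_natural act_comp_extend)
  also have "\<dots> = sw z X (Y \<diamond> m) \<bullet> (\<I> X \<star> sw z Y m) \<bullet> (\<I> X \<star> ass Y ?Z m) \<bullet>
      ass X (Y \<otimes>\<^sub>o ?Z) m"
    by (simp add: sw_ass[symmetric] act_comp_extend)
  also have "\<dots> = (sw z X (Y \<diamond> m) \<bullet> (\<I> X \<star> sw z Y m) \<bullet> ass X Y (?Z \<diamond> m)) \<bullet>
      ass (X \<otimes>\<^sub>o Y) ?Z m"
    by (simp add: pentagon)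
  finally show "((\<I> ?Z \<star> ass X Y m) \<bullet> sw z (X \<otimes>\<^sub>o Y) m) \<bullet> ass (X \<otimes>\<^sub>o Y) ?Z m = \<dots>" .
qed (use assms in simp_all)

text \<open>The same passage in the central argument, starting from the definition of the
  half-braiding of a tensor product in the center. It becomes the associativity axiom of the
  V-structure on \<open>rho X\<close>.\<close>

lemma sw_center_tensor:
  assumes "z \<in> Ob (center C)" "w \<in> Ob (center C)" "z \<otimes>\<^bsub>center C\<^esub> w \<in> Ob (center C)"
    "X \<in> Ob C" "m \<in> Ob M"
  shows "ass (fst z) (fst w) (X \<diamond> m) \<bullet> sw (z \<otimes>\<^bsub>center C\<^esub> w) X m
    = (\<I> (fst z) \<star> sw w X m) \<bullet> sw z X (fst w \<diamond> m) \<bullet> (\<I> X \<star> ass (fst z) (fst w) m)"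
proof (rule M.iso_ar_cancel_right[of _ "ass X (fst z \<otimes>\<^sub>o fst w) m"])
  note [simp] = assms
  let ?Z = "fst z" and ?W = "fst w" and ?zw = "z \<otimes>\<^bsub>center C\<^esub> w"
  have "(ass ?Z ?W (X \<diamond> m) \<bullet> sw ?zw X m) \<bullet> ass X (?Z \<otimes>\<^sub>o ?W) m
    = ass ?Z ?W (X \<diamond> m) \<bullet> ass (?Z \<otimes>\<^sub>o ?W) X m \<bullet> (hb_inv ?zw X \<star> \<J> m)"
    using sw_ass[of ?zw X m] by simp
  also have "\<dots> = (\<I> ?Z \<star> ass ?W X m) \<bullet> ass ?Z (?W \<otimes>\<^sub>o X) m \<bullet> (hb_inv ?zw X \<star> \<J> m)"
    by (simp add: pentagon')
  also have "\<dots> = (\<I> ?Z \<star> ass ?W X m) \<bullet> ass ?Z (?W \<otimes>\<^sub>o X) m \<bullet>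
     ((\<I> ?Z \<bowtie> hb_inv w X) \<star> \<J> m) \<bullet> ((hb_inv z X \<bowtie> \<I> ?W) \<star> \<J> m)"
    by (simp add: hb_inv_center_tensor act_comp)
  also have "\<dots> = (\<I> ?Z \<star> (ass ?W X m \<bullet> (hb_inv w X \<star> \<J> m))) \<bullet> ass ?Z (X \<otimes>\<^sub>o ?W) m \<bullet>
     ((hb_inv z X \<bowtie> \<I> ?W) \<star> \<J> m)"
    by (simp add: ass_natural' act_comp_extend)
  also have "\<dots> = (\<I> ?Z \<star> sw w X m) \<bullet> (\<I> ?Z \<star> ass X ?W m) \<bullet> ass ?Z (X \<otimes>\<^sub>o ?W) m \<bullet>
     ((hb_inv z X \<bowtie> \<I> ?W) \<star> \<J> m)"
    by (simp add: sw_ass[symmetric] act_comp_extend)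
  also have "\<dots> = (\<I> ?Z \<star> sw w X m) \<bullet> ass ?Z X (?W \<diamond> m) \<bullet> (hb_inv z X \<star> \<J> (?W \<diamond> m)) \<bullet>
     ass (X \<otimes>\<^sub>o ?Z) ?W m"
    by (simp add: pentagon' ass_natural)
  also have "\<dots> = (\<I> ?Z \<star> sw w X m) \<bullet> sw z X (?W \<diamond> m) \<bullet> ass X ?Z (?W \<diamond> m) \<bullet>
     ass (X \<otimes>\<^sub>o ?Z) ?W m"
    by (simp add: sw_ass')
  also have "\<dots> = ((\<I> ?Z \<star> sw w X m) \<bullet> sw z X (?W \<diamond> m) \<bullet> (\<I> X \<star> ass ?Z ?W m)) \<bullet>
      ass X (?Z \<otimes>\<^sub>o ?W) m"
    by (simp add: pentagon)
  finally show "(ass ?Z ?W (X \<diamond> m) \<bullet> sw ?zw X m) \<bullet> ass X (?Z \<otimes>\<^sub>o ?W) m = \<dots>" .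
qed (use assms in simp_all)

lemma sw_center_unit:
  assumes "X \<in> Ob C" "m \<in> Ob M"
  shows "uni (X \<diamond> m) \<bullet> sw \<one>\<^bsub>center C\<^esub> X m = \<I> X \<star> uni m"
proof (rule M.iso_ar_cancel_right[of _ "ass X \<one>\<^sub>o m"])
  show "(uni (X \<diamond> m) \<bullet> sw \<one>\<^bsub>center C\<^esub> X m) \<bullet> ass X \<one>\<^sub>o m = (\<I> X \<star> uni m) \<bullet> ass X \<one>\<^sub>o m"
    using assms sw_ass[of "\<one>\<^bsub>center C\<^esub>" X m]
    by (simp add: triangle triangle_left hb_inv_center_unit)
qed (use assms in simp_all)

lemma sw_unit:
  assumes "z \<in> Ob (center C)" "m \<in> Ob M"
  shows "(\<I> (fst z) \<star> uni m) \<bullet> sw z \<one>\<^sub>o m = uni (fst z \<diamond> m)"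
proof (rule M.iso_ar_cancel_right[of _ "ass \<one>\<^sub>o (fst z) m"])
  show "((\<I> (fst z) \<star> uni m) \<bullet> sw z \<one>\<^sub>o m) \<bullet> ass \<one>\<^sub>o (fst z) m
      = uni (fst z \<diamond> m) \<bullet> ass \<one>\<^sub>o (fst z) m"
    using assms sw_ass[of z "\<one>\<^sub>o" m]
    by (simp add: triangle triangle_left hb_inv_unit)
qed (use assms in simp_all)

section \<open>Evaluation and coevaluation acting on \<open>M\<close>\<close>

definition evact where
  "evact D X e m = uni m \<bullet> (e \<star> \<J> m) \<bullet> inv_ar M (ass D X m)"

definition coevact where
  "coevact X D b m = ass X D m \<bullet> (b \<star> \<J> m) \<bullet> inv_ar M (uni m)"

lemma src_tgt_evact [simp]:
  "src (evact D X e m) = D \<diamond> X \<diamond> m" "tgt (evact D X e m) = m"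
  "src (coevact X D b m) = m" "tgt (coevact X D b m) = X \<diamond> D \<diamond> m"
  by (simp_all add: evact_def coevact_def)

lemma is_ar_evact [simp]:
  "\<lbrakk>D \<in> Ob C; X \<in> Ob C; m \<in> Ob M; is_ar C e; src e = D \<otimes>\<^sub>o X; tgt e = \<one>\<^sub>o\<rbrakk>
    \<Longrightarrow> is_ar M (evact D X e m)"
  "\<lbrakk>D \<in> Ob C; X \<in> Ob C; m \<in> Ob M; is_ar C b; tgt b = X \<otimes>\<^sub>o D; src b = \<one>\<^sub>o\<rbrakk>
    \<Longrightarrow> is_ar M (coevact X D b m)"
  by (simp_all add: evact_def coevact_def)

text \<open>Stated for an arbitrary arrow \<open>e\<close> of this type, like the naturality rules
  that follow, so as to serve both the evaluation of \<open>G v\<close> obtained from V and the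
  evaluation chosen in \<open>C\<close>.\<close>

lemma evact_ass:
  "\<lbrakk>D \<in> Ob C; X \<in> Ob C; m \<in> Ob M; is_ar C e; src e = D \<otimes>\<^sub>o X; tgt e = \<one>\<^sub>o\<rbrakk>
    \<Longrightarrow> evact D X e m \<bullet> ass D X m = uni m \<bullet> (e \<star> \<J> m)"
  by (simp add: evact_def)

lemma evact_natural:
  assumes "is_ar M f" "D \<in> Ob C" "X \<in> Ob C" "is_ar C e" "src e = D \<otimes>\<^sub>o X" "tgt e = \<one>\<^sub>o"
  shows "evact D X e (tgt f) \<bullet> (\<I> D \<star> \<I> X \<star> f) = f \<bullet> evact D X e (src f)"
proof (rule M.iso_ar_cancel_right[of _ "ass D X (src f)"])
  note [simp] = assms
  have "(evact D X e (tgt f) \<bullet> (\<I> D \<star> \<I> X \<star> f)) \<bullet> ass D X (src f)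
      = evact D X e (tgt f) \<bullet> ass D X (tgt f) \<bullet> (\<I> (D \<otimes>\<^sub>o X) \<star> f)"
    using ass_natural[of "\<I> D" "\<I> X" f] by simp
  also have "\<dots> = uni (tgt f) \<bullet> (e \<star> f)"
    by (simp add: evact_def act_comp)
  also have "\<dots> = uni (tgt f) \<bullet> (\<I> \<one>\<^sub>o \<star> f) \<bullet> (e \<star> \<J> (src f))"
    by (simp add: act_comp)
  also have "\<dots> = f \<bullet> uni (src f) \<bullet> (e \<star> \<J> (src f))"
    using M.comp_ar_extend[OF uni_natural[of f], of "e \<star> \<J> (src f)"] by simp
  also have "\<dots> = (f \<bullet> evact D X e (src f)) \<bullet> ass D X (src f)"
    by (simp add: evact_ass)
  finally show "(evact D X e (tgt f) \<bullet> (\<I> D \<star> \<I> X \<star> f)) \<bullet> ass D X (src f) = \<dots>" .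
qed (use assms in simp_all)

lemma coevact_natural:
  assumes "is_ar M f" "D \<in> Ob C" "X \<in> Ob C" "is_ar C b" "tgt b = X \<otimes>\<^sub>o D" "src b = \<one>\<^sub>o"
  shows "(\<I> X \<star> \<I> D \<star> f) \<bullet> coevact X D b (src f) = coevact X D b (tgt f) \<bullet> f"
proof (rule M.iso_ar_cancel_right[of _ "uni (src f)"])
  note [simp] = assms
  have "((\<I> X \<star> \<I> D \<star> f) \<bullet> coevact X D b (src f)) \<bullet> uni (src f)
     = (\<I> X \<star> \<I> D \<star> f) \<bullet> ass X D (src f) \<bullet> (b \<star> \<J> (src f))"
    by (simp add: coevact_def)
  also have "\<dots> = ass X D (tgt f) \<bullet> (\<I> (X \<otimes>\<^sub>o D) \<star> f) \<bullet> (b \<star> \<J> (src f))"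
    using ass_natural'[of "\<I> X" "\<I> D" f _ _ _ "b \<star> \<J> (src f)"] by simp
  also have "\<dots> = ass X D (tgt f) \<bullet> (b \<star> \<J> (tgt f)) \<bullet> (\<I> \<one>\<^sub>o \<star> f)"
    by (simp add: act_comp)
  also have "\<dots> = coevact X D b (tgt f) \<bullet> uni (tgt f) \<bullet> (\<I> \<one>\<^sub>o \<star> f)"
    by (simp add: coevact_def)
  also have "\<dots> = (coevact X D b (tgt f) \<bullet> f) \<bullet> uni (src f)"
    by (simp add: uni_natural)
  finally show "((\<I> X \<star> \<I> D \<star> f) \<bullet> coevact X D b (src f)) \<bullet> uni (src f) = \<dots>" .
qed (use assms in simp_all)

lemma inv_uni_act:
  assumes "X \<in> Ob C" "m \<in> Ob M"
  shows "inv_ar M (uni (X \<diamond> m)) = ass \<one>\<^sub>o X m"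
proof (rule M.iso_ar_cancel_left[of "uni (X \<diamond> m)"])
  show "uni (X \<diamond> m) \<bullet> inv_ar M (uni (X \<diamond> m)) = uni (X \<diamond> m) \<bullet> ass \<one>\<^sub>o X m"
    using assms by (simp add: triangle_left)
qed (use assms in simp_all)

text \<open>Inside the coevaluation, \<open>inv_uni_act\<close> replaces the inverse unit
  isomorphism by an associator. Pentagon and naturality then collect the associators until the snake
  composite of \<open>X\<close> acts as a whole.\<close>

lemma snake_act:
  assumes "D \<in> Ob C" "X \<in> Ob C" "m \<in> Ob M" "is_ar C e" "src e = D \<otimes>\<^sub>o X" "tgt e = \<one>\<^sub>o"
    "is_ar C b" "tgt b = X \<otimes>\<^sub>o D" "src b = \<one>\<^sub>o"
    "(\<I> X \<bowtie> e) \<diamondop> (b \<bowtie> \<I> X) = \<I> X"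
  shows "(\<I> X \<star> evact D X e m) \<bullet> coevact X D b (X \<diamond> m) = \<J> (X \<diamond> m)"
proof -
  note [simp] = assms
  have "(\<I> X \<star> evact D X e m) \<bullet> coevact X D b (X \<diamond> m)
    = (\<I> X \<star> evact D X e m) \<bullet> ass X D (X \<diamond> m) \<bullet> (b \<star> \<J> (X \<diamond> m)) \<bullet> ass \<one>\<^sub>o X m"
    by (simp add: coevact_def inv_uni_act)
  also have "\<dots> = (\<I> X \<star> evact D X e m) \<bullet> ass X D (X \<diamond> m) \<bullet> ass (X \<otimes>\<^sub>o D) X m \<bullet>
      ((b \<bowtie> \<I> X) \<star> \<J> m)"
    using ass_natural[of b "\<I> X" "\<J> m"] by simp
  also have "\<dots> = (\<I> X \<star> evact D X e m) \<bullet> (\<I> X \<star> ass D X m) \<bullet> ass X (D \<otimes>\<^sub>o X) m \<bullet>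
      ((b \<bowtie> \<I> X) \<star> \<J> m)"
    by (simp add: pentagon')
  also have "\<dots> = (\<I> X \<star> uni m) \<bullet> (\<I> X \<star> e \<star> \<J> m) \<bullet> ass X (D \<otimes>\<^sub>o X) m \<bullet>
      ((b \<bowtie> \<I> X) \<star> \<J> m)"
    by (simp add: act_comp_extend evact_ass)
  also have "\<dots> = (\<I> X \<star> uni m) \<bullet> ass X \<one>\<^sub>o m \<bullet> (((\<I> X \<bowtie> e) \<diamondop> (b \<bowtie> \<I> X)) \<star> \<J> m)"
    using ass_natural'[of "\<I> X" e "\<J> m" _ _ _ "(b \<bowtie> \<I> X) \<star> \<J> m"] by (simp add: act_comp del: assms(10))
  also have "\<dots> = \<J> (X \<diamond> m)"
    by (simp add: triangle)
  finally show ?thesis .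
qed

text \<open>As \<open>e\<close> is an arrow of the center, carrying \<open>X\<close> past both
  factors and then evaluating amounts to carrying it past the unit of the center, where
  \<open>sw\<close> reduces to unit isomorphisms.\<close>

lemma evact_central:
  assumes e: "central (z \<otimes>\<^bsub>center C\<^esub> w) \<one>\<^bsub>center C\<^esub> e"
    and "z \<in> Ob (center C)" "w \<in> Ob (center C)" "X \<in> Ob C" "m \<in> Ob M"
  shows "evact (fst z) (fst w) e (X \<diamond> m) \<bullet> (\<I> (fst z) \<star> sw w X m) \<bullet> sw z X (fst w \<diamond> m)
    = \<I> X \<star> evact (fst z) (fst w) e m"
proof (rule M.iso_ar_cancel_right[of _ "\<I> X \<star> ass (fst z) (fst w) m"])
  note [simp] = assms centralD(1-5)[OF e]
  let ?Z = "fst z" and ?W = "fst w" and ?zw = "z \<otimes>\<^bsub>center C\<^esub> w"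
  have "(evact ?Z ?W e (X \<diamond> m) \<bullet> (\<I> ?Z \<star> sw w X m) \<bullet> sw z X (?W \<diamond> m)) \<bullet>
      (\<I> X \<star> ass ?Z ?W m) = evact ?Z ?W e (X \<diamond> m) \<bullet> ass ?Z ?W (X \<diamond> m) \<bullet> sw ?zw X m"
    by (simp add: sw_center_tensor)
  also have "\<dots> = uni (X \<diamond> m) \<bullet> (e \<star> \<J> (X \<diamond> m)) \<bullet> sw ?zw X m"
    by (simp add: evact_def)
  also have "\<dots> = uni (X \<diamond> m) \<bullet> sw \<one>\<^bsub>center C\<^esub> X m \<bullet> (\<I> X \<star> e \<star> \<J> m)"
    using sw_natural[OF e, of "\<I> X" "\<J> m"] by simp
  also have "\<dots> = (\<I> X \<star> uni m) \<bullet> (\<I> X \<star> e \<star> \<J> m)"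
    using M.comp_ar_extend[OF sw_center_unit[of X m], of "\<I> X \<star> e \<star> \<J> m"] by simp
  also have "\<dots> = (\<I> X \<star> evact ?Z ?W e m) \<bullet> (\<I> X \<star> ass ?Z ?W m)"
    by (simp add: act_comp evact_ass)
  finally show "(evact ?Z ?W e (X \<diamond> m) \<bullet> (\<I> ?Z \<star> sw w X m) \<bullet> sw z X (?W \<diamond> m)) \<bullet>
      (\<I> X \<star> ass ?Z ?W m) = \<dots>" .
qed (use assms centralD[OF e] in simp_all)

text \<open>Here the central object passes the pair that is evaluated, so that naturality of its
  half-braiding along the arrow \<open>e\<close> of \<open>C\<close> is what applies.\<close>

lemma evact_sw:
  assumes "z \<in> Ob (center C)" "D \<in> Ob C" "X \<in> Ob C" "m \<in> Ob M"
    "is_ar C e" "src e = D \<otimes>\<^sub>o X" "tgt e = \<one>\<^sub>o"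
  shows "(\<I> (fst z) \<star> evact D X e m) \<bullet> sw z D (X \<diamond> m) \<bullet> (\<I> D \<star> sw z X m)
    = evact D X e (fst z \<diamond> m)"
proof (rule M.iso_ar_cancel_right[of _ "ass D X (fst z \<diamond> m)"])
  note [simp] = assms
  let ?Z = "fst z"
  have id: "central z z (\<I> (fst z))"
    by (simp add: central_def)
  have "((\<I> ?Z \<star> evact D X e m) \<bullet> sw z D (X \<diamond> m) \<bullet> (\<I> D \<star> sw z X m)) \<bullet> ass D X (?Z \<diamond> m)
     = (\<I> ?Z \<star> evact D X e m) \<bullet> (\<I> ?Z \<star> ass D X m) \<bullet> sw z (D \<otimes>\<^sub>o X) m"
    by (simp add: sw_tensor)
  also have "\<dots> = (\<I> ?Z \<star> uni m) \<bullet> (\<I> ?Z \<star> e \<star> \<J> m) \<bullet> sw z (D \<otimes>\<^sub>o X) m"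
    by (simp add: act_comp_extend evact_ass)
  also have "\<dots> = (\<I> ?Z \<star> uni m) \<bullet> sw z \<one>\<^sub>o m \<bullet> (e \<star> \<J> (?Z \<diamond> m))"
    using sw_natural[OF id, of e "\<J> m"] by simp
  also have "\<dots> = uni (?Z \<diamond> m) \<bullet> (e \<star> \<J> (?Z \<diamond> m))"
    using M.comp_ar_extend[OF sw_unit[of z m], of "e \<star> \<J> (?Z \<diamond> m)"] by simp
  also have "\<dots> = evact D X e (?Z \<diamond> m) \<bullet> ass D X (?Z \<diamond> m)"
    by (simp add: evact_ass)
  finally show "((\<I> ?Z \<star> evact D X e m) \<bullet> sw z D (X \<diamond> m) \<bullet> (\<I> D \<star> sw z X m)) \<bullet>
      ass D X (?Z \<diamond> m) = \<dots>" .
qed (use assms in simp_all)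

section \<open>Closure properties of the center\<close>

lemma center_obI:
  assumes "A \<in> Ob C" "s \<in> extensional (Ob C)" "\<And>X. X \<in> Ob C \<Longrightarrow> iso_ar C (hb (A, s) X)"
    "\<And>f. is_ar C f \<Longrightarrow>
      (f \<bowtie> \<I> A) \<diamondop> hb (A, s) (src f) = hb (A, s) (tgt f) \<diamondop> (\<I> A \<bowtie> f)"
    "\<And>X Y. \<lbrakk>X \<in> Ob C; Y \<in> Ob C\<rbrakk> \<Longrightarrow>
      hb (A, s) (X \<otimes>\<^sub>o Y) = (\<I> X \<bowtie> hb (A, s) Y) \<diamondop> (hb (A, s) X \<bowtie> \<I> Y)"
  shows "(A, s) \<in> Ob (center C)"
  unfolding center_ob_iff half_braiding_def
proof (intro conjI ballI; simp)
  fix X assume "X \<in> Ob C"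
  then show "is_iso C (A \<otimes>\<^sub>o X) (X \<otimes>\<^sub>o A) (s X)"
    using assms(3)[of X] by (simp add: iso_ar_def hb_def)
next
  fix X Y f assume "X \<in> Ob C" "Y \<in> Ob C" "f \<in> Hom C X Y"
  then show "(f \<otimes>\<^sub>a\<^bsub>C\<^esub> ident C A) \<cdot>\<^bsub>C\<^esub> s X = s Y \<cdot>\<^bsub>C\<^esub> (ident C A \<otimes>\<^sub>a\<^bsub>C\<^esub> f)"
    using assms(4)[of "Ar X f Y"] by (simp add: comp_ar_def hb_def tensor_ar_def id_ar_def)
next
  fix X Y assume "X \<in> Ob C" "Y \<in> Ob C"
  then show "s (X \<otimes>\<^sub>o Y) = (ident C X \<otimes>\<^sub>a\<^bsub>C\<^esub> s Y) \<cdot>\<^bsub>C\<^esub> (s X \<otimes>\<^sub>a\<^bsub>C\<^esub> ident C Y)"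
    using assms(5)[of X Y] by (simp add: comp_ar_def hb_def tensor_ar_def id_ar_def)
qed (use assms in simp_all)

lemma center_tensor_ob [simp]:
  assumes "z \<in> Ob (center C)" "w \<in> Ob (center C)"
  shows "z \<otimes>\<^bsub>center C\<^esub> w \<in> Ob (center C)"
proof -
  note [simp] = assms
  let ?Z = "fst z" and ?W = "fst w" and ?zw = "z \<otimes>\<^bsub>center C\<^esub> w"
  have "(fst ?zw, snd ?zw) \<in> Ob (center C)"
  proof (rule center_obI, unfold prod.collapse, unfold fst_center_tensor)
    show "snd ?zw \<in> extensional (Ob C)"
      by (simp add: center_def split_beta)
    fix X assume "X \<in> Ob C"
    then show "iso_ar C (hb ?zw X)"
      by (simp add: hb_center_tensor)
  next
    fix f assume f [simp]: "is_ar C f"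
    have "(f \<bowtie> \<I> (?Z \<otimes>\<^sub>o ?W)) \<diamondop> hb ?zw (src f)
       = (((f \<bowtie> \<I> ?Z) \<diamondop> hb z (src f)) \<bowtie> \<I> ?W) \<diamondop> (\<I> ?Z \<bowtie> hb w (src f))"
      using tensor_comp_extend[of "hb z (src f)" "f \<bowtie> \<I> ?Z" "\<I> ?W" "\<I> ?W" "\<I> ?Z \<bowtie> hb w (src f)"]
      by (simp add: hb_center_tensor)
    also have "\<dots> = (hb z (tgt f) \<bowtie> \<I> ?W) \<diamondop> (\<I> ?Z \<bowtie> f \<bowtie> \<I> ?W) \<diamondop> (\<I> ?Z \<bowtie> hb w (src f))"
      using tensor_comp[of "\<I> ?Z \<bowtie> f" "hb z (tgt f)" "\<I> ?W" "\<I> ?W"]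
      by (simp add: hb_natural flip: C.comp_ar_assoc)
    also have "\<dots> = (hb z (tgt f) \<bowtie> \<I> ?W) \<diamondop> (\<I> ?Z \<bowtie> hb w (tgt f)) \<diamondop> (\<I> ?Z \<bowtie> \<I> ?W \<bowtie> f)"
      by (simp add: tensor_comp hb_natural)
    also have "\<dots> = hb ?zw (tgt f) \<diamondop> (\<I> (?Z \<otimes>\<^sub>o ?W) \<bowtie> f)"
      by (simp add: hb_center_tensor flip: tensor_id)
    finally show "(f \<bowtie> \<I> (?Z \<otimes>\<^sub>o ?W)) \<diamondop> hb ?zw (src f) = \<dots>" .
  next
    fix X Y assume [simp]: "X \<in> Ob C" "Y \<in> Ob C"
    \<comment> \<open>The only exchange in the hexagon of \<open>z \<otimes> w\<close>: the two
      half-braidings involved act on disjoint tensor factors.\<close>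
    have a: "(hb z X \<bowtie> \<I> Y \<bowtie> \<I> ?W) \<diamondop> (\<I> ?Z \<bowtie> \<I> X \<bowtie> hb w Y)
       = (\<I> X \<bowtie> \<I> ?Z \<bowtie> hb w Y) \<diamondop> (hb z X \<bowtie> \<I> ?W \<bowtie> \<I> Y)" (is "?l1 \<diamondop> ?l2 = ?r1 \<diamondop> ?r2")
      using tensor_comp[of "\<I> (?Z \<otimes>\<^sub>o X)" "hb z X" "hb w Y" "\<I> (Y \<otimes>\<^sub>o ?W)"]
        tensor_comp[of "hb z X" "\<I> (X \<otimes>\<^sub>o ?Z)" "\<I> (?W \<otimes>\<^sub>o Y)" "hb w Y"]
      by (simp flip: tensor_id) simp
    have "hb ?zw (X \<otimes>\<^sub>o Y) = (\<I> X \<bowtie> hb z Y \<bowtie> \<I> ?W) \<diamondop> ?l1 \<diamondop> ?l2 \<diamondop> (\<I> ?Z \<bowtie> hb w X \<bowtie> \<I> Y)"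
      using tensor_comp[of "hb z X \<bowtie> \<I> Y" "\<I> X \<bowtie> hb z Y" "\<I> ?W" "\<I> ?W", symmetric]
        tensor_comp[of "\<I> ?Z" "\<I> ?Z" "hb w X \<bowtie> \<I> Y" "\<I> X \<bowtie> hb w Y", symmetric]
      by (simp add: hb_center_tensor hb_tensor del: tensor_id)
    also have "\<dots> = (\<I> X \<bowtie> hb z Y \<bowtie> \<I> ?W) \<diamondop> ?r1 \<diamondop> ?r2 \<diamondop> (\<I> ?Z \<bowtie> hb w X \<bowtie> \<I> Y)"
      using C.comp_ar_extend[OF a, of "\<I> ?Z \<bowtie> hb w X \<bowtie> \<I> Y"] by simp
    also have "\<dots> = (\<I> X \<bowtie> hb ?zw Y) \<diamondop> (hb ?zw X \<bowtie> \<I> Y)"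
      using tensor_comp[of "\<I> X" "\<I> X" "\<I> ?Z \<bowtie> hb w Y" "hb z Y \<bowtie> \<I> ?W", symmetric]
        tensor_comp[of "\<I> ?Z \<bowtie> hb w X" "hb z X \<bowtie> \<I> ?W" "\<I> Y" "\<I> Y", symmetric]
      by (simp add: hb_center_tensor del: tensor_id)
    finally show "hb ?zw (X \<otimes>\<^sub>o Y) = \<dots>" .
  qed simp
  then show ?thesis by (simp only: prod.collapse)
qed

lemma central_id [simp]: "z \<in> Ob (center C) \<Longrightarrow> central z z (\<I> (fst z))"
  by (simp add: central_def)

lemma central_comp:
  assumes "central z w g" "central w y h"
  shows "central z y (h \<diamondop> g)"
  unfolding central_def
proof (intro conjI ballI)
  note [simp] = centralD(1-5)[OF assms(1)] centralD(1-5)[OF assms(2)]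
  fix X assume [simp]: "X \<in> Ob C"
  have "(\<I> X \<bowtie> (h \<diamondop> g)) \<diamondop> hb z X = (\<I> X \<bowtie> h) \<diamondop> (\<I> X \<bowtie> g) \<diamondop> hb z X"
    by (simp add: tensor_comp_extend)
  also have "\<dots> = (\<I> X \<bowtie> h) \<diamondop> hb w X \<diamondop> (g \<bowtie> \<I> X)"
    using centralD(6)[OF assms(1), of X] by simp
  also have "\<dots> = hb y X \<diamondop> (h \<bowtie> \<I> X) \<diamondop> (g \<bowtie> \<I> X)"
    using C.comp_ar_extend[OF centralD(6)[OF assms(2), of X], of "g \<bowtie> \<I> X"] by simp
  also have "\<dots> = hb y X \<diamondop> ((h \<diamondop> g) \<bowtie> \<I> X)"
    by (simp add: tensor_comp)
  finally show "(\<I> X \<bowtie> (h \<diamondop> g)) \<diamondop> hb z X = \<dots>" .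
qed (use centralD[OF assms(1)] centralD[OF assms(2)] in simp_all)

lemma central_inv:
  assumes "central z w h" "iso_ar C h"
  shows "central w z (inv_ar C h)"
  unfolding central_def
proof (intro conjI ballI)
  note [simp] = centralD(1-5)[OF assms(1)] assms(2)
  fix X assume X [simp]: "X \<in> Ob C"
  have i: "inv_ar C (\<I> X \<bowtie> h) = \<I> X \<bowtie> inv_ar C h" "inv_ar C (h \<bowtie> \<I> X) = inv_ar C h \<bowtie> \<I> X"
    by (rule C.iso_arI(2); simp add: tensor_comp)+
  show "(\<I> X \<bowtie> inv_ar C h) \<diamondop> hb w X = hb z X \<diamondop> (inv_ar C h \<bowtie> \<I> X)"
    using inverse_square[of "h \<bowtie> \<I> X" "\<I> X \<bowtie> h" "hb w X" "hb z X"] centralD(6)[OF assms(1) X]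
    by (simp add: i)
qed (use centralD[OF assms(1)] assms(2) in simp_all)

end

section \<open>Module functors over a central functor\<close>

lemma is_functor_comp:
  assumes "is_functor C D F" "is_ar C f" "is_ar C g" "tgt f = src g"
  shows "far F (arr g \<cdot>\<^bsub>C\<^esub> arr f) = far F (arr g) \<cdot>\<^bsub>D\<^esub> far F (arr f)"
proof -
  have "src f \<in> Ob C" "tgt f \<in> Ob C" "tgt g \<in> Ob C" "arr f \<in> Hom C (src f) (tgt f)"
    "arr g \<in> Hom C (tgt f) (tgt g)"
    using assms(2-4) unfolding is_ar_def by auto
  then show ?thesis
    using assms(1) unfolding is_functor_def by blast
qed

section \<open>The strong monoidal functor \<open>G\<close> into the center\<close>

locale central_setting =
  V: tensor_category V + C: tensor_category C + action_setting C M a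
  for V :: "('vo, 'vm, 'k::alg_closed_field) tensor_cat"
    and C :: "('co, 'cm, 'k) tensor_cat"
    and M :: "('mo, 'mm, 'k) kcat"
    and a :: "('co, 'cm, 'mo, 'mm) action" +
  fixes G :: "('vo, 'vm, 'co \<times> ('co \<Rightarrow> 'cm), 'cm) mon_fctr"
  assumes G: "monoidal_functor V (center C) G"
begin

abbreviation gob where "gob v \<equiv> fst (fob G v)"

definition gar where
  "gar g = Ar (gob (src g)) (far G (arr g)) (gob (tgt g))"

definition gmu where
  "gmu v w = Ar (gob v \<otimes>\<^sub>o gob w) (mu G v w) (gob (v \<otimes>\<^bsub>V\<^esub> w))"

definition geps where
  "geps = Ar \<one>\<^sub>o (eps G) (gob \<one>\<^bsub>V\<^esub>)"

lemma src_tgt_g [simp]: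
  "src (gar g) = gob (src g)" "tgt (gar g) = gob (tgt g)"
  "src (gmu v w) = gob v \<otimes>\<^sub>o gob w" "tgt (gmu v w) = gob (v \<otimes>\<^bsub>V\<^esub> w)"
  "src geps = \<one>\<^sub>o" "tgt geps = gob \<one>\<^bsub>V\<^esub>"
  by (simp_all add: gar_def gmu_def geps_def)

lemma V_ob [simp]:
  "\<one>\<^bsub>V\<^esub> \<in> Ob V" "\<lbrakk>v \<in> Ob V; w \<in> Ob V\<rbrakk> \<Longrightarrow> v \<otimes>\<^bsub>V\<^esub> w \<in> Ob V" "v \<in> Ob V \<Longrightarrow> dual V v \<in> Ob V"
  using V.left_dual by (auto simp: V.unit_closed V.tensor_ob_closed is_left_dual_def)

lemma G_ob [simp]: "v \<in> Ob V \<Longrightarrow> fob G v \<in> Ob (center C)"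
  using G by (simp add: monoidal_functor_def is_functor_def)

lemma gar_central: "is_ar V g \<Longrightarrow> central (fob G (src g)) (fob G (tgt g)) (gar g)"
  using G unfolding is_ar_def by (simp add: gar_def central_iff monoidal_functor_def is_functor_def)

lemma center_comp [simp]: "comp_arr (center C) = comp_arr C"
  "tensor_arr (center C) = tensor_arr C" "ident (center C) z = ident C (fst z)"
  by (simp_all add: center_def split_beta)

lemma gar_comp:
  assumes "is_ar V f" "is_ar V g" "tgt f = src g"
  shows "gar (comp_ar V g f) = gar g \<diamondop> gar f"
proof -
  have "far G (arr g \<cdot>\<^bsub>V\<^esub> arr f) = far G (arr g) \<cdot>\<^bsub>C\<^esub> far G (arr f)"
    using G is_functor_comp[OF _ assms, of "center C" G] by (simp add: monoidal_functor_def)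
  then show ?thesis by (simp add: gar_def comp_ar_def)
qed

lemma gar_id [simp]: "v \<in> Ob V \<Longrightarrow> gar (id_ar V v) = \<I> (gob v)"
  using G unfolding monoidal_functor_def is_functor_def
  by (simp add: gar_def id_ar_def)

text \<open>\<open>V_action\<close> and \<open>ev_G\<close> invert the comparison arrows
  \<open>mu\<close> and \<open>eps\<close> in \<open>C\<close>, whereas a monoidal functor provides
  their inverses in the center. Forgetting the half-braidings transfers them.\<close>

lemma iso_center_imp:
  assumes "is_iso (center C) z w f" "z \<in> Ob (center C)" "w \<in> Ob (center C)"
  shows "iso_ar C (Ar (fst z) f (fst w))" "central z w (Ar (fst z) f (fst w))"
proof -
  obtain g where g: "is_inverse (center C) z w f g"
    using assms(1) by (auto simp: is_iso_def)
  then have c: "central z w (Ar (fst z) f (fst w))" "central w z (Ar (fst w) g (fst z))"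
    using assms by (simp_all add: central_iff is_inverse_def)
  show "central z w (Ar (fst z) f (fst w))" by fact
  show "iso_ar C (Ar (fst z) f (fst w))"
    using g centralD(3)[OF c(1)] centralD(3)[OF c(2)]
    by (intro C.iso_arI(1)[of _ "Ar (fst w) g (fst z)"])
      (simp_all add: is_inverse_def comp_ar_def id_ar_def)
qed

lemma gmu_iso [simp]:
  assumes "v \<in> Ob V" "w \<in> Ob V"
  shows "iso_ar C (gmu v w)"
  using iso_center_imp(1)[of "fob G v \<otimes>\<^bsub>center C\<^esub> fob G w" "fob G (v \<otimes>\<^bsub>V\<^esub> w)" "mu G v w"] G assms
  by (simp add: monoidal_functor_def gmu_def)

lemma gmu_central:
  assumes "v \<in> Ob V" "w \<in> Ob V"
  shows "central (fob G v \<otimes>\<^bsub>center C\<^esub> fob G w) (fob G (v \<otimes>\<^bsub>V\<^esub> w)) (gmu v w)"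
  using iso_center_imp(2)[of "fob G v \<otimes>\<^bsub>center C\<^esub> fob G w" "fob G (v \<otimes>\<^bsub>V\<^esub> w)" "mu G v w"] G assms
  by (simp add: monoidal_functor_def gmu_def)

lemma geps_iso [simp]: "iso_ar C geps"
  using iso_center_imp(1)[of "\<one>\<^bsub>center C\<^esub>" "fob G \<one>\<^bsub>V\<^esub>" "eps G"] G
  by (simp add: monoidal_functor_def geps_def)

lemma geps_central: "central \<one>\<^bsub>center C\<^esub> (fob G \<one>\<^bsub>V\<^esub>) geps"
  using iso_center_imp(2)[of "\<one>\<^bsub>center C\<^esub>" "fob G \<one>\<^bsub>V\<^esub>" "eps G"] G
  by (simp add: monoidal_functor_def geps_def)

lemma is_ar_g [simp]:
  "is_ar V g \<Longrightarrow> is_ar C (gar g)" "\<lbrakk>v \<in> Ob V; w \<in> Ob V\<rbrakk> \<Longrightarrow> is_ar C (gmu v w)" "is_ar C geps"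
  using centralD(3)[OF gar_central[of g]] by simp_all

lemma gmu_natural:
  assumes "is_ar V f" "is_ar V g"
  shows "gar (tensor_ar V f g) \<diamondop> gmu (src f) (src g) = gmu (tgt f) (tgt g) \<diamondop> (gar f \<bowtie> gar g)"
proof -
  have "far G (arr f \<otimes>\<^sub>a\<^bsub>V\<^esub> arr g) \<cdot>\<^bsub>C\<^esub> mu G (src f) (src g)
      = mu G (tgt f) (tgt g) \<cdot>\<^bsub>C\<^esub> (far G (arr f) \<otimes>\<^sub>a\<^bsub>C\<^esub> far G (arr g))"
    using G assms unfolding monoidal_functor_def is_ar_def by simp
  then show ?thesis by (simp add: gar_def comp_ar_def tensor_ar_def gmu_def)
qed

lemma gmu_assoc:
  assumes "u \<in> Ob V" "v \<in> Ob V" "w \<in> Ob V"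
  shows "gmu (u \<otimes>\<^bsub>V\<^esub> v) w \<diamondop> (gmu u v \<bowtie> \<I> (gob w)) = gmu u (v \<otimes>\<^bsub>V\<^esub> w) \<diamondop> (\<I> (gob u) \<bowtie> gmu v w)"
proof -
  have "mu G (u \<otimes>\<^bsub>V\<^esub> v) w \<cdot>\<^bsub>C\<^esub> (mu G u v \<otimes>\<^sub>a\<^bsub>C\<^esub> ident C (gob w)) =
      mu G u (v \<otimes>\<^bsub>V\<^esub> w) \<cdot>\<^bsub>C\<^esub> (ident C (gob u) \<otimes>\<^sub>a\<^bsub>C\<^esub> mu G v w)"
    using G assms unfolding monoidal_functor_def by simp
  then show ?thesis using assms
    by (simp add: gar_def comp_ar_def tensor_ar_def gmu_def id_ar_def V.tensor_ob_assoc)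
qed

lemma gmu_unit:
  assumes "v \<in> Ob V"
  shows "gmu \<one>\<^bsub>V\<^esub> v \<diamondop> (geps \<bowtie> \<I> (gob v)) = \<I> (gob v)"
    "gmu v \<one>\<^bsub>V\<^esub> \<diamondop> (\<I> (gob v) \<bowtie> geps) = \<I> (gob v)"
proof -
  have "mu G \<one>\<^bsub>V\<^esub> v \<cdot>\<^bsub>C\<^esub> (eps G \<otimes>\<^sub>a\<^bsub>C\<^esub> ident C (gob v)) = ident C (gob v)"
    "mu G v \<one>\<^bsub>V\<^esub> \<cdot>\<^bsub>C\<^esub> (ident C (gob v) \<otimes>\<^sub>a\<^bsub>C\<^esub> eps G) = ident C (gob v)"
    using G assms unfolding monoidal_functor_def by simp_all
  then show "gmu \<one>\<^bsub>V\<^esub> v \<diamondop> (geps \<bowtie> \<I> (gob v)) = \<I> (gob v)"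
    "gmu v \<one>\<^bsub>V\<^esub> \<diamondop> (\<I> (gob v) \<bowtie> geps) = \<I> (gob v)"
    using assms
    by (simp_all add: gar_def comp_ar_def tensor_ar_def gmu_def geps_def id_ar_def
        V.unit_ob_left V.unit_ob_right)
qed

definition evG where
  "evG v = inv_ar C geps \<diamondop> gar (Ar (dual V v \<otimes>\<^bsub>V\<^esub> v) (ev V v) \<one>\<^bsub>V\<^esub>) \<diamondop> gmu (dual V v) v"

text \<open>Partner of \<open>evG\<close>, assembled from \<open>coev V v\<close> in the mirrored
  way. It serves to make the evaluation of \<open>G v\<close> cancellable.\<close>

definition coevG where
  "coevG v = inv_ar C (gmu v (dual V v)) \<diamondop> gar (Ar \<one>\<^bsub>V\<^esub> (coev V v) (v \<otimes>\<^bsub>V\<^esub> dual V v)) \<diamondop> geps"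

lemma src_tgt_evG [simp]:
  "src (evG v) = gob (dual V v) \<otimes>\<^sub>o gob v" "tgt (evG v) = \<one>\<^sub>o"
  "src (coevG v) = \<one>\<^sub>o" "tgt (coevG v) = gob v \<otimes>\<^sub>o gob (dual V v)"
  by (simp_all add: evG_def coevG_def)

lemma ev_V:
  assumes "v \<in> Ob V"
  shows "is_ar V (Ar (dual V v \<otimes>\<^bsub>V\<^esub> v) (ev V v) \<one>\<^bsub>V\<^esub>)"
    "is_ar V (Ar \<one>\<^bsub>V\<^esub> (coev V v) (v \<otimes>\<^bsub>V\<^esub> dual V v))"
  using V.left_dual[OF assms] assms by (simp_all add: is_left_dual_def)

lemma is_ar_evG [simp]: "v \<in> Ob V \<Longrightarrow> is_ar C (evG v)" "v \<in> Ob V \<Longrightarrow> is_ar C (coevG v)"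
  using ev_V[of v] by (simp_all add: evG_def coevG_def)

text \<open>Each factor is an arrow of the center: \<open>G\<close> takes values there, and its
  comparison arrows are isomorphisms there.\<close>

lemma evG_central:
  assumes "v \<in> Ob V"
  shows "central (fob G (dual V v) \<otimes>\<^bsub>center C\<^esub> fob G v) \<one>\<^bsub>center C\<^esub> (evG v)"
  unfolding evG_def using assms gar_central[OF ev_V(1)[OF assms]]
  by (intro central_comp[OF central_comp]) (auto intro: gmu_central central_inv geps_central)

text \<open>Strong monoidal functors preserve duals. The unit axiom replaces the inverse of
  \<open>eps\<close> by a component of \<open>mu\<close>, associativity of \<open>mu\<close> joins
  the two inner terms, naturality of \<open>mu\<close> exposes images under \<open>G\<close>, and
  what is left is \<open>G\<close> of the snake identity in V.\<close>

lemma snake_G: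
  assumes "v \<in> Ob V"
  shows "(\<I> (gob v) \<bowtie> evG v) \<diamondop> (coevG v \<bowtie> \<I> (gob v)) = \<I> (gob v)"
proof -
  note [simp] = assms ev_V[OF assms] ev_V[OF assms, unfolded is_ar_Ar]
  let ?w = "dual V v" and ?e = "Ar (dual V v \<otimes>\<^bsub>V\<^esub> v) (ev V v) \<one>\<^bsub>V\<^esub>"
    and ?b = "Ar \<one>\<^bsub>V\<^esub> (coev V v) (v \<otimes>\<^bsub>V\<^esub> dual V v)" and ?I = "\<I> (gob v)"
  have [simp]: "(v \<otimes>\<^bsub>V\<^esub> ?w) \<otimes>\<^bsub>V\<^esub> v = v \<otimes>\<^bsub>V\<^esub> ?w \<otimes>\<^bsub>V\<^esub> v" "\<one>\<^bsub>V\<^esub> \<otimes>\<^bsub>V\<^esub> v = v" "v \<otimes>\<^bsub>V\<^esub> \<one>\<^bsub>V\<^esub> = v"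
    by (simp_all add: V.tensor_ob_assoc V.unit_ob_left V.unit_ob_right)
  have [simp]: "is_ar V (tensor_ar V (id_ar V v) ?e)" "is_ar V (tensor_ar V ?b (id_ar V v))"
    using V.tensor_arr_closed[of v v "?w \<otimes>\<^bsub>V\<^esub> v" "\<one>\<^bsub>V\<^esub>" "ident V v" "ev V v"]
      V.tensor_arr_closed[of "\<one>\<^bsub>V\<^esub>" "v \<otimes>\<^bsub>V\<^esub> ?w" v v "coev V v" "ident V v"] ev_V[OF assms]
    by (simp_all add: tensor_ar_def id_ar_def V.ident_closed)
  have 1: "\<I> (gob v) \<bowtie> inv_ar C geps = gmu v \<one>\<^bsub>V\<^esub>"
  proof (rule C.iso_ar_cancel_right)
    show "(?I \<bowtie> inv_ar C geps) \<diamondop> (?I \<bowtie> geps) = gmu v \<one>\<^bsub>V\<^esub> \<diamondop> (?I \<bowtie> geps)"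
      by (simp add: tensor_comp gmu_unit)
  qed simp_all
  have 2: "(?I \<bowtie> gmu ?w v) \<diamondop> (inv_ar C (gmu v ?w) \<bowtie> ?I) = inv_ar C (gmu v (?w \<otimes>\<^bsub>V\<^esub> v)) \<diamondop> gmu (v \<otimes>\<^bsub>V\<^esub> ?w) v"
  proof (rule C.iso_ar_cancel_left[of "gmu v (?w \<otimes>\<^bsub>V\<^esub> v)"])
    show "gmu v (?w \<otimes>\<^bsub>V\<^esub> v) \<diamondop> (?I \<bowtie> gmu ?w v) \<diamondop> (inv_ar C (gmu v ?w) \<bowtie> ?I)
        = gmu v (?w \<otimes>\<^bsub>V\<^esub> v) \<diamondop> inv_ar C (gmu v (?w \<otimes>\<^bsub>V\<^esub> v)) \<diamondop> gmu (v \<otimes>\<^bsub>V\<^esub> ?w) v"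
      using C.comp_ar_extend[OF gmu_assoc[of v ?w v, symmetric], of "inv_ar C (gmu v ?w) \<bowtie> ?I"]
      by (simp add: tensor_comp)
  qed simp_all
  have 3: "gmu (v \<otimes>\<^bsub>V\<^esub> ?w) v \<diamondop> (gar ?b \<bowtie> ?I) = gar (tensor_ar V ?b (id_ar V v)) \<diamondop> gmu \<one>\<^bsub>V\<^esub> v"
    using gmu_natural[OF ev_V(2)[OF assms], of "id_ar V v"] by simp
  have 4: "gmu v \<one>\<^bsub>V\<^esub> \<diamondop> (?I \<bowtie> gar ?e) = gar (tensor_ar V (id_ar V v) ?e) \<diamondop> gmu v (?w \<otimes>\<^bsub>V\<^esub> v)"
    using gmu_natural[OF _ ev_V(1)[OF assms], of "id_ar V v"] by simp
  have s: "?I \<bowtie> evG v = (?I \<bowtie> inv_ar C geps) \<diamondop> (?I \<bowtie> gar ?e) \<diamondop> (?I \<bowtie> gmu ?w v)"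
    "coevG v \<bowtie> ?I = (inv_ar C (gmu v ?w) \<bowtie> ?I) \<diamondop> (gar ?b \<bowtie> ?I) \<diamondop> (geps \<bowtie> ?I)"
    by (simp_all add: evG_def coevG_def tensor_comp)
  have "(?I \<bowtie> evG v) \<diamondop> (coevG v \<bowtie> ?I)
    = gmu v \<one>\<^bsub>V\<^esub> \<diamondop> (?I \<bowtie> gar ?e) \<diamondop> ((?I \<bowtie> gmu ?w v) \<diamondop> (inv_ar C (gmu v ?w) \<bowtie> ?I)) \<diamondop>
      (gar ?b \<bowtie> ?I) \<diamondop> (geps \<bowtie> ?I)"
    by (simp add: s 1)
  also have "\<dots> = (gmu v \<one>\<^bsub>V\<^esub> \<diamondop> (?I \<bowtie> gar ?e)) \<diamondop> inv_ar C (gmu v (?w \<otimes>\<^bsub>V\<^esub> v)) \<diamondop>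
      (gmu (v \<otimes>\<^bsub>V\<^esub> ?w) v \<diamondop> (gar ?b \<bowtie> ?I)) \<diamondop> (geps \<bowtie> ?I)"
    by (simp add: 2)
  also have "\<dots> = gar (tensor_ar V (id_ar V v) ?e) \<diamondop> gar (tensor_ar V ?b (id_ar V v)) \<diamondop>
      gmu \<one>\<^bsub>V\<^esub> v \<diamondop> (geps \<bowtie> ?I)"
    unfolding 3 4 by simp
  also have "\<dots> = gar (comp_ar V (tensor_ar V (id_ar V v) ?e) (tensor_ar V ?b (id_ar V v)))"
    by (simp add: gmu_unit gar_comp)
  also have "comp_ar V (tensor_ar V (id_ar V v) ?e) (tensor_ar V ?b (id_ar V v)) = id_ar V v"
    using V.left_dual[OF assms] by (simp add: is_left_dual_def comp_ar_def tensor_ar_def id_ar_def)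
  finally show ?thesis by simp
qed

end

section \<open>Composites of functors\<close>

lemma is_functor_map:
  "\<lbrakk>is_functor C D F; A \<in> Ob C\<rbrakk> \<Longrightarrow> fob F A \<in> Ob D"
  "\<lbrakk>is_functor C D F; is_ar C f\<rbrakk> \<Longrightarrow> is_ar D (map_ar F f)"
  "\<lbrakk>is_functor C D F; A \<in> Ob C\<rbrakk> \<Longrightarrow> map_ar F (id_ar C A) = id_ar D (fob F A)"
  unfolding is_functor_def is_ar_def by (simp_all add: map_ar_def id_ar_def)

lemma map_ar_comp:
  assumes "is_functor C D F" "is_ar C f" "is_ar C g" "tgt f = src g"
  shows "comp_ar D (map_ar F g) (map_ar F f) = map_ar F (comp_ar C g f)"
  using is_functor_comp[OF assms] by (simp add: comp_ar_def map_ar_def)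

lemma iso_map_ar:
  assumes "category C" "category D" "is_functor C D F" "iso_ar C f"
  shows "iso_ar D (map_ar F f)"
  using category.is_ar_inv[OF assms(1,4)] category.inv_ar_left[OF assms(1,4)]
    category.inv_ar_right[OF assms(1,4)] category.iso_ar_imp_is_ar[OF assms(1,4)]
  by (intro category.iso_arI(1)[OF assms(2), of _ "map_ar F (inv_ar C f)"])
    (simp_all add: map_ar_comp[OF assms(3)] is_functor_map[OF assms(3)])

definition comp_fun :: "('p, 'n, 'q, 'r) fctr \<Rightarrow> ('o, 'm, 'p, 'n) fctr \<Rightarrow> ('o, 'm, 'q, 'r) fctr" where
  "comp_fun F F' = \<lparr>fob = (\<lambda>m. fob F (fob F' m)), far = (\<lambda>f. far F (far F' f))\<rparr>"

lemma comp_fun_simps [simp]: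
  "fob (comp_fun F F') m = fob F (fob F' m)"
  "far (comp_fun F F') f = far F (far F' f)"
  "map_ar (comp_fun F F') g = map_ar F (map_ar F' g)"
  by (simp_all add: comp_fun_def map_ar_def)

lemma is_functor_comp_fun:
  assumes "is_functor D E F" "is_functor C D F'"
  shows "is_functor C E (comp_fun F F')"
  unfolding is_functor_def
proof (intro conjI ballI)
  fix A B H f g assume "A \<in> Ob C" "B \<in> Ob C" "H \<in> Ob C" "f \<in> Hom C A B" "g \<in> Hom C B H"
  then have "is_ar C (Ar A f B)" "is_ar C (Ar B g H)"
    by simp_all
  then have "far F' (g \<cdot>\<^bsub>C\<^esub> f) = far F' g \<cdot>\<^bsub>D\<^esub> far F' f"
    "far F (far F' g \<cdot>\<^bsub>D\<^esub> far F' f) = far F (far F' g) \<cdot>\<^bsub>E\<^esub> far F (far F' f)"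
    using is_functor_comp[OF assms(2), of "Ar A f B" "Ar B g H"]
      is_functor_comp[OF assms(1) is_functor_map(2)[OF assms(2)] is_functor_map(2)[OF assms(2)],
        of "Ar A f B" "Ar B g H"]
    by (simp_all del: is_ar_Ar) (simp add: map_ar_def)
  then show "far (comp_fun F F') (g \<cdot>\<^bsub>C\<^esub> f) = far (comp_fun F F') g \<cdot>\<^bsub>E\<^esub> far (comp_fun F F') f"
    by simp
qed (use assms in \<open>auto simp: is_functor_def\<close>)

lemma right_exact_comp_fun:
  assumes "right_exact D E F" "right_exact C D F'"
  shows "right_exact C E (comp_fun F F')"
proof -
  have l: "linear_functor D E F" "linear_functor C D F'"
    using assms by (simp_all add: right_exact_def)
  then have f: "is_functor D E F" "is_functor C D F'"
    by (simp_all add: linear_functor_def)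
  have ob: "fob F' A \<in> Ob D" if "A \<in> Ob C" for A
    using is_functor_map(1)[OF f(2) that] .
  have ar: "far F' g \<in> Hom D (fob F' A) (fob F' B)" if "A \<in> Ob C" "B \<in> Ob C" "g \<in> Hom C A B" for A B g
    using f(2) that by (simp add: is_functor_def)
  have "linear_functor C E (comp_fun F F')"
    unfolding linear_functor_def comp_fun_simps
  proof (intro conjI ballI allI)
    fix A B g h assume h: "A \<in> Ob C" "B \<in> Ob C" "g \<in> Hom C A B" "h \<in> Hom C A B"
    then have "far F' (g \<oplus>\<^bsub>C\<^esub> h) = far F' g \<oplus>\<^bsub>D\<^esub> far F' h"
      using l(2) unfolding linear_functor_def by blast
    moreover have "far F (far F' g \<oplus>\<^bsub>D\<^esub> far F' h) = far F (far F' g) \<oplus>\<^bsub>E\<^esub> far F (far F' h)"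
      using l(1) ob[OF h(1)] ob[OF h(2)] ar[OF h(1,2,3)] ar[OF h(1,2,4)]
      unfolding linear_functor_def by blast
    ultimately show "far F (far F' (g \<oplus>\<^bsub>C\<^esub> h)) = far F (far F' g) \<oplus>\<^bsub>E\<^esub> far F (far F' h)"
      by simp
  next
    fix A B g c assume h: "A \<in> Ob C" "B \<in> Ob C" "g \<in> Hom C A B"
    then have "far F' (c \<odot>\<^bsub>C\<^esub> g) = c \<odot>\<^bsub>D\<^esub> far F' g"
      using l(2) unfolding linear_functor_def by blast
    moreover have "far F (c \<odot>\<^bsub>D\<^esub> far F' g) = c \<odot>\<^bsub>E\<^esub> far F (far F' g)"
      using l(1) ob[OF h(1)] ob[OF h(2)] ar[OF h] unfolding linear_functor_def by blast
    ultimately show "far F (far F' (c \<odot>\<^bsub>C\<^esub> g)) = c \<odot>\<^bsub>E\<^esub> far F (far F' g)"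
      by simp
  qed (rule is_functor_comp_fun[OF f])
  then show ?thesis
    using assms ob unfolding right_exact_def comp_fun_simps by blast
qed

section \<open>V-module endofunctors and their composites\<close>

context central_setting
begin

abbreviation V_act where "V_act \<equiv> V_action V C G M a"
abbreviation EndV where "EndV \<equiv> End_V V C G M a"
abbreviation rhoV where "rhoV \<equiv> rho C G M a"
abbreviation lact where "lact \<equiv> left_act C G M a"
abbreviation ract where "ract \<equiv> right_act C G M a"

definition vass where
  "vass v w m = ass (gob v) (gob w) m \<bullet> (inv_ar C (gmu v w) \<star> \<J> m)"

definition vuni where
  "vuni m = uni m \<bullet> (inv_ar C geps \<star> \<J> m)"

lemma src_tgt_vass [simp]:
  "src (vass v w m) = gob (v \<otimes>\<^bsub>V\<^esub> w) \<diamond> m" "tgt (vass v w m) = gob v \<diamond> gob w \<diamond> m"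
  "src (vuni m) = gob \<one>\<^bsub>V\<^esub> \<diamond> m" "tgt (vuni m) = m"
  by (simp_all add: vass_def vuni_def)

lemma is_ar_vass [simp]:
  "\<lbrakk>v \<in> Ob V; w \<in> Ob V; m \<in> Ob M\<rbrakk> \<Longrightarrow> is_ar M (vass v w m)"
  "m \<in> Ob M \<Longrightarrow> is_ar M (vuni m)"
  by (simp_all add: vass_def vuni_def)

lemma V_act_simps [simp]:
  "v \<rhd>\<^bsub>V_act\<^esub> m = gob v \<diamond> m" "g \<rhd>\<^sub>a\<^bsub>V_act\<^esub> f = far G g \<rhd>\<^sub>a\<^bsub>a\<^esub> f"
  "massoc V_act v w m = arr (vass v w m)" "munit V_act m = arr (vuni m)"
  by (simp_all add: V_action_def vass_def vuni_def comp_ar_def ass_def act_ar_def uni_def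
      gmu_def geps_def inv_ar_def id_ar_def)

definition str where
  "str A v m = Ar (fob (fst A) (gob v \<diamond> m)) (snd A v m) (gob v \<diamond> fob (fst A) m)"

lemma src_tgt_str [simp]:
  "src (str A v m) = fob (fst A) (gob v \<diamond> m)" "tgt (str A v m) = gob v \<diamond> fob (fst A) m"
  by (simp_all add: str_def)

lemma EndV_ob_iff: "A \<in> Ob EndV \<longleftrightarrow> module_functor V M V_act (fst A) (snd A)"
  by (cases A) (simp add: End_V_def)

lemma EndV_right_exact: "A \<in> Ob EndV \<Longrightarrow> right_exact M M (fst A)"
  by (simp add: EndV_ob_iff module_functor_def)

lemma EndV_functor [simp]: "A \<in> Ob EndV \<Longrightarrow> is_functor M M (fst A)"
  using EndV_right_exact[of A] by (simp add: right_exact_def linear_functor_def)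

lemma map_M [simp]:
  "\<lbrakk>is_functor M M F; m \<in> Ob M\<rbrakk> \<Longrightarrow> fob F m \<in> Ob M"
  "\<lbrakk>is_functor M M F; is_ar M f\<rbrakk> \<Longrightarrow> is_ar M (map_ar F f)"
  "\<lbrakk>is_functor M M F; m \<in> Ob M\<rbrakk> \<Longrightarrow> map_ar F (\<J> m) = \<J> (fob F m)"
  by (rule is_functor_map; assumption)+

lemma map_comp:
  "\<lbrakk>is_functor M M F; is_ar M f; is_ar M g; tgt f = src g\<rbrakk>
    \<Longrightarrow> map_ar F g \<bullet> map_ar F f = map_ar F (g \<bullet> f)"
  by (rule map_ar_comp)

lemma iso_map [simp]: "\<lbrakk>is_functor M M F; iso_ar M f\<rbrakk> \<Longrightarrow> iso_ar M (map_ar F f)"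
  by (rule iso_map_ar[OF M.category_axioms M.category_axioms])

lemma iso_str [simp]:
  assumes "A \<in> Ob EndV" "v \<in> Ob V" "m \<in> Ob M"
  shows "iso_ar M (str A v m)"
  using assms EndV_functor[OF assms(1)] unfolding iso_ar_def EndV_ob_iff module_functor_def
  by (simp add: str_def)

lemma str_natural:
  assumes "A \<in> Ob EndV" "is_ar V g" "is_ar M f"
  shows "str A (tgt g) (tgt f) \<bullet> map_ar (fst A) (gar g \<star> f)
    = (gar g \<star> map_ar (fst A) f) \<bullet> str A (src g) (src f)"
  using assms unfolding EndV_ob_iff module_functor_def is_ar_def
  by (simp add: str_def comp_ar_def map_ar_def act_ar_def gar_def)

lemma str_assoc:
  assumes "A \<in> Ob EndV" "v \<in> Ob V" "w \<in> Ob V" "m \<in> Ob M"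
  shows "vass v w (fob (fst A) m) \<bullet> str A (v \<otimes>\<^bsub>V\<^esub> w) m
    = (\<I> (gob v) \<star> str A w m) \<bullet> str A v (gob w \<diamond> m) \<bullet> map_ar (fst A) (vass v w m)"
proof -
  \<comment> \<open>\<open>module_functor\<close> brackets the three factors to the left, so the
    equation is read off in that form and reassociated afterwards.\<close>
  have "vass v w (fob (fst A) m) \<bullet> str A (v \<otimes>\<^bsub>V\<^esub> w) m
    = ((\<I> (gob v) \<star> str A w m) \<bullet> str A v (gob w \<diamond> m)) \<bullet> map_ar (fst A) (vass v w m)"
    using assms G unfolding EndV_ob_iff module_functor_def monoidal_functor_def is_functor_def
    by (simp add: str_def comp_ar_def map_ar_def act_ar_def id_ar_def)
  then show ?thesis using assms by simp
qed

lemma str_unit: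
  assumes "A \<in> Ob EndV" "m \<in> Ob M"
  shows "vuni (fob (fst A) m) \<bullet> str A \<one>\<^bsub>V\<^esub> m = map_ar (fst A) (vuni m)"
  using assms unfolding EndV_ob_iff module_functor_def
  by (simp add: str_def comp_ar_def map_ar_def)

lemma EndV_obI:
  assumes "right_exact M M (fst A)"
    and iso: "\<And>v m. \<lbrakk>v \<in> Ob V; m \<in> Ob M\<rbrakk> \<Longrightarrow> iso_ar M (str A v m)"
    and nat: "\<And>g f. \<lbrakk>is_ar V g; is_ar M f\<rbrakk> \<Longrightarrow>
      str A (tgt g) (tgt f) \<bullet> map_ar (fst A) (gar g \<star> f)
        = (gar g \<star> map_ar (fst A) f) \<bullet> str A (src g) (src f)"
    and assoc: "\<And>v w m. \<lbrakk>v \<in> Ob V; w \<in> Ob V; m \<in> Ob M\<rbrakk> \<Longrightarrow>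
      vass v w (fob (fst A) m) \<bullet> str A (v \<otimes>\<^bsub>V\<^esub> w) m
        = (\<I> (gob v) \<star> str A w m) \<bullet> str A v (gob w \<diamond> m) \<bullet> map_ar (fst A) (vass v w m)"
    and unit: "\<And>m. m \<in> Ob M \<Longrightarrow> vuni (fob (fst A) m) \<bullet> str A \<one>\<^bsub>V\<^esub> m = map_ar (fst A) (vuni m)"
  shows "A \<in> Ob EndV"
  unfolding EndV_ob_iff module_functor_def
proof (intro conjI ballI, unfold V_act_simps)
  fix v m assume "v \<in> Ob V" "m \<in> Ob M"
  then show "is_iso M (fob (fst A) (gob v \<diamond> m)) (gob v \<diamond> fob (fst A) m) (snd A v m)"
    using iso[of v m] by (simp add: iso_ar_def str_def)
next
  fix v w m n g f assume "v \<in> Ob V" "w \<in> Ob V" "m \<in> Ob M" "n \<in> Ob M" "g \<in> Hom V v w" "f \<in> Hom M m n"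
  then show "snd A w n \<cdot>\<^bsub>M\<^esub> far (fst A) (far G g \<rhd>\<^sub>a\<^bsub>a\<^esub> f)
      = (far G g \<rhd>\<^sub>a\<^bsub>a\<^esub> far (fst A) f) \<cdot>\<^bsub>M\<^esub> snd A v m"
    using nat[of "Ar v g w" "Ar m f n"]
    by (simp add: str_def comp_ar_def map_ar_def act_ar_def gar_def)
next
  fix v w m assume vwm: "v \<in> Ob V" "w \<in> Ob V" "m \<in> Ob M"
  have "is_functor M M (fst A)"
    using assms(1) by (simp add: right_exact_def linear_functor_def)
  moreover have "is_ar M (str A w m)" "is_ar M (str A v (gob w \<diamond> m))"
    using iso vwm by simp_all
  ultimately have "vass v w (fob (fst A) m) \<bullet> str A (v \<otimes>\<^bsub>V\<^esub> w) m
    = ((\<I> (gob v) \<star> str A w m) \<bullet> str A v (gob w \<diamond> m)) \<bullet> map_ar (fst A) (vass v w m)"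
    using assoc[OF vwm] vwm by simp
  moreover have "far G (ident V v) = ident C (gob v)"
    using gar_id[OF vwm(1)] by (simp add: gar_def id_ar_def)
  ultimately show "arr (vass v w (fob (fst A) m)) \<cdot>\<^bsub>M\<^esub> snd A (v \<otimes>\<^bsub>V\<^esub> w) m =
      (far G (ident V v) \<rhd>\<^sub>a\<^bsub>a\<^esub> snd A w m) \<cdot>\<^bsub>M\<^esub> snd A v (gob w \<diamond> m) \<cdot>\<^bsub>M\<^esub> far (fst A) (arr (vass v w m))"
    by (simp add: str_def comp_ar_def map_ar_def act_ar_def id_ar_def)
next
  fix m assume "m \<in> Ob M"
  then show "arr (vuni (fob (fst A) m)) \<cdot>\<^bsub>M\<^esub> snd A \<one>\<^bsub>V\<^esub> m = far (fst A) (arr (vuni m))"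
    using unit[of m] by (simp add: str_def comp_ar_def map_ar_def)
qed (rule assms(1))

text \<open>Composition of V-module functors. Both sides of the bimodule structure are instances in
  which one factor is \<open>rho X\<close>, so that one closure proof covers them.\<close>

definition vcomp where
  "vcomp A B = (comp_fun (fst A) (fst B),
     \<lambda>v m. snd A v (fob (fst B) m) \<cdot>\<^bsub>M\<^esub> far (fst A) (snd B v m))"

lemma fst_vcomp [simp]: "fst (vcomp A B) = comp_fun (fst A) (fst B)"
  by (simp add: vcomp_def)

lemma str_vcomp: "str (vcomp A B) v m = str A v (fob (fst B) m) \<bullet> map_ar (fst A) (str B v m)"
  by (simp add: vcomp_def str_def map_ar_def comp_ar_def)

lemma vcomp_ob:
  assumes "A \<in> Ob EndV" "B \<in> Ob EndV"
  shows "vcomp A B \<in> Ob EndV"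
proof (rule EndV_obI)
  note [simp] = assms
  note f = EndV_functor[OF assms(1)] EndV_functor[OF assms(2)]
  show "right_exact M M (fst (vcomp A B))"
    using right_exact_comp_fun[OF EndV_right_exact[OF assms(1)] EndV_right_exact[OF assms(2)]] by simp
  fix v m assume [simp]: "v \<in> Ob V" "m \<in> Ob M"
  show "iso_ar M (str (vcomp A B) v m)"
    using f by (simp add: str_vcomp)
next
  note [simp] = assms
  note f [simp] = EndV_functor[OF assms(1)] EndV_functor[OF assms(2)]
  fix g f assume [simp]: "is_ar V g" "is_ar M f"
  have "str (vcomp A B) (tgt g) (tgt f) \<bullet> map_ar (fst (vcomp A B)) (gar g \<star> f)
     = str A (tgt g) (fob (fst B) (tgt f)) \<bullet>
       map_ar (fst A) (str B (tgt g) (tgt f) \<bullet> map_ar (fst B) (gar g \<star> f))"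
    by (simp add: str_vcomp map_comp)
  also have "\<dots> = str A (tgt g) (fob (fst B) (tgt f)) \<bullet> map_ar (fst A) (gar g \<star> map_ar (fst B) f) \<bullet>
       map_ar (fst A) (str B (src g) (src f))"
    by (simp add: str_natural map_comp)
  also have "\<dots> = (gar g \<star> map_ar (fst (vcomp A B)) f) \<bullet> str (vcomp A B) (src g) (src f)"
    using M.comp_ar_extend[OF str_natural[of A g "map_ar (fst B) f"], of "map_ar (fst A) (str B (src g) (src f))"]
    by (simp add: str_vcomp)
  finally show "str (vcomp A B) (tgt g) (tgt f) \<bullet> map_ar (fst (vcomp A B)) (gar g \<star> f) = \<dots>" .
next
  note [simp] = assms
  note f [simp] = EndV_functor[OF assms(1)] EndV_functor[OF assms(2)]
  fix v w m assume [simp]: "v \<in> Ob V" "w \<in> Ob V" "m \<in> Ob M"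
  let ?F = "fst A" and ?F' = "fst B" and ?n = "fob (fst B) m"
  \<comment> \<open>Naturality of the structure of the outer functor along a structure arrow of the
    inner one; this interleaves the two associativity axioms.\<close>
  have n: "str A v (gob w \<diamond> ?n) \<bullet> map_ar ?F (\<I> (gob v) \<star> str B w m)
     = (\<I> (gob v) \<star> map_ar ?F (str B w m)) \<bullet> str A v (fob ?F' (gob w \<diamond> m))"
    using str_natural[of A "id_ar V v" "str B w m"] by simp
  have "vass v w (fob (fst (vcomp A B)) m) \<bullet> str (vcomp A B) (v \<otimes>\<^bsub>V\<^esub> w) m
    = (\<I> (gob v) \<star> str A w ?n) \<bullet> str A v (gob w \<diamond> ?n) \<bullet>
      map_ar ?F (vass v w ?n \<bullet> str B (v \<otimes>\<^bsub>V\<^esub> w) m)"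
    using M.comp_ar_extend[OF str_assoc[of A v w ?n], of "map_ar ?F (str B (v \<otimes>\<^bsub>V\<^esub> w) m)"]
    by (simp add: str_vcomp map_comp)
  also have "\<dots> = (\<I> (gob v) \<star> str A w ?n) \<bullet> str A v (gob w \<diamond> ?n) \<bullet>
      map_ar ?F (\<I> (gob v) \<star> str B w m) \<bullet>
      map_ar ?F (str B v (gob w \<diamond> m)) \<bullet> map_ar ?F (map_ar ?F' (vass v w m))"
    by (simp add: str_assoc map_comp)
  also have "\<dots> = (\<I> (gob v) \<star> str A w ?n) \<bullet> (\<I> (gob v) \<star> map_ar ?F (str B w m)) \<bullet>
      str A v (fob ?F' (gob w \<diamond> m)) \<bullet>
      map_ar ?F (str B v (gob w \<diamond> m)) \<bullet> map_ar ?F (map_ar ?F' (vass v w m))"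
    using M.comp_ar_extend[OF n, of "map_ar ?F (str B v (gob w \<diamond> m)) \<bullet> map_ar ?F (map_ar ?F' (vass v w m))"]
    by simp
  also have "\<dots> = (\<I> (gob v) \<star> str (vcomp A B) w m) \<bullet> str (vcomp A B) v (gob w \<diamond> m) \<bullet>
      map_ar (fst (vcomp A B)) (vass v w m)"
    by (simp add: str_vcomp act_comp_extend)
  finally show "vass v w (fob (fst (vcomp A B)) m) \<bullet> str (vcomp A B) (v \<otimes>\<^bsub>V\<^esub> w) m = \<dots>" .
next
  note [simp] = assms
  note f [simp] = EndV_functor[OF assms(1)] EndV_functor[OF assms(2)]
  fix m assume [simp]: "m \<in> Ob M"
  show "vuni (fob (fst (vcomp A B)) m) \<bullet> str (vcomp A B) \<one>\<^bsub>V\<^esub> m = map_ar (fst (vcomp A B)) (vuni m)"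
    using M.comp_ar_extend[OF str_unit[of A "fob (fst B) m"], of "map_ar (fst A) (str B \<one>\<^bsub>V\<^esub> m)"]
    by (simp add: str_vcomp map_comp str_unit)
qed

lemma fst_rho [simp]: "fob (fst (rhoV X)) m = X \<diamond> m" "map_ar (fst (rhoV X)) f = \<I> X \<star> f"
  by (simp_all add: rho_def act_by_def map_ar_def act_ar_def id_ar_def)

lemma str_rho [simp]:
  assumes "v \<in> Ob V" "X \<in> Ob C" "m \<in> Ob M"
  shows "str (rhoV X) v m = sw (fob G v) X m"
proof -
  have "str (rhoV X) v m
    = (ass (gob v) X m \<bullet> (hb_inv (fob G v) X \<star> \<J> m)) \<bullet> inv_ar M (ass X (gob v) m)"
    by (simp add: rho_def act_by_def str_def swap_def hb_def inv_ar_def comp_ar_def act_ar_def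
        id_ar_def ass_def)
  then show ?thesis using assms by (simp add: sw_def)
qed

end

context action_setting
begin

text \<open>Transposition along a duality of \<open>D\<close> and \<open>X\<close> is injective: by
  the snake identity an arrow is recovered from its transpose by acting with \<open>X\<close> and
  precomposing with the coevaluation.\<close>

lemma evact_inject:
  assumes "evact D X e n \<bullet> (\<I> D \<star> k) = evact D X e n \<bullet> (\<I> D \<star> l)"
    "D \<in> Ob C" "X \<in> Ob C" "n \<in> Ob M" "is_ar C e" "src e = D \<otimes>\<^sub>o X" "tgt e = \<one>\<^sub>o"
    "is_ar C b" "tgt b = X \<otimes>\<^sub>o D" "src b = \<one>\<^sub>o"
    "(\<I> X \<bowtie> e) \<diamondop> (b \<bowtie> \<I> X) = \<I> X"
    "is_ar M k" "is_ar M l" "src k = src l" "tgt k = X \<diamond> n" "tgt l = X \<diamond> n"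
  shows "k = l"
proof -
  note [simp] = assms(2-)
  have "f = (\<I> X \<star> (evact D X e n \<bullet> (\<I> D \<star> f))) \<bullet> coevact X D b (src f)"
    if [simp]: "is_ar M f" "tgt f = X \<diamond> n" for f
  proof -
    have "f = ((\<I> X \<star> evact D X e n) \<bullet> coevact X D b (X \<diamond> n)) \<bullet> f"
      using snake_act[OF assms(2,3,4,5,6,7,8,9,10,11)] by simp
    also have "\<dots> = (\<I> X \<star> evact D X e n) \<bullet> (\<I> X \<star> \<I> D \<star> f) \<bullet> coevact X D b (src f)"
      using coevact_natural[of f D X b] by simp
    finally show ?thesis
      by (simp add: act_comp_extend)
  qed
  from this[of k] this[of l] show ?thesis
    using assms(1) by simp
qed

end

section \<open>\<open>rho\<close> and the bimodule structure on V-module endofunctors\<close>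

context central_setting
begin

text \<open>The axioms of a V-module functor are the rules for \<open>sw\<close> in its central
  argument: naturality, tensor products and unit. The inverses of \<open>mu\<close> and
  \<open>eps\<close> are absorbed because they are arrows of the center, along which
  \<open>sw\<close> is natural.\<close>

lemma rho_ob [simp]:
  assumes "X \<in> Ob C"
  shows "rhoV X \<in> Ob EndV"
proof (rule EndV_obI)
  note [simp] = assms
  show "right_exact M M (fst (rhoV X))"
    using M.act_by_exact[OF assms] by (simp add: rho_def exact_def)
next
  note [simp] = assms
  fix v m assume [simp]: "v \<in> Ob V" "m \<in> Ob M"
  show "iso_ar M (str (rhoV X) v m)"
    by simp
next
  note [simp] = assms
  fix g f assume [simp]: "is_ar V g" "is_ar M f"
  show "str (rhoV X) (tgt g) (tgt f) \<bullet> map_ar (fst (rhoV X)) (gar g \<star> f)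
      = (gar g \<star> map_ar (fst (rhoV X)) f) \<bullet> str (rhoV X) (src g) (src f)"
    using sw_natural[OF gar_central[of g], of "\<I> X" f] by simp
next
  note [simp] = assms
  fix v w m assume [simp]: "v \<in> Ob V" "w \<in> Ob V" "m \<in> Ob M"
  let ?vw = "fob G v \<otimes>\<^bsub>center C\<^esub> fob G w"
  have "central (fob G (v \<otimes>\<^bsub>V\<^esub> w)) ?vw (inv_ar C (gmu v w))"
    by (intro central_inv gmu_central) simp_all
  from sw_natural[OF this, of "\<I> X" "\<J> m"]
  have n: "(inv_ar C (gmu v w) \<star> \<J> (X \<diamond> m)) \<bullet> sw (fob G (v \<otimes>\<^bsub>V\<^esub> w)) X m
      = sw ?vw X m \<bullet> (\<I> X \<star> inv_ar C (gmu v w) \<star> \<J> m)"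
    by simp
  have "vass v w (X \<diamond> m) \<bullet> sw (fob G (v \<otimes>\<^bsub>V\<^esub> w)) X m
    = ass (gob v) (gob w) (X \<diamond> m) \<bullet> sw ?vw X m \<bullet> (\<I> X \<star> inv_ar C (gmu v w) \<star> \<J> m)"
    by (simp add: vass_def n)
  also have "\<dots> = (\<I> (gob v) \<star> sw (fob G w) X m) \<bullet> sw (fob G v) X (gob w \<diamond> m) \<bullet>
      (\<I> X \<star> vass v w m)"
    using M.comp_ar_extend[OF sw_center_tensor[of "fob G v" "fob G w" X m],
        of "\<I> X \<star> inv_ar C (gmu v w) \<star> \<J> m"]
    by (simp add: act_comp vass_def)
  finally show "vass v w (fob (fst (rhoV X)) m) \<bullet> str (rhoV X) (v \<otimes>\<^bsub>V\<^esub> w) m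
      = (\<I> (gob v) \<star> str (rhoV X) w m) \<bullet> str (rhoV X) v (gob w \<diamond> m) \<bullet>
        map_ar (fst (rhoV X)) (vass v w m)"
    by simp
next
  note [simp] = assms
  fix m assume [simp]: "m \<in> Ob M"
  from sw_natural[OF central_inv[OF geps_central geps_iso], of "\<I> X" "\<J> m"]
  have n: "(inv_ar C geps \<star> \<J> (X \<diamond> m)) \<bullet> sw (fob G \<one>\<^bsub>V\<^esub>) X m
      = sw \<one>\<^bsub>center C\<^esub> X m \<bullet> (\<I> X \<star> inv_ar C geps \<star> \<J> m)"
    by simp
  show "vuni (fob (fst (rhoV X)) m) \<bullet> str (rhoV X) \<one>\<^bsub>V\<^esub> m = map_ar (fst (rhoV X)) (vuni m)"
    using M.comp_ar_extend[OF sw_center_unit[of X m], of "\<I> X \<star> inv_ar C geps \<star> \<J> m"]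
    by (simp add: vuni_def n act_comp)
qed

lemma lact_eq: "lact X A = vcomp (rhoV X) A"
  by (simp add: left_act_def vcomp_def rho_def act_by_def comp_fun_def split_beta)

lemma ract_eq: "ract A X = vcomp A (rhoV X)"
  by (simp add: right_act_def vcomp_def rho_def act_by_def comp_fun_def split_beta)

lemma act_EndV_ob [simp]:
  "\<lbrakk>A \<in> Ob EndV; X \<in> Ob C\<rbrakk> \<Longrightarrow> lact X A \<in> Ob EndV"
  "\<lbrakk>A \<in> Ob EndV; X \<in> Ob C\<rbrakk> \<Longrightarrow> ract A X \<in> Ob EndV"
  by (simp_all add: lact_eq ract_eq vcomp_ob)

lemma act_EndV_simps [simp]:
  "fob (fst (lact X A)) m = X \<diamond> fob (fst A) m" "fob (fst (ract A X)) m = fob (fst A) (X \<diamond> m)"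
  "map_ar (fst (lact X A)) f = \<I> X \<star> map_ar (fst A) f"
  "map_ar (fst (ract A X)) f = map_ar (fst A) (\<I> X \<star> f)"
  by (simp_all add: lact_eq ract_eq)

lemma str_lact [simp]:
  "\<lbrakk>A \<in> Ob EndV; v \<in> Ob V; X \<in> Ob C; m \<in> Ob M\<rbrakk>
    \<Longrightarrow> str (lact X A) v m = sw (fob G v) X (fob (fst A) m) \<bullet> (\<I> X \<star> str A v m)"
  by (simp add: lact_eq str_vcomp)

lemma str_ract [simp]:
  "\<lbrakk>A \<in> Ob EndV; v \<in> Ob V; X \<in> Ob C; m \<in> Ob M\<rbrakk>
    \<Longrightarrow> str (ract A X) v m = str A v (X \<diamond> m) \<bullet> map_ar (fst A) (sw (fob G v) X m)"
  by (simp add: ract_eq str_vcomp)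

section \<open>Transformations of V-module functors\<close>

definition vtrans ::
  "('vo, 'mo, 'mm) vfun \<Rightarrow> ('vo, 'mo, 'mm) vfun \<Rightarrow> ('mo \<Rightarrow> ('mo, 'mm) ar) \<Rightarrow> bool" where
  "vtrans A B t \<longleftrightarrow>
     (\<forall>m \<in> Ob M. is_ar M (t m) \<and> src (t m) = fob (fst A) m \<and> tgt (t m) = fob (fst B) m) \<and>
     (\<forall>f. is_ar M f \<longrightarrow> t (tgt f) \<bullet> map_ar (fst A) f = map_ar (fst B) f \<bullet> t (src f)) \<and>
     (\<forall>v \<in> Ob V. \<forall>m \<in> Ob M.
        str B v m \<bullet> t (gob v \<diamond> m) = (\<I> (gob v) \<star> t m) \<bullet> str A v m)"

lemma vtransD:
  assumes "vtrans A B t"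
  shows "m \<in> Ob M \<Longrightarrow> is_ar M (t m)" "m \<in> Ob M \<Longrightarrow> src (t m) = fob (fst A) m"
    "m \<in> Ob M \<Longrightarrow> tgt (t m) = fob (fst B) m"
    "is_ar M f \<Longrightarrow> t (tgt f) \<bullet> map_ar (fst A) f = map_ar (fst B) f \<bullet> t (src f)"
    "\<lbrakk>v \<in> Ob V; m \<in> Ob M\<rbrakk> \<Longrightarrow> str B v m \<bullet> t (gob v \<diamond> m) = (\<I> (gob v) \<star> t m) \<bullet> str A v m"
  using assms by (simp_all add: vtrans_def)

text \<open>Arrows of \<open>End_V\<close> are extensional, families in \<open>vtrans\<close> are
  not: they can be written as plain functions, and their values outside \<open>Ob M\<close> do not
  matter.\<close>

lemma vtrans_cong:
  assumes "\<And>m. m \<in> Ob M \<Longrightarrow> t m = t' m"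
  shows "vtrans A B t \<longleftrightarrow> vtrans A B t'"
  using assms by (simp add: vtrans_def)

lemma vtrans_comp:
  assumes "vtrans A B t" "vtrans B D s" "A \<in> Ob EndV" "B \<in> Ob EndV" "D \<in> Ob EndV"
  shows "vtrans A D (\<lambda>m. s m \<bullet> t m)"
  unfolding vtrans_def
proof (intro conjI ballI allI impI)
  note [simp] = vtransD(1-3)[OF assms(1)] vtransD(1-3)[OF assms(2)] assms(3-5)
  fix f assume [simp]: "is_ar M f"
  have "(s (tgt f) \<bullet> t (tgt f)) \<bullet> map_ar (fst A) f = s (tgt f) \<bullet> map_ar (fst B) f \<bullet> t (src f)"
    by (simp add: vtransD(4)[OF assms(1)])
  also have "\<dots> = map_ar (fst D) f \<bullet> s (src f) \<bullet> t (src f)"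
    using M.comp_ar_extend[OF vtransD(4)[OF assms(2)], of f "t (src f)"] by simp
  finally show "(s (tgt f) \<bullet> t (tgt f)) \<bullet> map_ar (fst A) f = \<dots>" .
next
  note [simp] = vtransD(1-3)[OF assms(1)] vtransD(1-3)[OF assms(2)] assms(3-5)
  fix v m assume [simp]: "v \<in> Ob V" "m \<in> Ob M"
  have "str D v m \<bullet> s (gob v \<diamond> m) \<bullet> t (gob v \<diamond> m)
      = (\<I> (gob v) \<star> s m) \<bullet> str B v m \<bullet> t (gob v \<diamond> m)"
    using M.comp_ar_extend[OF vtransD(5)[OF assms(2)], of v m "t (gob v \<diamond> m)"] by simp
  also have "\<dots> = (\<I> (gob v) \<star> (s m \<bullet> t m)) \<bullet> str A v m"
    by (simp add: vtransD(5)[OF assms(1)] act_comp_extend)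
  finally show "str D v m \<bullet> s (gob v \<diamond> m) \<bullet> t (gob v \<diamond> m)
      = (\<I> (gob v) \<star> (s m \<bullet> t m)) \<bullet> str A v m"
    by (simp add: act_comp_extend)
qed (use vtransD(1-3)[OF assms(1)] vtransD(1-3)[OF assms(2)] in simp_all)

definition fam where
  "fam A \<alpha> B m = Ar (fob (fst A) m) (\<alpha> m) (fob (fst B) m)"

lemma src_tgt_fam [simp]:
  "src (fam A \<alpha> B m) = fob (fst A) m" "tgt (fam A \<alpha> B m) = fob (fst B) m"
  by (simp_all add: fam_def)

lemma EndV_hom_iff:
  assumes "A \<in> Ob EndV" "B \<in> Ob EndV"
  shows "(A, \<alpha>, B) \<in> Hom EndV A B \<longleftrightarrow> \<alpha> \<in> extensional (Ob M) \<and> vtrans A B (fam A \<alpha> B)"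
proof -
  have ob: "fob (fst A) m \<in> Ob M" "fob (fst B) m \<in> Ob M" if "m \<in> Ob M" for m
    using assms that by simp_all
  have all: "(\<forall>f. is_ar M f \<longrightarrow> P (src f) (tgt f) (arr f))
      \<longleftrightarrow> (\<forall>m \<in> Ob M. \<forall>n \<in> Ob M. \<forall>f \<in> Hom M m n. P m n f)" for P
    unfolding is_ar_def by (metis ar.sel)
  note all = all[of "\<lambda>m n f. \<alpha> n \<cdot>\<^bsub>M\<^esub> far (fst A) f = far (fst B) f \<cdot>\<^bsub>M\<^esub> \<alpha> m"]
  show ?thesis
    unfolding vtrans_def End_V_def cat.simps
    by (simp add: all fam_def comp_ar_def map_ar_def str_def act_ar_def id_ar_def ob)
qed

text \<open>A wedge of the relative end encodes the compatibility with the \<open>V\<close>-action through the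
  evaluations; the snake identity translates it into that of a transformation.\<close>

lemma wedge_condition_iff:
  assumes A: "A \<in> Ob EndV" and E: "E \<in> Ob C" and v: "v \<in> Ob V" and m: "m \<in> Ob M"
    and t: "is_ar M t" "src t = E \<diamond> m" "tgt t = fob (fst A) m"
    and s: "is_ar M s" "src s = E \<diamond> gob v \<diamond> m" "tgt s = fob (fst A) (gob v \<diamond> m)"
  shows "t \<bullet> (\<I> E \<star> evact (gob (dual V v)) (gob v) (evG v) m)
      = evact (gob (dual V v)) (gob v) (evG v) (fob (fst A) m) \<bullet>
        (\<I> (gob (dual V v)) \<star> (str A v m \<bullet> s)) \<bullet> sw (fob G (dual V v)) E (gob v \<diamond> m)
    \<longleftrightarrow> str A v m \<bullet> s = (\<I> (gob v) \<star> t) \<bullet> sw (fob G v) E m"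
proof -
  note [simp] = A E v m t s
  let ?D = "gob (dual V v)" and ?X = "gob v" and ?z = "fob G (dual V v)" and ?n = "fob (fst A) m"
  let ?ev = "evact ?D ?X (evG v)" and ?l = "(\<I> ?X \<star> t) \<bullet> sw (fob G v) E m" and ?k = "str A v m \<bullet> s"
  \<comment> \<open>The transpose of the desired value \<open>?l\<close> is computed without
    reference to \<open>s\<close>: evaluation is natural along \<open>t\<close>, and
    \<open>evact_central\<close> absorbs both exchanges. Hence the wedge condition says that
    \<open>?k\<close> and \<open>?l\<close> have the same transpose.\<close>
  have "?ev ?n \<bullet> (\<I> ?D \<star> ?l) \<bullet> sw ?z E (?X \<diamond> m)
    = (?ev ?n \<bullet> (\<I> ?D \<star> \<I> ?X \<star> t)) \<bullet> (\<I> ?D \<star> sw (fob G v) E m) \<bullet> sw ?z E (?X \<diamond> m)"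
    by (simp add: act_comp_extend)
  also have "?ev ?n \<bullet> (\<I> ?D \<star> \<I> ?X \<star> t) = t \<bullet> ?ev (E \<diamond> m)"
    using evact_natural[of t ?D ?X "evG v"] by simp
  also have "(t \<bullet> ?ev (E \<diamond> m)) \<bullet> (\<I> ?D \<star> sw (fob G v) E m) \<bullet> sw ?z E (?X \<diamond> m)
    = t \<bullet> (\<I> E \<star> ?ev m)"
    using evact_central[OF evG_central[OF v], of E m] by simp
  finally have l: "t \<bullet> (\<I> E \<star> ?ev m) = ?ev ?n \<bullet> (\<I> ?D \<star> ?l) \<bullet> sw ?z E (?X \<diamond> m)" ..
  show ?thesis
  proof
    assume "t \<bullet> (\<I> E \<star> ?ev m) = ?ev ?n \<bullet> (\<I> ?D \<star> ?k) \<bullet> sw ?z E (?X \<diamond> m)"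
    with l have "(?ev ?n \<bullet> (\<I> ?D \<star> ?k)) \<bullet> sw ?z E (?X \<diamond> m)
        = (?ev ?n \<bullet> (\<I> ?D \<star> ?l)) \<bullet> sw ?z E (?X \<diamond> m)"
      by simp
    then have "?ev ?n \<bullet> (\<I> ?D \<star> ?k) = ?ev ?n \<bullet> (\<I> ?D \<star> ?l)"
      by (rule M.iso_ar_cancel_right) simp_all
    then show "?k = ?l"
      by (rule evact_inject[of _ _ _ _ _ _ "coevG v"]) (simp_all add: snake_G)
  next
    assume "?k = ?l"
    then show "t \<bullet> (\<I> E \<star> ?ev m) = ?ev ?n \<bullet> (\<I> ?D \<star> ?k) \<bullet> sw ?z E (?X \<diamond> m)"
      using l by (simp only:)
  qed
qed

end

section \<open>Relative ends and the counit\<close>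

context central_setting
begin

lemma swap_eq:
  "\<lbrakk>v \<in> Ob V; X \<in> Ob C; m \<in> Ob M\<rbrakk> \<Longrightarrow> swap C G M a v X m = arr (sw (fob G v) X m)"
  by (simp add: str_def rho_def flip: str_rho)

abbreviation evV where "evV v \<equiv> evact (gob (dual V v)) (gob v) (evG v)"

lemma ev_act_eq:
  assumes "v \<in> Ob V" "m \<in> Ob M"
  shows "ev_act V C G M a v m = arr (evV v m)"
proof -
  note [simp] = assms ev_V[OF assms(1)] ev_V[OF assms(1), unfolded is_ar_Ar]
  have "evG v = (inv_ar C geps \<diamondop> gar (Ar (dual V v \<otimes>\<^bsub>V\<^esub> v) (ev V v) \<one>\<^bsub>V\<^esub>)) \<diamondop> gmu (dual V v) v"
    by (simp add: evG_def)
  then have e: "arr (evG v) = ev_G V C G v"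
    by (simp add: ev_G_def comp_ar_def gar_def gmu_def inv_ar_def geps_def)
  have "evV v m = (uni m \<bullet> (evG v \<star> \<J> m)) \<bullet> inv_ar M (ass (gob (dual V v)) (gob v) m)"
    by (simp add: evact_def)
  also have "arr \<dots> = ev_act V C G M a v m"
    by (simp add: ev_act_def comp_ar_def inv_ar_def ass_def uni_def act_ar_def id_ar_def e)
  finally show ?thesis by simp
qed

end

section \<open>The internal Hom adjunction\<close>

locale ihom_setting = central_setting V C M a G
  for V :: "('vo, 'vm, 'k::alg_closed_field) tensor_cat"
    and C :: "('co, 'cm, 'k) tensor_cat"
    and M :: "('mo, 'mm, 'k) kcat"
    and a :: "('co, 'cm, 'mo, 'mm) action"
    and G :: "('vo, 'vm, 'co \<times> ('co \<Rightarrow> 'cm), 'cm) mon_fctr" +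
  fixes H :: "'mo \<Rightarrow> 'mo \<Rightarrow> 'co"
    and phi :: "'co \<Rightarrow> 'mo \<Rightarrow> 'mo \<Rightarrow> 'cm \<Rightarrow> 'mm"
  assumes IH: "internal_hom C M a H phi"
begin

definition ph where
  "ph m n u = Ar (src u \<diamond> m) (phi (src u) m n (arr u)) n"

definition ph_inv where
  "ph_inv X m n f = Ar X (phi_inv C H phi X m n (arr f)) (H m n)"

definition hev where
  "hev m n = ph m n (\<I> (H m n))"

lemma src_tgt_ph [simp]:
  "src (ph m n u) = src u \<diamond> m" "tgt (ph m n u) = n" "src (ph_inv X m n f) = X"
  "tgt (ph_inv X m n f) = H m n" "src (hev m n) = H m n \<diamond> m" "tgt (hev m n) = n"
  by (simp_all add: ph_def ph_inv_def hev_def)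

lemma H_ob [simp]: "\<lbrakk>m \<in> Ob M; n \<in> Ob M\<rbrakk> \<Longrightarrow> H m n \<in> Ob C"
  using IH by (simp add: internal_hom_def)

lemma phi_bij:
  "\<lbrakk>m \<in> Ob M; n \<in> Ob M; X \<in> Ob C\<rbrakk> \<Longrightarrow> bij_betw (phi X m n) (Hom C X (H m n)) (Hom M (X \<diamond> m) n)"
  using IH by (simp add: internal_hom_def)

lemma is_ar_ph [simp]:
  assumes "is_ar C u" "tgt u = H m n" "m \<in> Ob M" "n \<in> Ob M"
  shows "is_ar M (ph m n u)"
  using bij_betwE[OF phi_bij[OF assms(3,4), of "src u"]] assms unfolding is_ar_def
  by (simp add: ph_def)

lemma ph_comp:
  assumes "is_ar C u" "is_ar C g" "tgt u = H m n" "tgt g = src u" "m \<in> Ob M" "n \<in> Ob M"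
  shows "ph m n (u \<diamondop> g) = ph m n u \<bullet> (g \<star> \<J> m)"
  using IH assms unfolding is_ar_def internal_hom_def
  by (simp add: ph_def comp_ar_def act_ar_def id_ar_def)

lemma ph_inject:
  assumes "ph m n u = ph m n w" "is_ar C u" "is_ar C w" "tgt u = H m n" "tgt w = H m n"
    "src u = src w" "m \<in> Ob M" "n \<in> Ob M"
  shows "u = w"
proof -
  have "phi (src w) m n (arr u) = phi (src w) m n (arr w)"
    using assms(1,6) by (simp add: ph_def)
  moreover have "arr u \<in> Hom C (src w) (H m n)" "arr w \<in> Hom C (src w) (H m n)" "src w \<in> Ob C"
    using assms(2-6) unfolding is_ar_def by auto
  ultimately have "arr u = arr w"
    using phi_bij[OF assms(7,8), of "src w"] by (meson bij_betw_imp_inj_on inj_on_eq_iff)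
  then show ?thesis using assms(4-6) by (intro ar.expand) simp
qed

lemma ph_inv:
  assumes "is_ar M f" "src f = X \<diamond> m" "tgt f = n" "X \<in> Ob C" "m \<in> Ob M"
  shows "is_ar C (ph_inv X m n f)" "ph m n (ph_inv X m n f) = f"
proof -
  have f: "arr f \<in> Hom M (X \<diamond> m) n" "n \<in> Ob M"
    using assms(1-3) unfolding is_ar_def by auto
  note b = phi_bij[OF assms(5) f(2) assms(4)]
  show "ph m n (ph_inv X m n f) = f"
    using f(1) assms(2,3) f_the_inv_into_f_bij_betw[OF b]
    by (intro ar.expand) (simp add: ph_def ph_inv_def phi_inv_def)
  show "is_ar C (ph_inv X m n f)"
    using bij_betwE[OF bij_betw_the_inv_into[OF b]] f assms(4,5)
    by (simp add: ph_inv_def phi_inv_def)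
qed

lemma is_ar_hev [simp]: "\<lbrakk>m \<in> Ob M; n \<in> Ob M\<rbrakk> \<Longrightarrow> is_ar M (hev m n)"
  by (simp add: hev_def)

text \<open>Yoneda: naturality of \<open>phi\<close> at the identity of \<open>H m n\<close> shows
  that the universal evaluation \<open>hev\<close> determines it.\<close>

lemma ph_hev:
  assumes "is_ar C u" "tgt u = H m n" "m \<in> Ob M" "n \<in> Ob M"
  shows "hev m n \<bullet> (u \<star> \<J> m) = ph m n u"
  using ph_comp[of "\<I> (H m n)" u m n] assms by (simp add: hev_def)

definition hcov where
  "hcov m f = Ar (H m (src f)) (ihom_cov C M H phi m (src f) (tgt f) (arr f)) (H m (tgt f))"

definition hcon where
  "hcon g n = Ar (H (tgt g) n) (ihom_con C M a H phi (src g) (tgt g) n (arr g)) (H (src g) n)"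

definition hbeta where
  "hbeta A v m n = Ar (H m (fob (fst A) (gob v \<diamond> n))) (beta V C G M a H phi A v m n)
     (H (gob (dual V v) \<diamond> m) (fob (fst A) n))"

lemma src_tgt_h [simp]:
  "src (hcov m f) = H m (src f)" "tgt (hcov m f) = H m (tgt f)"
  "src (hcon f n) = H (tgt f) n" "tgt (hcon f n) = H (src f) n"
  "src (hbeta A v m n) = H m (fob (fst A) (gob v \<diamond> n))"
  "tgt (hbeta A v m n) = H (gob (dual V v) \<diamond> m) (fob (fst A) n)"
  by (simp_all add: hcov_def hcon_def hbeta_def)

lemma hev_arr: "ihom_ev C H phi m n = arr (hev m n)"
  by (simp add: ihom_ev_def hev_def ph_def id_ar_def)

lemma hcov_eq: "hcov m f = ph_inv (H m (src f)) m (tgt f) (f \<bullet> hev m (src f))"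
  by (simp add: hcov_def ph_inv_def ihom_cov_def hev_arr comp_ar_def)

lemma hcon_eq:
  "hcon g n = ph_inv (H (tgt g) n) (src g) n (hev (tgt g) n \<bullet> (\<I> (H (tgt g) n) \<star> g))"
  by (simp add: hcon_def ph_inv_def ihom_con_def hev_arr comp_ar_def act_ar_def id_ar_def)

lemma hbeta_eq:
  assumes "A \<in> Ob EndV" "v \<in> Ob V" "m \<in> Ob M" "n \<in> Ob M" "E = H m (fob (fst A) (gob v \<diamond> n))"
  shows "hbeta A v m n = ph_inv E (gob (dual V v) \<diamond> m) (fob (fst A) n)
    (evV v (fob (fst A) n) \<bullet> (\<I> (gob (dual V v)) \<star> (str A v n \<bullet> hev m (fob (fst A) (gob v \<diamond> n)))) \<bullet>
      sw (fob G (dual V v)) E m)" (is "_ = ph_inv _ _ _ ?f")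
proof -
  note [simp] = assms
  let ?h = "hev m (fob (fst A) (gob v \<diamond> n))" and ?D = "gob (dual V v)"
  have "?f = (evV v (fob (fst A) n) \<bullet> (\<I> ?D \<star> (str A v n \<bullet> ?h))) \<bullet> sw (fob G (dual V v)) E m"
    by simp
  also have "arr \<dots> = gamma V C G M a A E v m n (arr ?h)"
    by (simp add: gamma_def split_beta comp_ar_def act_ar_def id_ar_def str_def swap_eq ev_act_eq)
  finally show ?thesis
    by (simp add: hbeta_def beta_def split_beta Let_def ph_inv_def flip: hev_arr ihom_ev_def)
qed

lemma is_ar_hcov [simp]: "\<lbrakk>is_ar M f; m \<in> Ob M\<rbrakk> \<Longrightarrow> is_ar C (hcov m f)"
  unfolding hcov_eq by (rule ph_inv) simp_all

lemma is_ar_hcon [simp]: "\<lbrakk>is_ar M g; n \<in> Ob M\<rbrakk> \<Longrightarrow> is_ar C (hcon g n)"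
  unfolding hcon_eq by (rule ph_inv) simp_all

text \<open>The functoriality of \<open>H\<close> is prescribed at the universal evaluation alone.
  Naturality of \<open>phi\<close> extends the prescription to every \<open>u\<close>, here for
  postcomposition and in \<open>ph_hcon\<close> for precomposition.\<close>

lemma ph_hcov:
  assumes "is_ar M f" "m \<in> Ob M" "is_ar C u" "tgt u = H m (src f)"
  shows "ph m (tgt f) (hcov m f \<diamondop> u) = f \<bullet> ph m (src f) u"
proof -
  have "ph m (tgt f) (hcov m f) = f \<bullet> hev m (src f)"
    using assms unfolding hcov_eq by (intro ph_inv) simp_all
  then show ?thesis
    using assms by (simp add: ph_comp ph_hev)
qed

lemma ph_hcon:
  assumes "is_ar M g" "n \<in> Ob M" "is_ar C u" "tgt u = H (tgt g) n"
  shows "ph (src g) n (hcon g n \<diamondop> u) = ph (tgt g) n u \<bullet> (\<I> (src u) \<star> g)"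
proof -
  note [simp] = assms
  have "ph (src g) n (hcon g n) = hev (tgt g) n \<bullet> (\<I> (H (tgt g) n) \<star> g)"
    unfolding hcon_eq by (intro ph_inv) simp_all
  then have "ph (src g) n (hcon g n \<diamondop> u) = hev (tgt g) n \<bullet> (u \<star> g)"
    by (simp add: ph_comp act_comp)
  also have "\<dots> = hev (tgt g) n \<bullet> (u \<star> \<J> (tgt g)) \<bullet> (\<I> (src u) \<star> g)"
    by (simp add: act_comp)
  also have "\<dots> = ph (tgt g) n u \<bullet> (\<I> (src u) \<star> g)"
    using M.comp_ar_extend[OF ph_hev[of u "tgt g" n], of "\<I> (src u) \<star> g"] by simp
  finally show ?thesis .
qed

text \<open>\<open>beta\<close> is defined by the value of \<open>gamma\<close> at the identity. As
  \<open>sw\<close> is natural in the acting object, \<open>gamma\<close> is natural in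
  \<open>X\<close>, and its formula carries over from the identity to every
  \<open>u\<close>.\<close>

lemma ph_hbeta:
  assumes "A \<in> Ob EndV" "v \<in> Ob V" "m \<in> Ob M" "n \<in> Ob M"
    "is_ar C u" "tgt u = H m (fob (fst A) (gob v \<diamond> n))"
  shows "is_ar C (hbeta A v m n)"
    "ph (gob (dual V v) \<diamond> m) (fob (fst A) n) (hbeta A v m n \<diamondop> u)
      = evV v (fob (fst A) n) \<bullet>
        (\<I> (gob (dual V v)) \<star> (str A v n \<bullet> ph m (fob (fst A) (gob v \<diamond> n)) u)) \<bullet>
        sw (fob G (dual V v)) (src u) m"
proof -
  note [simp] = assms
  let ?D = "gob (dual V v)" and ?z = "fob G (dual V v)" and ?n = "fob (fst A) (gob v \<diamond> n)"
  let ?E = "H m ?n"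
  have b: "is_ar C (hbeta A v m n)"
    "ph (?D \<diamond> m) (fob (fst A) n) (hbeta A v m n) = evV v (fob (fst A) n) \<bullet>
      (\<I> ?D \<star> (str A v n \<bullet> hev m ?n)) \<bullet> sw ?z ?E m"
    by (simp_all only: hbeta_eq[OF assms(1-4) refl]) (rule ph_inv; simp)+
  show "is_ar C (hbeta A v m n)" by (fact b(1))
  have n: "sw ?z ?E m \<bullet> (u \<star> \<J> (?D \<diamond> m)) = (\<I> ?D \<star> u \<star> \<J> m) \<bullet> sw ?z (src u) m"
    using sw_natural[OF central_id, of ?z u "\<J> m"] by simp
  have "ph (?D \<diamond> m) (fob (fst A) n) (hbeta A v m n \<diamondop> u) = evV v (fob (fst A) n) \<bullet>
      (\<I> ?D \<star> (str A v n \<bullet> hev m ?n)) \<bullet> (\<I> ?D \<star> u \<star> \<J> m) \<bullet> sw ?z (src u) m"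
    by (simp add: ph_comp b n)
  also have "\<dots> = evV v (fob (fst A) n) \<bullet>
      (\<I> ?D \<star> (str A v n \<bullet> ph m ?n u)) \<bullet> sw ?z (src u) m"
    by (simp add: act_comp_extend ph_hev)
  finally show "ph (?D \<diamond> m) (fob (fst A) n) (hbeta A v m n \<diamondop> u) = \<dots>" .
qed

section \<open>Wedges as transformations\<close>

definition wedge :: "('vo, 'mo, 'mm) vfun \<Rightarrow> 'co \<Rightarrow> ('mo \<Rightarrow> 'cm) \<Rightarrow> bool" where
  "wedge A = relative_wedge V M V_act (ev_act V C G M a) C
     (\<lambda>m n. H m (fob (fst A) n))
     (\<lambda>m' m n g. ihom_con C M a H phi m' m (fob (fst A) n) g)
     (\<lambda>m n n' f. ihom_cov C M H phi m (fob (fst A) n) (fob (fst A) n') (far (fst A) f))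
     (beta V C G M a H phi A)"

lemma is_rhobar_iff:
  "is_rhobar V C G M a H phi A E q \<longleftrightarrow> wedge A E q \<and>
     (\<forall>E' q'. wedge A E' q' \<longrightarrow> (\<exists>!u. u \<in> Hom C E' E \<and> (\<forall>m \<in> Ob M. q' m = q m \<cdot>\<^bsub>C\<^esub> u)))"
  by (cases A) (simp add: is_rhobar_def relative_end_def wedge_def)

definition leg where
  "leg A E q m = Ar E (q m) (H m (fob (fst A) m))"

text \<open>Since \<open>phi\<close> is injective, the wedge equations may be compared after
  applying it. Functoriality of \<open>H\<close> turns dinaturality into naturality, and
  \<open>wedge_condition_iff\<close> turns the equation with \<open>beta\<close> into compatibility
  with the V-structures.\<close>

lemma wedge_iff_vtrans:
  assumes A: "A \<in> Ob EndV"
    and q: "E \<in> Ob C" "\<And>m. m \<in> Ob M \<Longrightarrow> is_ar C (leg A E q m)"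
  shows "wedge A E q \<longleftrightarrow> vtrans (rhoV E) A (\<lambda>m. ph m (fob (fst A) m) (leg A E q m))"
proof -
  note [simp] = A q
  let ?F = "fst A" and ?Q = "leg A E q"
  have [simp]: "src (?Q m) = E" "tgt (?Q m) = H m (fob ?F m)" for m
    by (simp_all add: leg_def)
  have Qh: "q m \<in> Hom C E (H m (fob ?F m))" if "m \<in> Ob M" for m
    using q(2)[OF that] by (simp add: leg_def)
  have nat: "hcov (src f) (map_ar ?F f) \<diamondop> ?Q (src f) = hcon f (fob ?F (tgt f)) \<diamondop> ?Q (tgt f) \<longleftrightarrow>
      ph (tgt f) (fob ?F (tgt f)) (?Q (tgt f)) \<bullet> (\<I> E \<star> f)
        = map_ar ?F f \<bullet> ph (src f) (fob ?F (src f)) (?Q (src f))" (is "?l \<longleftrightarrow> ?r")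
    if [simp]: "is_ar M f" for f
  proof -
    have "?l \<longleftrightarrow> ph (src f) (fob ?F (tgt f)) (hcov (src f) (map_ar ?F f) \<diamondop> ?Q (src f))
        = ph (src f) (fob ?F (tgt f)) (hcon f (fob ?F (tgt f)) \<diamondop> ?Q (tgt f))"
      by (auto intro!: ph_inject[of "src f" "fob ?F (tgt f)"])
    then show ?thesis
      using ph_hcov[of "map_ar ?F f" "src f" "?Q (src f)"]
        ph_hcon[of f "fob ?F (tgt f)" "?Q (tgt f)"] by auto
  qed
  have bal: "hcon (evV v m) (fob ?F m) \<diamondop> ?Q m = hbeta A v (gob v \<diamond> m) m \<diamondop> ?Q (gob v \<diamond> m) \<longleftrightarrow>
      str A v m \<bullet> ph (gob v \<diamond> m) (fob ?F (gob v \<diamond> m)) (?Q (gob v \<diamond> m))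
        = (\<I> (gob v) \<star> ph m (fob ?F m) (?Q m)) \<bullet> sw (fob G v) E m" (is "?l \<longleftrightarrow> ?r")
    if [simp]: "v \<in> Ob V" "m \<in> Ob M" for v m
  proof -
    let ?Dm = "gob (dual V v) \<diamond> gob v \<diamond> m"
    have b: "is_ar C (hbeta A v (gob v \<diamond> m) m)"
      by (rule ph_hbeta(1)[of _ _ _ _ "?Q (gob v \<diamond> m)"]) simp_all
    have "?l \<longleftrightarrow> ph ?Dm (fob ?F m) (hcon (evV v m) (fob ?F m) \<diamondop> ?Q m)
       = ph ?Dm (fob ?F m) (hbeta A v (gob v \<diamond> m) m \<diamondop> ?Q (gob v \<diamond> m))"
      using b by (auto intro!: ph_inject[of ?Dm "fob ?F m"])
    also have "\<dots> \<longleftrightarrow> ?r"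
      using ph_hcon[of "evV v m" "fob ?F m" "?Q m"]
        ph_hbeta(2)[of A v "gob v \<diamond> m" m "?Q (gob v \<diamond> m)"]
        wedge_condition_iff[of A E v m "ph m (fob ?F m) (?Q m)"
          "ph (gob v \<diamond> m) (fob ?F (gob v \<diamond> m)) (?Q (gob v \<diamond> m))"]
      by simp
    finally show ?thesis .
  qed
  have "wedge A E q \<longleftrightarrow>
      (\<forall>f. is_ar M f \<longrightarrow> hcov (src f) (map_ar ?F f) \<diamondop> ?Q (src f) = hcon f (fob ?F (tgt f)) \<diamondop> ?Q (tgt f)) \<and>
      (\<forall>v \<in> Ob V. \<forall>m \<in> Ob M.
        hcon (evV v m) (fob ?F m) \<diamondop> ?Q m = hbeta A v (gob v \<diamond> m) m \<diamondop> ?Q (gob v \<diamond> m))"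
  proof -
    have "(\<forall>f. is_ar M f \<longrightarrow> P (src f) (tgt f) (arr f))
        \<longleftrightarrow> (\<forall>m \<in> Ob M. \<forall>n \<in> Ob M. \<forall>f \<in> Hom M m n. P m n f)" for P
      unfolding is_ar_def by (metis ar.sel)
    note all = this[of "\<lambda>m n f. ihom_cov C M H phi m (fob ?F m) (fob ?F n) (far ?F f) \<cdot>\<^bsub>C\<^esub> q m
       = ihom_con C M a H phi m n (fob ?F n) f \<cdot>\<^bsub>C\<^esub> q n"]
    show ?thesis
      unfolding wedge_def relative_wedge_def V_act_simps all[symmetric]
      by (simp add: hcov_def hcon_def hbeta_def leg_def comp_ar_def map_ar_def ev_act_eq Qh)
  qed
  then show ?thesis
    by (simp add: vtrans_def nat bal)
qed

end

section \<open>The universal property in terms of the counit\<close>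

locale rhobar_setting = ihom_setting V C M a G H phi
  for V :: "('vo, 'vm, 'k::alg_closed_field) tensor_cat"
    and C :: "('co, 'cm, 'k) tensor_cat"
    and M :: "('mo, 'mm, 'k) kcat"
    and a :: "('co, 'cm, 'mo, 'mm) action"
    and G :: "('vo, 'vm, 'co \<times> ('co \<Rightarrow> 'cm), 'cm) mon_fctr"
    and H :: "'mo \<Rightarrow> 'mo \<Rightarrow> 'co"
    and phi :: "'co \<Rightarrow> 'mo \<Rightarrow> 'mo \<Rightarrow> 'cm \<Rightarrow> 'mm" +
  fixes R :: "('vo, 'mo, 'mm) vfun \<Rightarrow> 'co"
    and p :: "('vo, 'mo, 'mm) vfun \<Rightarrow> 'mo \<Rightarrow> 'cm"
  assumes rhobar: "\<forall>A \<in> Ob (End_V V C G M a). is_rhobar V C G M a H phi A (R A) (p A)"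
begin

text \<open>The counit \<open>counit_at\<close> as a typed arrow. Inside this locale the name hides
  the unit comparison \<open>eps\<close> of a monoidal functor.\<close>

definition eps where
  "eps A m = ph m (fob (fst A) m) (leg A (R A) (p A) m)"

lemma src_tgt_leg [simp]:
  "src (leg A E q m) = E" "tgt (leg A E q m) = H m (fob (fst A) m)"
  "src (eps A m) = R A \<diamond> m" "tgt (eps A m) = fob (fst A) m"
  by (simp_all add: leg_def eps_def)

lemma wedge_R: "A \<in> Ob EndV \<Longrightarrow> wedge A (R A) (p A)"
  using rhobar by (simp add: is_rhobar_iff)

lemma R_ob [simp]: "A \<in> Ob EndV \<Longrightarrow> R A \<in> Ob C"
  using wedge_R[of A] by (simp add: wedge_def relative_wedge_def)

lemma is_ar_leg_R [simp]: "\<lbrakk>A \<in> Ob EndV; m \<in> Ob M\<rbrakk> \<Longrightarrow> is_ar C (leg A (R A) (p A) m)"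
  using wedge_R[of A] by (simp add: wedge_def relative_wedge_def leg_def)

lemma is_ar_eps [simp]: "\<lbrakk>A \<in> Ob EndV; m \<in> Ob M\<rbrakk> \<Longrightarrow> is_ar M (eps A m)"
  by (simp add: eps_def)

lemma vtrans_eps: "A \<in> Ob EndV \<Longrightarrow> vtrans (rhoV (R A)) A (eps A)"
  using wedge_iff_vtrans[of A "R A" "p A"] wedge_R[of A] unfolding eps_def by simp

lemma eps_natural:
  "\<lbrakk>A \<in> Ob EndV; is_ar M f\<rbrakk>
    \<Longrightarrow> eps A (tgt f) \<bullet> (\<I> (R A) \<star> f) = map_ar (fst A) f \<bullet> eps A (src f)"
  using vtransD(4)[OF vtrans_eps] by simp

lemma ph_leg_comp:
  assumes "A \<in> Ob EndV" "m \<in> Ob M" "is_ar C u" "tgt u = R A"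
  shows "ph m (fob (fst A) m) (leg A (R A) (p A) m \<diamondop> u) = eps A m \<bullet> (u \<star> \<J> m)"
  using assms by (simp add: ph_comp eps_def)

lemma ex1_lift:
  assumes "A \<in> Ob EndV" "wedge A E q" "E \<in> Ob C"
  shows "\<exists>!u. u \<in> Hom C E (R A) \<and> (\<forall>m \<in> Ob M. q m = p A m \<cdot>\<^bsub>C\<^esub> u)"
  using rhobar assms by (simp add: is_rhobar_iff)

text \<open>The defining property of the relative end, read through \<open>wedge_iff_vtrans\<close>:
  \<open>eps A\<close> is a universal arrow from \<open>rho\<close> to \<open>A\<close>.\<close>

lemma lift_exists:
  assumes A: "A \<in> Ob EndV" and E: "E \<in> Ob C" and t: "vtrans (rhoV E) A t"
  shows "\<exists>!u. u \<in> Hom C E (R A) \<and> (\<forall>m \<in> Ob M. eps A m \<bullet> (Ar E u (R A) \<star> \<J> m) = t m)"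
proof -
  note [simp] = A E
  \<comment> \<open>The wedge whose legs correspond under \<open>phi\<close> to the given components
    \<open>t m\<close>.\<close>
  define q where "q = (\<lambda>m. arr (ph_inv E m (fob (fst A) m) (t m)))"
  have leg: "leg A E q m = ph_inv E m (fob (fst A) m) (t m)" for m
    by (simp add: leg_def q_def ph_inv_def)
  have ar: "is_ar C (leg A E q m)" "ph m (fob (fst A) m) (leg A E q m) = t m" if "m \<in> Ob M" for m
    using ph_inv[of "t m" E m "fob (fst A) m"] vtransD(1-3)[OF t, of m] that by (simp_all add: leg)
  have "wedge A E q"
    using t ar vtrans_cong[of "\<lambda>m. ph m (fob (fst A) m) (leg A E q m)" t "rhoV E" A]
    by (simp add: wedge_iff_vtrans)
  moreover have "q m = p A m \<cdot>\<^bsub>C\<^esub> u \<longleftrightarrow> eps A m \<bullet> (Ar E u (R A) \<star> \<J> m) = t m"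
    if u [simp]: "u \<in> Hom C E (R A)" and m [simp]: "m \<in> Ob M" for u m
  proof -
    have "q m = p A m \<cdot>\<^bsub>C\<^esub> u \<longleftrightarrow> leg A (R A) (p A) m \<diamondop> Ar E u (R A) = leg A E q m"
      by (auto simp: leg_def comp_ar_def)
    also have "\<dots> \<longleftrightarrow> ph m (fob (fst A) m) (leg A (R A) (p A) m \<diamondop> Ar E u (R A))
        = ph m (fob (fst A) m) (leg A E q m)"
      using ar(1)[of m] by (auto intro!: ph_inject[of m "fob (fst A) m"])
    finally show ?thesis
      by (simp add: ph_leg_comp ar(2))
  qed
  ultimately show ?thesis
    using ex1_lift[OF A _ E, of q] by (simp cong: conj_cong)
qed

text \<open>Both arrows lift the same family. It is a transformation, being \<open>eps A\<close>
  after the transformation induced by \<open>u\<close>, so the uniqueness in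
  \<open>lift_exists\<close> applies.\<close>

lemma eps_inject:
  assumes "\<And>m. m \<in> Ob M \<Longrightarrow> eps A m \<bullet> (u \<star> \<J> m) = eps A m \<bullet> (w \<star> \<J> m)"
    "A \<in> Ob EndV" "is_ar C u" "is_ar C w" "tgt u = R A" "tgt w = R A" "src u = src w"
  shows "u = w"
proof -
  note [simp] = assms(2-)
  let ?E = "src w"
  have E: "?E \<in> Ob C" by simp
  have leg: "leg A ?E (\<lambda>m. p A m \<cdot>\<^bsub>C\<^esub> arr x) m = leg A (R A) (p A) m \<diamondop> x"
    if "is_ar C x" "src x = ?E" "tgt x = R A" for x m
    using that by (simp add: leg_def comp_ar_def)
  have "vtrans (rhoV ?E) A (\<lambda>m. eps A m \<bullet> (u \<star> \<J> m))"
  proof (rule vtrans_comp[OF _ vtrans_eps])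
    show "vtrans (rhoV ?E) (rhoV (R A)) (\<lambda>m. u \<star> \<J> m)"
      unfolding vtrans_def
    proof (intro conjI ballI allI impI)
      fix v m assume "v \<in> Ob V" "m \<in> Ob M"
      then show "str (rhoV (R A)) v m \<bullet> (u \<star> \<J> (gob v \<diamond> m))
          = (\<I> (gob v) \<star> u \<star> \<J> m) \<bullet> str (rhoV ?E) v m"
        using sw_natural[OF central_id, of "fob G v" u "\<J> m"] by simp
    qed (simp_all add: act_comp)
  qed simp_all
  from lift_exists[OF _ E this] have "arr u = arr w"
    using assms unfolding is_ar_def by (cases u, cases w) auto
  then show ?thesis by (intro ar.expand) simp
qed

definition rar where
  "rar A \<alpha> B = Ar (R A) (rhobar_arr C M H phi R p (A, \<alpha>, B)) (R B)"

text \<open>\<open>rhobar_arr\<close> is a definite description by a condition on legs. Under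
  \<open>phi\<close> this condition becomes the naturality square of the counit, and
  \<open>lift_exists\<close>, applied to the counit followed by the given family, provides the
  unique solution.\<close>

lemma rar:
  assumes A: "A \<in> Ob EndV" and B: "B \<in> Ob EndV" and t: "vtrans A B (fam A \<alpha> B)"
  shows "is_ar C (rar A \<alpha> B)"
    "m \<in> Ob M \<Longrightarrow> eps B m \<bullet> (rar A \<alpha> B \<star> \<J> m) = fam A \<alpha> B m \<bullet> eps A m"
proof -
  note [simp] = A B
  have iff: "p B m \<cdot>\<^bsub>C\<^esub> u = ihom_cov C M H phi m (fob (fst A) m) (fob (fst B) m) (\<alpha> m) \<cdot>\<^bsub>C\<^esub> p A m
      \<longleftrightarrow> eps B m \<bullet> (Ar (R A) u (R B) \<star> \<J> m) = fam A \<alpha> B m \<bullet> eps A m"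
    if u [simp]: "u \<in> Hom C (R A) (R B)" and m [simp]: "m \<in> Ob M" for u m
  proof -
    note [simp] = vtransD(1-3)[OF t m]
    have "p B m \<cdot>\<^bsub>C\<^esub> u = ihom_cov C M H phi m (fob (fst A) m) (fob (fst B) m) (\<alpha> m) \<cdot>\<^bsub>C\<^esub> p A m
        \<longleftrightarrow> leg B (R B) (p B) m \<diamondop> Ar (R A) u (R B) = hcov m (fam A \<alpha> B m) \<diamondop> leg A (R A) (p A) m"
      by (simp add: leg_def comp_ar_def hcov_def fam_def)
    also have "\<dots> \<longleftrightarrow> ph m (fob (fst B) m) (leg B (R B) (p B) m \<diamondop> Ar (R A) u (R B))
        = ph m (fob (fst B) m) (hcov m (fam A \<alpha> B m) \<diamondop> leg A (R A) (p A) m)"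
      by (auto intro!: ph_inject[of m "fob (fst B) m"])
    finally show ?thesis
      using ph_hcov[of "fam A \<alpha> B m" m "leg A (R A) (p A) m"] by (simp add: ph_leg_comp eps_def)
  qed
  have "\<exists>!u. u \<in> Hom C (R A) (R B) \<and>
      (\<forall>m \<in> Ob M. eps B m \<bullet> (Ar (R A) u (R B) \<star> \<J> m) = fam A \<alpha> B m \<bullet> eps A m)"
    by (rule lift_exists) (use vtrans_comp[OF vtrans_eps[OF A] t] in simp_all)
  then have "\<exists>!u. u \<in> Hom C (R A) (R B) \<and> (\<forall>m \<in> Ob M. p B m \<cdot>\<^bsub>C\<^esub> u =
        ihom_cov C M H phi m (fob (fst A) m) (fob (fst B) m) (\<alpha> m) \<cdot>\<^bsub>C\<^esub> p A m)"
    by (simp add: iff cong: conj_cong)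
  from theI'[OF this] have u: "rhobar_arr C M H phi R p (A, \<alpha>, B) \<in> Hom C (R A) (R B)"
    "\<And>m. m \<in> Ob M \<Longrightarrow> p B m \<cdot>\<^bsub>C\<^esub> rhobar_arr C M H phi R p (A, \<alpha>, B) =
        ihom_cov C M H phi m (fob (fst A) m) (fob (fst B) m) (\<alpha> m) \<cdot>\<^bsub>C\<^esub> p A m"
    by (simp_all add: rhobar_arr_def)
  then show "is_ar C (rar A \<alpha> B)"
    "m \<in> Ob M \<Longrightarrow> eps B m \<bullet> (rar A \<alpha> B \<star> \<J> m) = fam A \<alpha> B m \<bullet> eps A m"
    using iff by (simp_all add: rar_def)
qed

lemma src_tgt_rar [simp]:
  "src (rar A \<alpha> B) = R A" "tgt (rar A \<alpha> B) = R B"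
  by (simp_all add: rar_def)

lemma vtrans_id: "A \<in> Ob EndV \<Longrightarrow> vtrans A A (\<lambda>m. \<J> (fob (fst A) m))"
  by (simp add: vtrans_def)

text \<open>The unit is the lift of the identity transformation of \<open>rho X\<close>; the
  resulting equation is a triangle identity of the adjunction.\<close>

lemma adj_unit:
  assumes "X \<in> Ob C"
  shows "is_ar C (Ar X (adj_unit C G M a H phi R p X) (R (rhoV X)))"
    "m \<in> Ob M \<Longrightarrow> eps (rhoV X) m \<bullet> (Ar X (adj_unit C G M a H phi R p X) (R (rhoV X)) \<star> \<J> m)
      = \<J> (X \<diamond> m)"
proof -
  note [simp] = assms
  let ?A = "rhoV X"
  have iff: "p ?A m \<cdot>\<^bsub>C\<^esub> u = phi_inv C H phi X m (X \<diamond> m) (ident M (X \<diamond> m))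
      \<longleftrightarrow> eps ?A m \<bullet> (Ar X u (R ?A) \<star> \<J> m) = \<J> (X \<diamond> m)"
    if u [simp]: "u \<in> Hom C X (R ?A)" and m [simp]: "m \<in> Ob M" for u m
  proof -
    note i = ph_inv[of "\<J> (X \<diamond> m)" X m "X \<diamond> m"]
    have "p ?A m \<cdot>\<^bsub>C\<^esub> u = phi_inv C H phi X m (X \<diamond> m) (ident M (X \<diamond> m))
        \<longleftrightarrow> leg ?A (R ?A) (p ?A) m \<diamondop> Ar X u (R ?A) = ph_inv X m (X \<diamond> m) (\<J> (X \<diamond> m))"
      by (simp add: leg_def comp_ar_def ph_inv_def id_ar_def)
    also have "\<dots> \<longleftrightarrow> ph m (X \<diamond> m) (leg ?A (R ?A) (p ?A) m \<diamondop> Ar X u (R ?A))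
        = ph m (X \<diamond> m) (ph_inv X m (X \<diamond> m) (\<J> (X \<diamond> m)))"
      using i by (auto intro!: ph_inject[of m "X \<diamond> m"])
    finally show ?thesis
      using i ph_leg_comp[of ?A m "Ar X u (R ?A)"] by simp
  qed
  have "\<exists>!u. u \<in> Hom C X (R ?A) \<and>
      (\<forall>m \<in> Ob M. eps ?A m \<bullet> (Ar X u (R ?A) \<star> \<J> m) = \<J> (X \<diamond> m))"
    by (rule lift_exists) (use vtrans_id[of ?A] in simp_all)
  then have "\<exists>!u. u \<in> Hom C X (R ?A) \<and> (\<forall>m \<in> Ob M. p ?A m \<cdot>\<^bsub>C\<^esub> u =
        phi_inv C H phi X m (X \<diamond> m) (ident M (X \<diamond> m)))"
    by (simp add: iff cong: conj_cong)
  from theI'[OF this] have u: "adj_unit C G M a H phi R p X \<in> Hom C X (R ?A)"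
    "\<And>m. m \<in> Ob M \<Longrightarrow> p ?A m \<cdot>\<^bsub>C\<^esub> adj_unit C G M a H phi R p X =
        phi_inv C H phi X m (X \<diamond> m) (ident M (X \<diamond> m))"
    by (simp_all add: adj_unit_def)
  then show "is_ar C (Ar X (adj_unit C G M a H phi R p X) (R ?A))"
    "m \<in> Ob M \<Longrightarrow> eps ?A m \<bullet> (Ar X (adj_unit C G M a H phi R p X) (R ?A) \<star> \<J> m)
      = \<J> (X \<diamond> m)"
    using iff by simp_all
qed

section \<open>The structure arrows of the bimodule functor\<close>

lemma vtrans_lact:
  assumes "vtrans (rhoV E) A t" "E \<in> Ob C" "A \<in> Ob EndV" "X \<in> Ob C"
  shows "vtrans (rhoV (X \<otimes>\<^sub>o E)) (lact X A) (\<lambda>m. (\<I> X \<star> t m) \<bullet> ass X E m)"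
  unfolding vtrans_def
proof (intro conjI ballI allI impI)
  note [simp] = assms(2-) vtransD(1-3)[OF assms(1)]
  fix f assume [simp]: "is_ar M f"
  have "((\<I> X \<star> t (tgt f)) \<bullet> ass X E (tgt f)) \<bullet> map_ar (fst (rhoV (X \<otimes>\<^sub>o E))) f
      = (\<I> X \<star> t (tgt f)) \<bullet> (\<I> X \<star> \<I> E \<star> f) \<bullet> ass X E (src f)"
    using ass_natural[of "\<I> X" "\<I> E" f] by simp
  also have "\<dots> = map_ar (fst (lact X A)) f \<bullet> (\<I> X \<star> t (src f)) \<bullet> ass X E (src f)"
    using vtransD(4)[OF assms(1), of f] by (simp add: act_comp_extend)
  finally show "((\<I> X \<star> t (tgt f)) \<bullet> ass X E (tgt f)) \<bullet> map_ar (fst (rhoV (X \<otimes>\<^sub>o E))) f = \<dots>" .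
next
  note [simp] = assms(2-) vtransD(1-3)[OF assms(1)]
  fix v m assume [simp]: "v \<in> Ob V" "m \<in> Ob M"
  let ?X = "gob v"
  have "str (lact X A) v m \<bullet> (\<I> X \<star> t (?X \<diamond> m)) \<bullet> ass X E (?X \<diamond> m)
      = sw (fob G v) X (fob (fst A) m) \<bullet> (\<I> X \<star> ((\<I> ?X \<star> t m) \<bullet> sw (fob G v) E m)) \<bullet> ass X E (?X \<diamond> m)"
    using vtransD(5)[OF assms(1), of v m] by (simp add: act_comp_extend)
  also have "\<dots> = sw (fob G v) X (fob (fst A) m) \<bullet> (\<I> X \<star> \<I> ?X \<star> t m) \<bullet>
      (\<I> X \<star> sw (fob G v) E m) \<bullet> ass X E (?X \<diamond> m)"
    by (simp add: act_comp_extend)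
  also have "\<dots> = (\<I> ?X \<star> \<I> X \<star> t m) \<bullet> sw (fob G v) X (E \<diamond> m) \<bullet>
      (\<I> X \<star> sw (fob G v) E m) \<bullet> ass X E (?X \<diamond> m)"
    using M.comp_ar_extend[OF sw_natural[OF central_id, of "fob G v" "\<I> X" "t m"],
        of "(\<I> X \<star> sw (fob G v) E m) \<bullet> ass X E (?X \<diamond> m)"] by simp
  also have "\<dots> = (\<I> ?X \<star> ((\<I> X \<star> t m) \<bullet> ass X E m)) \<bullet> str (rhoV (X \<otimes>\<^sub>o E)) v m"
    by (simp add: act_comp_extend flip: sw_tensor)
  finally show "str (lact X A) v m \<bullet> (\<I> X \<star> t (?X \<diamond> m)) \<bullet> ass X E (?X \<diamond> m) = \<dots>" .
qed (use assms(2-) vtransD(1-3)[OF assms(1)] in simp_all)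

text \<open>As for the left action, \<open>sw_tensor\<close> merges two exchanges into the one with
  the tensor product. Here one of them sits under the functor of \<open>A\<close>, and naturality of
  \<open>t\<close> brings it out.\<close>

lemma vtrans_ract:
  assumes "vtrans (rhoV E) A t" "E \<in> Ob C" "A \<in> Ob EndV" "X \<in> Ob C"
  shows "vtrans (rhoV (E \<otimes>\<^sub>o X)) (ract A X) (\<lambda>m. t (X \<diamond> m) \<bullet> ass E X m)"
  unfolding vtrans_def
proof (intro conjI ballI allI impI)
  note [simp] = assms(2-) vtransD(1-3)[OF assms(1)]
  fix f assume [simp]: "is_ar M f"
  have "(t (X \<diamond> tgt f) \<bullet> ass E X (tgt f)) \<bullet> map_ar (fst (rhoV (E \<otimes>\<^sub>o X))) f
      = t (X \<diamond> tgt f) \<bullet> (\<I> E \<star> \<I> X \<star> f) \<bullet> ass E X (src f)"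
    using ass_natural[of "\<I> E" "\<I> X" f] by simp
  also have "\<dots> = map_ar (fst (ract A X)) f \<bullet> t (X \<diamond> src f) \<bullet> ass E X (src f)"
    using M.comp_ar_extend[OF vtransD(4)[OF assms(1), of "\<I> X \<star> f"], of "ass E X (src f)"] by simp
  finally show "(t (X \<diamond> tgt f) \<bullet> ass E X (tgt f)) \<bullet> map_ar (fst (rhoV (E \<otimes>\<^sub>o X))) f = \<dots>" .
next
  note [simp] = assms(2-) vtransD(1-3)[OF assms(1)]
  fix v m assume [simp]: "v \<in> Ob V" "m \<in> Ob M"
  let ?X = "gob v" and ?z = "fob G v"
  have "str (ract A X) v m \<bullet> t (X \<diamond> ?X \<diamond> m) \<bullet> ass E X (?X \<diamond> m)
      = str A v (X \<diamond> m) \<bullet> t (?X \<diamond> X \<diamond> m) \<bullet> (\<I> E \<star> sw ?z X m) \<bullet> ass E X (?X \<diamond> m)"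
    using M.comp_ar_extend[OF vtransD(4)[OF assms(1), of "sw ?z X m"], of "ass E X (?X \<diamond> m)"] by simp
  also have "\<dots> = (\<I> ?X \<star> t (X \<diamond> m)) \<bullet> sw ?z E (X \<diamond> m) \<bullet> (\<I> E \<star> sw ?z X m) \<bullet>
      ass E X (?X \<diamond> m)"
    using M.comp_ar_extend[OF vtransD(5)[OF assms(1), of v "X \<diamond> m"],
        of "(\<I> E \<star> sw ?z X m) \<bullet> ass E X (?X \<diamond> m)"] by simp
  also have "\<dots> = (\<I> ?X \<star> (t (X \<diamond> m) \<bullet> ass E X m)) \<bullet> str (rhoV (E \<otimes>\<^sub>o X)) v m"
    by (simp add: act_comp_extend flip: sw_tensor)
  finally show "str (ract A X) v m \<bullet> t (X \<diamond> ?X \<diamond> m) \<bullet> ass E X (?X \<diamond> m) = \<dots>" .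
qed (use assms(2-) vtransD(1-3)[OF assms(1)] in simp_all)

definition linv where
  "linv X A = Ar (X \<otimes>\<^sub>o R A) (l_inv C G M a H phi R p X A) (R (lact X A))"

definition rinv where
  "rinv A X = Ar (R A \<otimes>\<^sub>o X) (r_inv C G M a H phi R p A X) (R (ract A X))"

lemma src_tgt_linv [simp]:
  "src (linv X A) = X \<otimes>\<^sub>o R A" "tgt (linv X A) = R (lact X A)"
  "src (rinv A X) = R A \<otimes>\<^sub>o X" "tgt (rinv A X) = R (ract A X)"
  by (simp_all add: linv_def rinv_def)

text \<open>Adjuncts in the form used by \<open>l_inv\<close> and \<open>r_inv\<close>, the image of
  a transformation after the unit. The counit passes through the image by its naturality, and the
  triangle identity cancels the unit.\<close>

lemma mate:
  assumes B: "B \<in> Ob EndV" and E: "E \<in> Ob C" and t: "vtrans (rhoV E) B t"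
    and \<alpha>: "\<And>m. m \<in> Ob M \<Longrightarrow> t m = Ar (E \<diamond> m) (\<alpha> m) (fob (fst B) m)"
    and u: "u = Ar E (rhobar_arr C M H phi R p (rhoV E, \<alpha>, B) \<cdot>\<^bsub>C\<^esub> adj_unit C G M a H phi R p E) (R B)"
  shows "is_ar C u" "m \<in> Ob M \<Longrightarrow> eps B m \<bullet> (u \<star> \<J> m) = t m"
proof -
  note [simp] = B E
  let ?h = "Ar E (adj_unit C G M a H phi R p E) (R (rhoV E))"
  have u': "u = rar (rhoV E) \<alpha> B \<diamondop> ?h"
    by (simp add: u rar_def comp_ar_def)
  have fam: "fam (rhoV E) \<alpha> B m = t m" if "m \<in> Ob M" for m
    using \<alpha>[OF that] by (simp add: fam_def)
  then have v: "vtrans (rhoV E) B (fam (rhoV E) \<alpha> B)"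
    using t vtrans_cong[of "fam (rhoV E) \<alpha> B" t] by simp
  note r = rar[OF _ B v] and h = adj_unit[OF E]
  show "is_ar C u"
    using r h(1) by (simp add: u' del: is_ar_Ar)
  show "eps B m \<bullet> (u \<star> \<J> m) = t m" if m [simp]: "m \<in> Ob M"
  proof -
    note [simp] = vtransD(1-3)[OF t m] r(1) h(1)
    have "eps B m \<bullet> (u \<star> \<J> m) = eps B m \<bullet> (rar (rhoV E) \<alpha> B \<star> \<J> m) \<bullet> (?h \<star> \<J> m)"
      by (simp add: u' act_comp del: is_ar_Ar)
    also have "\<dots> = (fam (rhoV E) \<alpha> B m \<bullet> eps (rhoV E) m) \<bullet> (?h \<star> \<J> m)"
      using M.comp_ar_extend[OF r(2), of m "?h \<star> \<J> m"] by (simp del: is_ar_Ar)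
    also have "\<dots> = t m"
      using h(2) by (simp add: fam del: is_ar_Ar)
    finally show ?thesis .
  qed
qed

text \<open>An instance of \<open>mate\<close>: the inverse of l is the adjunct of the counit acted
  upon by \<open>X\<close>. The definite descriptions inside \<open>l_inv\<close> are from here on
  replaced by this equation.\<close>

lemma linv:
  assumes "A \<in> Ob EndV" "X \<in> Ob C"
  shows "is_ar C (linv X A)"
    "m \<in> Ob M \<Longrightarrow>
      eps (lact X A) m \<bullet> (linv X A \<star> \<J> m) = (\<I> X \<star> eps A m) \<bullet> ass X (R A) m"
proof -
  let ?\<alpha> = "\<lambda>m \<in> Ob M. (ident C X \<rhd>\<^sub>a\<^bsub>a\<^esub> counit_at phi R p A m) \<cdot>\<^bsub>M\<^esub> massoc a X (R A) m"
  note * = mate[OF act_EndV_ob(1)[OF assms] _ vtrans_lact[OF vtrans_eps[OF assms(1)] _ assms],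
      of ?\<alpha> "linv X A"]
  show "is_ar C (linv X A)" "m \<in> Ob M \<Longrightarrow>
      eps (lact X A) m \<bullet> (linv X A \<star> \<J> m) = (\<I> X \<star> eps A m) \<bullet> ass X (R A) m"
    by (rule *; use assms in \<open>simp add: linv_def l_inv_def comp_ar_def act_ar_def id_ar_def
      ass_def eps_def ph_def leg_def counit_at_def\<close>)+
qed

lemma rinv:
  assumes "A \<in> Ob EndV" "X \<in> Ob C"
  shows "is_ar C (rinv A X)"
    "m \<in> Ob M \<Longrightarrow>
      eps (ract A X) m \<bullet> (rinv A X \<star> \<J> m) = eps A (X \<diamond> m) \<bullet> ass (R A) X m"
proof -
  let ?\<alpha> = "\<lambda>m \<in> Ob M. counit_at phi R p A (X \<diamond> m) \<cdot>\<^bsub>M\<^esub> massoc a (R A) X m"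
  note * = mate[OF act_EndV_ob(2)[OF assms] _ vtrans_ract[OF vtrans_eps[OF assms(1)] _ assms],
      of ?\<alpha> "rinv A X"]
  show "is_ar C (rinv A X)" "m \<in> Ob M \<Longrightarrow>
      eps (ract A X) m \<bullet> (rinv A X \<star> \<J> m) = eps A (X \<diamond> m) \<bullet> ass (R A) X m"
    by (rule *; use assms in \<open>simp add: rinv_def r_inv_def comp_ar_def
      ass_def eps_def ph_def leg_def counit_at_def\<close>)+
qed

section \<open>Arrows into \<open>X \<otimes> R A\<close>\<close>

definition Phi where
  "Phi X A u m = (\<I> X \<star> eps A m) \<bullet> ass X (R A) m \<bullet> (u \<star> \<J> m)"

lemma src_tgt_Phi [simp]:
  "src (Phi X A u m) = src u \<diamond> m" "tgt (Phi X A u m) = X \<diamond> fob (fst A) m"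
  by (simp_all add: Phi_def)

lemma is_ar_Phi [simp]:
  "\<lbrakk>A \<in> Ob EndV; X \<in> Ob C; m \<in> Ob M; is_ar C u; tgt u = X \<otimes>\<^sub>o R A\<rbrakk> \<Longrightarrow> is_ar M (Phi X A u m)"
  by (simp add: Phi_def)

definition dl where
  "dl X = Ar (dual C X \<otimes>\<^sub>o X) (ev C X) \<one>\<^sub>o"

definition codl where
  "codl X = Ar \<one>\<^sub>o (coev C X) (X \<otimes>\<^sub>o dual C X)"

lemma src_tgt_dl [simp]:
  "src (dl X) = dual C X \<otimes>\<^sub>o X" "tgt (dl X) = \<one>\<^sub>o"
  "src (codl X) = \<one>\<^sub>o" "tgt (codl X) = X \<otimes>\<^sub>o dual C X"
  by (simp_all add: dl_def codl_def)

lemma dual_ob [simp]: "X \<in> Ob C \<Longrightarrow> dual C X \<in> Ob C"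
  using C.left_dual by (simp add: is_left_dual_def)

lemma is_ar_dl [simp]: "X \<in> Ob C \<Longrightarrow> is_ar C (dl X)" "X \<in> Ob C \<Longrightarrow> is_ar C (codl X)"
  using C.left_dual[of X] by (simp_all add: is_left_dual_def dl_def codl_def)

lemma snake_dl: "X \<in> Ob C \<Longrightarrow> (\<I> X \<bowtie> dl X) \<diamondop> (codl X \<bowtie> \<I> X) = \<I> X"
  using C.left_dual[of X]
  by (simp add: is_left_dual_def dl_def codl_def comp_ar_def tensor_ar_def id_ar_def)

abbreviation evC where "evC X \<equiv> evact (dual C X) X (dl X)"

text \<open>Transposing \<open>u\<close> along the dual of \<open>X\<close> gives an arrow into
  \<open>R A\<close>, to which the universal property applies. Its composite with the counit is the
  transpose, on \<open>M\<close>, of \<open>Phi X A u\<close>.\<close>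

lemma eps_transpose:
  assumes A: "A \<in> Ob EndV" and X: "X \<in> Ob C" and u: "is_ar C u" "tgt u = X \<otimes>\<^sub>o R A" and m: "m \<in> Ob M"
  shows "eps A m \<bullet> (((dl X \<bowtie> \<I> (R A)) \<diamondop> (\<I> (dual C X) \<bowtie> u)) \<star> \<J> m)
    = evC X (fob (fst A) m) \<bullet> (\<I> (dual C X) \<star> Phi X A u m) \<bullet> ass (dual C X) (src u) m"
proof -
  note [simp] = A X u m
  let ?D = "dual C X" and ?u = "(\<I> (dual C X) \<bowtie> u) \<star> \<J> m"
  have "evC X (fob (fst A) m) \<bullet> (\<I> ?D \<star> Phi X A u m) \<bullet> ass ?D (src u) m
    = (evC X (fob (fst A) m) \<bullet> (\<I> ?D \<star> \<I> X \<star> eps A m)) \<bullet> (\<I> ?D \<star> ass X (R A) m) \<bullet>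
      (\<I> ?D \<star> u \<star> \<J> m) \<bullet> ass ?D (src u) m"
    by (simp add: Phi_def act_comp_extend)
  also have "evC X (fob (fst A) m) \<bullet> (\<I> ?D \<star> \<I> X \<star> eps A m) = eps A m \<bullet> evC X (R A \<diamond> m)"
    using evact_natural[of "eps A m" ?D X "dl X"] by simp
  also have "(eps A m \<bullet> evC X (R A \<diamond> m)) \<bullet> (\<I> ?D \<star> ass X (R A) m) \<bullet>
      (\<I> ?D \<star> u \<star> \<J> m) \<bullet> ass ?D (src u) m
    = eps A m \<bullet> evC X (R A \<diamond> m) \<bullet> (\<I> ?D \<star> ass X (R A) m) \<bullet> ass ?D (X \<otimes>\<^sub>o R A) m \<bullet> ?u"
    using ass_natural[of "\<I> ?D" u "\<J> m"] by simp
  also have "\<dots> = eps A m \<bullet> evC X (R A \<diamond> m) \<bullet> ass ?D X (R A \<diamond> m) \<bullet> ass (?D \<otimes>\<^sub>o X) (R A) m \<bullet> ?u"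
    by (simp add: pentagon')
  also have "\<dots> = eps A m \<bullet> uni (R A \<diamond> m) \<bullet> (dl X \<star> \<J> (R A \<diamond> m)) \<bullet>
      ass (?D \<otimes>\<^sub>o X) (R A) m \<bullet> ?u"
    by (simp add: evact_def)
  also have "\<dots> = eps A m \<bullet> uni (R A \<diamond> m) \<bullet> ass \<one>\<^sub>o (R A) m \<bullet> ((dl X \<bowtie> \<I> (R A)) \<star> \<J> m) \<bullet> ?u"
    using ass_natural'[of "dl X" "\<I> (R A)" "\<J> m" _ _ _ ?u] by simp
  also have "\<dots> = eps A m \<bullet> ((dl X \<bowtie> \<I> (R A)) \<star> \<J> m) \<bullet> ?u"
    using M.comp_ar_extend[OF triangle_left[of "R A" m], of "((dl X \<bowtie> \<I> (R A)) \<star> \<J> m) \<bullet> ?u"] by simp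
  finally show ?thesis
    by (simp add: act_comp)
qed

text \<open>By interchange \<open>u\<close> can be applied ahead of the coevaluation, and what
  follows it is the snake on \<open>X\<close>.\<close>

lemma transpose_back:
  assumes "X \<in> Ob C" "Y \<in> Ob C" "is_ar C u" "tgt u = X \<otimes>\<^sub>o Y"
  shows "(\<I> X \<bowtie> ((dl X \<bowtie> \<I> Y) \<diamondop> (\<I> (dual C X) \<bowtie> u))) \<diamondop> (codl X \<bowtie> \<I> (src u)) = u"
proof -
  note [simp] = assms
  let ?D = "dual C X"
  have 1: "(\<I> X \<bowtie> \<I> ?D \<bowtie> u) \<diamondop> (codl X \<bowtie> \<I> (src u)) = (codl X \<bowtie> \<I> X \<bowtie> \<I> Y) \<diamondop> u"
    using tensor_comp[of "codl X" "\<I> (X \<otimes>\<^sub>o ?D)" "\<I> (src u)" u]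
      tensor_comp[of "\<I> \<one>\<^sub>o" "codl X" u "\<I> (X \<otimes>\<^sub>o Y)"]
    by (simp flip: tensor_id) simp
  have "(\<I> X \<bowtie> ((dl X \<bowtie> \<I> Y) \<diamondop> (\<I> ?D \<bowtie> u))) \<diamondop> (codl X \<bowtie> \<I> (src u))
    = (\<I> X \<bowtie> dl X \<bowtie> \<I> Y) \<diamondop> (\<I> X \<bowtie> \<I> ?D \<bowtie> u) \<diamondop> (codl X \<bowtie> \<I> (src u))"
    using tensor_comp_extend[of "\<I> X" "\<I> X" "\<I> ?D \<bowtie> u" "dl X \<bowtie> \<I> Y" "codl X \<bowtie> \<I> (src u)"] by simp
  also have "\<dots> = ((\<I> X \<bowtie> dl X \<bowtie> \<I> Y) \<diamondop> (codl X \<bowtie> \<I> X \<bowtie> \<I> Y)) \<diamondop> u"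
    by (simp add: 1 del: tensor_id)
  also have "(\<I> X \<bowtie> dl X \<bowtie> \<I> Y) \<diamondop> (codl X \<bowtie> \<I> X \<bowtie> \<I> Y) = \<I> (X \<otimes>\<^sub>o Y)"
    using tensor_comp[of "codl X \<bowtie> \<I> X" "\<I> X \<bowtie> dl X" "\<I> Y" "\<I> Y"] by (simp add: snake_dl)
  finally show ?thesis by simp
qed

text \<open>\<open>Phi X A\<close> does for \<open>X \<otimes> R A\<close> what composing with the
  counit does for \<open>R A\<close>. Equal values give equal transposes by
  \<open>eps_transpose\<close> and \<open>eps_inject\<close>, and transposing is reversible.\<close>

lemma Phi_inject:
  assumes "\<And>m. m \<in> Ob M \<Longrightarrow> Phi X A u m = Phi X A w m" "A \<in> Ob EndV" "X \<in> Ob C"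
    "is_ar C u" "is_ar C w" "tgt u = X \<otimes>\<^sub>o R A" "tgt w = X \<otimes>\<^sub>o R A" "src u = src w"
  shows "u = w"
proof -
  let ?t = "\<lambda>u. (dl X \<bowtie> \<I> (R A)) \<diamondop> (\<I> (dual C X) \<bowtie> u)"
  have "?t u = ?t w"
  proof (rule eps_inject[of A])
    fix m assume "m \<in> Ob M"
    then show "eps A m \<bullet> (?t u \<star> \<J> m) = eps A m \<bullet> (?t w \<star> \<J> m)"
      using assms by (simp add: eps_transpose)
  qed (use assms in simp_all)
  then have t: "(\<I> X \<bowtie> ?t u) \<diamondop> (codl X \<bowtie> \<I> (src u)) = (\<I> X \<bowtie> ?t w) \<diamondop> (codl X \<bowtie> \<I> (src w))"
    by (simp only: assms(8))
  show ?thesis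
    using t unfolding transpose_back[OF assms(3) R_ob[OF assms(2)] assms(4,6)]
      transpose_back[OF assms(3) R_ob[OF assms(2)] assms(5,7)] .
qed

text \<open>Compatibility with V survives transposition: \<open>sw_tensor\<close> splits the
  exchange with \<open>dual C X \<otimes> Y\<close>, the hypothesis on \<open>t\<close> trades the
  exchange with \<open>Y\<close> for one with \<open>X\<close>, and the exchanges with
  \<open>X\<close> and its dual disappear under the evaluation by \<open>evact_sw\<close>.\<close>

lemma vtrans_transpose:
  assumes t: "vtrans (rhoV Y) (lact X A) t" and Y: "Y \<in> Ob C" and X: "X \<in> Ob C" and A: "A \<in> Ob EndV"
  shows "vtrans (rhoV (dual C X \<otimes>\<^sub>o Y)) A
    (\<lambda>m. evC X (fob (fst A) m) \<bullet> (\<I> (dual C X) \<star> t m) \<bullet> ass (dual C X) Y m)"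
  unfolding vtrans_def
proof (intro conjI ballI allI impI)
  note [simp] = Y X A vtransD(1-3)[OF t]
  let ?D = "dual C X"
  fix f assume [simp]: "is_ar M f"
  have "(evC X (fob (fst A) (tgt f)) \<bullet> (\<I> ?D \<star> t (tgt f)) \<bullet> ass ?D Y (tgt f)) \<bullet>
      map_ar (fst (rhoV (?D \<otimes>\<^sub>o Y))) f
    = evC X (fob (fst A) (tgt f)) \<bullet> (\<I> ?D \<star> (t (tgt f) \<bullet> (\<I> Y \<star> f))) \<bullet> ass ?D Y (src f)"
    using ass_natural[of "\<I> ?D" "\<I> Y" f] by (simp add: act_comp_extend)
  also have "t (tgt f) \<bullet> (\<I> Y \<star> f) = (\<I> X \<star> map_ar (fst A) f) \<bullet> t (src f)"
    using vtransD(4)[OF t, of f] by simp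
  also have "evC X (fob (fst A) (tgt f)) \<bullet> (\<I> ?D \<star> ((\<I> X \<star> map_ar (fst A) f) \<bullet> t (src f))) \<bullet>
      ass ?D Y (src f)
    = (evC X (fob (fst A) (tgt f)) \<bullet> (\<I> ?D \<star> \<I> X \<star> map_ar (fst A) f)) \<bullet>
      (\<I> ?D \<star> t (src f)) \<bullet> ass ?D Y (src f)"
    by (simp add: act_comp_extend)
  also have "evC X (fob (fst A) (tgt f)) \<bullet> (\<I> ?D \<star> \<I> X \<star> map_ar (fst A) f)
      = map_ar (fst A) f \<bullet> evC X (fob (fst A) (src f))"
    using evact_natural[of "map_ar (fst A) f" ?D X "dl X"] by simp
  finally show "(evC X (fob (fst A) (tgt f)) \<bullet> (\<I> ?D \<star> t (tgt f)) \<bullet> ass ?D Y (tgt f)) \<bullet>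
      map_ar (fst (rhoV (?D \<otimes>\<^sub>o Y))) f
    = map_ar (fst A) f \<bullet> evC X (fob (fst A) (src f)) \<bullet> (\<I> ?D \<star> t (src f)) \<bullet> ass ?D Y (src f)"
    by simp
next
  note [simp] = Y X A vtransD(1-3)[OF t]
  let ?D = "dual C X"
  fix v m assume [simp]: "v \<in> Ob V" "m \<in> Ob M"
  let ?z = "fob G v" and ?Z = "gob v" and ?n = "fob (fst A) m"
  have "(\<I> ?Z \<star> (evC X ?n \<bullet> (\<I> ?D \<star> t m) \<bullet> ass ?D Y m)) \<bullet> str (rhoV (?D \<otimes>\<^sub>o Y)) v m
    = (\<I> ?Z \<star> evC X ?n) \<bullet> (\<I> ?Z \<star> \<I> ?D \<star> t m) \<bullet> (\<I> ?Z \<star> ass ?D Y m) \<bullet> sw ?z (?D \<otimes>\<^sub>o Y) m"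
    by (simp add: act_comp_extend)
  also have "\<dots> = (\<I> ?Z \<star> evC X ?n) \<bullet> ((\<I> ?Z \<star> \<I> ?D \<star> t m) \<bullet> sw ?z ?D (Y \<diamond> m)) \<bullet>
      (\<I> ?D \<star> sw ?z Y m) \<bullet> ass ?D Y (?Z \<diamond> m)"
    by (simp add: sw_tensor)
  also have "(\<I> ?Z \<star> \<I> ?D \<star> t m) \<bullet> sw ?z ?D (Y \<diamond> m)
      = sw ?z ?D (X \<diamond> ?n) \<bullet> (\<I> ?D \<star> \<I> ?Z \<star> t m)"
    using sw_natural[OF central_id, of ?z "\<I> ?D" "t m"] by simp
  also have "(\<I> ?Z \<star> evC X ?n) \<bullet> (sw ?z ?D (X \<diamond> ?n) \<bullet> (\<I> ?D \<star> \<I> ?Z \<star> t m)) \<bullet>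
      (\<I> ?D \<star> sw ?z Y m) \<bullet> ass ?D Y (?Z \<diamond> m)
    = (\<I> ?Z \<star> evC X ?n) \<bullet> sw ?z ?D (X \<diamond> ?n) \<bullet>
      (\<I> ?D \<star> ((\<I> ?Z \<star> t m) \<bullet> sw ?z Y m)) \<bullet> ass ?D Y (?Z \<diamond> m)"
    by (simp add: act_comp_extend)
  also have "(\<I> ?Z \<star> t m) \<bullet> sw ?z Y m = sw ?z X ?n \<bullet> (\<I> X \<star> str A v m) \<bullet> t (?Z \<diamond> m)"
    using vtransD(5)[OF t, of v m] by simp
  also have "(\<I> ?Z \<star> evC X ?n) \<bullet> sw ?z ?D (X \<diamond> ?n) \<bullet>
      (\<I> ?D \<star> (sw ?z X ?n \<bullet> (\<I> X \<star> str A v m) \<bullet> t (?Z \<diamond> m))) \<bullet> ass ?D Y (?Z \<diamond> m)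
    = ((\<I> ?Z \<star> evC X ?n) \<bullet> sw ?z ?D (X \<diamond> ?n) \<bullet> (\<I> ?D \<star> sw ?z X ?n)) \<bullet>
      (\<I> ?D \<star> \<I> X \<star> str A v m) \<bullet> (\<I> ?D \<star> t (?Z \<diamond> m)) \<bullet> ass ?D Y (?Z \<diamond> m)"
    by (simp add: act_comp_extend)
  also have "(\<I> ?Z \<star> evC X ?n) \<bullet> sw ?z ?D (X \<diamond> ?n) \<bullet> (\<I> ?D \<star> sw ?z X ?n) = evC X (?Z \<diamond> ?n)"
    by (rule evact_sw) simp_all
  also have "evC X (?Z \<diamond> ?n) \<bullet> (\<I> ?D \<star> \<I> X \<star> str A v m) \<bullet> (\<I> ?D \<star> t (?Z \<diamond> m)) \<bullet>
      ass ?D Y (?Z \<diamond> m)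
    = str A v m \<bullet> evC X (fob (fst A) (?Z \<diamond> m)) \<bullet> (\<I> ?D \<star> t (?Z \<diamond> m)) \<bullet> ass ?D Y (?Z \<diamond> m)"
    using M.comp_ar_extend[OF evact_natural[of "str A v m" ?D X "dl X"],
        of "(\<I> ?D \<star> t (?Z \<diamond> m)) \<bullet> ass ?D Y (?Z \<diamond> m)"] by simp
  finally show "str A v m \<bullet> evC X (fob (fst A) (?Z \<diamond> m)) \<bullet> (\<I> ?D \<star> t (?Z \<diamond> m)) \<bullet>
      ass ?D Y (?Z \<diamond> m)
    = (\<I> ?Z \<star> (evC X ?n \<bullet> (\<I> ?D \<star> t m) \<bullet> ass ?D Y m)) \<bullet> str (rhoV (?D \<otimes>\<^sub>o Y)) v m" ..
qed (use X Y A vtransD(1-3)[OF t] in simp_all)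

text \<open>The transposed family lifts along the counit to an arrow into \<open>R A\<close>, and
  transposing that back along the coevaluation gives \<open>u\<close>. The snake identity, acting on
  \<open>M\<close>, returns \<open>t\<close>.\<close>

lemma Phi_surj:
  assumes t: "vtrans (rhoV Y) (lact X A) t" and Y: "Y \<in> Ob C" and X: "X \<in> Ob C" and A: "A \<in> Ob EndV"
  obtains u where "is_ar C u" "src u = Y" "tgt u = X \<otimes>\<^sub>o R A" "\<And>m. m \<in> Ob M \<Longrightarrow> Phi X A u m = t m"
proof -
  note [simp] = Y X A
  let ?D = "dual C X"
  obtain w' where "w' \<in> Hom C (?D \<otimes>\<^sub>o Y) (R A)"
    "\<And>m. m \<in> Ob M \<Longrightarrow> eps A m \<bullet> (Ar (?D \<otimes>\<^sub>o Y) w' (R A) \<star> \<J> m)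
      = evC X (fob (fst A) m) \<bullet> (\<I> ?D \<star> t m) \<bullet> ass ?D Y m"
    using lift_exists[OF A _ vtrans_transpose[OF assms]] by auto
  then obtain w where w [simp]: "is_ar C w" "src w = ?D \<otimes>\<^sub>o Y" "tgt w = R A"
    and eps: "\<And>m. m \<in> Ob M \<Longrightarrow> eps A m \<bullet> (w \<star> \<J> m)
      = evC X (fob (fst A) m) \<bullet> (\<I> ?D \<star> t m) \<bullet> ass ?D Y m"
    by (metis Y X A R_ob ar.sel(1,3) dual_ob is_ar_Ar ob_closed(2))
  let ?u = "(\<I> X \<bowtie> w) \<diamondop> (codl X \<bowtie> \<I> Y)"
  have "Phi X A ?u m = t m" if m [simp]: "m \<in> Ob M" for m
  proof -
    note [simp] = vtransD(1-3)[OF t m]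
    let ?n = "fob (fst A) m" and ?c = "(codl X \<bowtie> \<I> Y) \<star> \<J> m"
    have "Phi X A ?u m = (\<I> X \<star> eps A m) \<bullet> ass X (R A) m \<bullet> ((\<I> X \<bowtie> w) \<star> \<J> m) \<bullet> ?c"
      by (simp add: Phi_def act_comp)
    also have "\<dots> = (\<I> X \<star> (eps A m \<bullet> (w \<star> \<J> m))) \<bullet> ass X (?D \<otimes>\<^sub>o Y) m \<bullet> ?c"
      by (simp add: ass_natural' act_comp_extend)
    also have "\<dots> = (\<I> X \<star> (evC X ?n \<bullet> (\<I> ?D \<star> t m))) \<bullet> (\<I> X \<star> ass ?D Y m) \<bullet>
        ass X (?D \<otimes>\<^sub>o Y) m \<bullet> ?c"
      by (simp add: eps act_comp_extend)
    also have "\<dots> = (\<I> X \<star> (evC X ?n \<bullet> (\<I> ?D \<star> t m))) \<bullet> ass X ?D (Y \<diamond> m) \<bullet>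
        ass (X \<otimes>\<^sub>o ?D) Y m \<bullet> ?c"
      by (simp add: pentagon')
    also have "\<dots> = (\<I> X \<star> (evC X ?n \<bullet> (\<I> ?D \<star> t m))) \<bullet> ass X ?D (Y \<diamond> m) \<bullet>
        (codl X \<star> \<J> (Y \<diamond> m)) \<bullet> ass \<one>\<^sub>o Y m"
      using ass_natural[of "codl X" "\<I> Y" "\<J> m"] by simp
    also have "\<dots> = (\<I> X \<star> (evC X ?n \<bullet> (\<I> ?D \<star> t m))) \<bullet> coevact X ?D (codl X) (Y \<diamond> m)"
      by (simp add: coevact_def inv_uni_act)
    also have "\<dots> = (\<I> X \<star> evC X ?n) \<bullet> (\<I> X \<star> \<I> ?D \<star> t m) \<bullet> coevact X ?D (codl X) (Y \<diamond> m)"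
      by (simp add: act_comp_extend)
    also have "\<dots> = (\<I> X \<star> evC X ?n) \<bullet> coevact X ?D (codl X) (X \<diamond> ?n) \<bullet> t m"
      using coevact_natural[of "t m" ?D X "codl X"] by simp
    also have "\<dots> = t m"
      using M.comp_ar_extend[OF snake_act[of ?D X ?n "dl X" "codl X"], of "t m"] by (simp add: snake_dl)
    finally show ?thesis .
  qed
  then show ?thesis by (intro that[of ?u]) simp_all
qed

text \<open>The inverse is the preimage under \<open>Phi X A\<close> of the counit at
  \<open>lact X A\<close>. One composite is the identity by uniqueness of arrows into
  \<open>R (lact X A)\<close>, the other by uniqueness of arrows into
  \<open>X \<otimes> R A\<close>.\<close>

lemma iso_linv:
  assumes "A \<in> Ob EndV" "X \<in> Ob C"
  shows "iso_ar C (linv X A)"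
proof -
  note [simp] = assms linv(1)[OF assms]
  have eq: "eps (lact X A) m \<bullet> (linv X A \<star> \<J> m) \<bullet> (u \<star> \<J> m) = Phi X A u m"
    if "is_ar C u" "tgt u = X \<otimes>\<^sub>o R A" "m \<in> Ob M" for u m
    using M.comp_ar_extend[OF linv(2)[OF assms], of m "u \<star> \<J> m"] that by (simp add: Phi_def)
  obtain u where u [simp]: "is_ar C u" "src u = R (lact X A)" "tgt u = X \<otimes>\<^sub>o R A"
    and Phi: "\<And>m. m \<in> Ob M \<Longrightarrow> Phi X A u m = eps (lact X A) m"
    by (rule Phi_surj[OF vtrans_eps]) (use assms in auto)
  have 1: "linv X A \<diamondop> u = \<I> (R (lact X A))"
    by (rule eps_inject[of "lact X A"]) (use eq[of u] Phi in \<open>simp_all add: act_comp\<close>)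
  have 2: "u \<diamondop> linv X A = \<I> (X \<otimes>\<^sub>o R A)"
  proof (rule Phi_inject)
    fix m assume [simp]: "m \<in> Ob M"
    have "Phi X A (u \<diamondop> linv X A) m = Phi X A u m \<bullet> (linv X A \<star> \<J> m)"
      by (simp add: Phi_def act_comp)
    also have "\<dots> = Phi X A (\<I> (X \<otimes>\<^sub>o R A)) m"
      using linv(2)[OF assms, of m] by (simp add: Phi) (simp add: Phi_def)
    finally show "Phi X A (u \<diamondop> linv X A) m = \<dots>" .
  qed simp_all
  show ?thesis
    by (rule C.iso_arI(1)[of _ u]) (simp_all add: 1 2)
qed

end

section \<open>The half-braiding of the relative end\<close>

context action_setting
begin

text \<open>The inverse of \<open>s X\<close> is \<open>s D\<close> rotated along the duality of \<open>X\<close> and \<open>D\<close>. Hence \<open>r_inv\<close> need not be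
  shown to be invertible.\<close>

lemma half_braiding_iso:
  assumes E: "E \<in> Ob C" and X: "X \<in> Ob C" and D: "D \<in> Ob C" "is_left_dual C D X e0 b0"
    and s: "\<And>X. X \<in> Ob C \<Longrightarrow> is_ar C (s X)" "\<And>X. src (s X) = E \<otimes>\<^sub>o X" "\<And>X. tgt (s X) = X \<otimes>\<^sub>o E"
    and nat: "\<And>f. is_ar C f \<Longrightarrow> (f \<bowtie> \<I> E) \<diamondop> s (src f) = s (tgt f) \<diamondop> (\<I> E \<bowtie> f)"
    and tensor: "\<And>X Y. \<lbrakk>X \<in> Ob C; Y \<in> Ob C\<rbrakk> \<Longrightarrow>
      s (X \<otimes>\<^sub>o Y) = (\<I> X \<bowtie> s Y) \<diamondop> (s X \<bowtie> \<I> Y)"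
    and unit: "s \<one>\<^sub>o = \<I> E"
  shows "iso_ar C (s X)"
proof -
  note [simp] = E X D(1) s
  define e where "e = Ar (X \<otimes>\<^sub>o D) e0 \<one>\<^sub>o"
  define b where "b = Ar \<one>\<^sub>o b0 (D \<otimes>\<^sub>o X)"
  have [simp]: "is_ar C e" "src e = X \<otimes>\<^sub>o D" "tgt e = \<one>\<^sub>o" "is_ar C b" "src b = \<one>\<^sub>o" "tgt b = D \<otimes>\<^sub>o X"
    using D by (simp_all add: e_def b_def is_left_dual_def)
  have snake: "(e \<bowtie> \<I> X) \<diamondop> (\<I> X \<bowtie> b) = \<I> X"
    using D(2) by (simp add: e_def b_def is_left_dual_def comp_ar_def tensor_ar_def id_ar_def)
  \<comment> \<open>The candidate inverse \<open>?e \<diamondop> ?s \<diamondop> ?b\<close> runs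
    from \<open>X \<otimes> E\<close> through \<open>X \<otimes> E \<otimes> D \<otimes> X\<close>
    and \<open>X \<otimes> D \<otimes> E \<otimes> X\<close> to
    \<open>E \<otimes> X\<close>.\<close>
  let ?e = "e \<bowtie> \<I> (E \<otimes>\<^sub>o X)" and ?s = "\<I> X \<bowtie> s D \<bowtie> \<I> X" and ?b = "\<I> (X \<otimes>\<^sub>o E) \<bowtie> b"
  \<comment> \<open>Naturality along evaluation and coevaluation, with the unit condition, lets the
    cup and the cap slide past \<open>E\<close>. Together with multiplicativity this makes
    \<open>s D\<close> and \<open>s X\<close> cancel on either side.\<close>
  have n1: "(e \<bowtie> \<I> E) \<diamondop> s (X \<otimes>\<^sub>o D) = \<I> E \<bowtie> e"
    using nat[of e] by (simp add: unit)
  have n2: "s (D \<otimes>\<^sub>o X) \<diamondop> (\<I> E \<bowtie> b) = b \<bowtie> \<I> E"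
    using nat[of b] by (simp add: unit)
  have 1: "?b \<diamondop> s X = (s X \<bowtie> \<I> (D \<otimes>\<^sub>o X)) \<diamondop> (\<I> (E \<otimes>\<^sub>o X) \<bowtie> b)"
    using tensor_comp[of "s X" "\<I> (X \<otimes>\<^sub>o E)" "\<I> \<one>\<^sub>o" b] by (simp add: tensor_comp)
  have 2: "?s \<diamondop> (s X \<bowtie> \<I> (D \<otimes>\<^sub>o X)) = s (X \<otimes>\<^sub>o D) \<bowtie> \<I> X"
    using tensor_comp[of "s X \<bowtie> \<I> D" "\<I> X \<bowtie> s D" "\<I> X" "\<I> X"] by (simp add: tensor)
  have 3: "?e \<diamondop> (s (X \<otimes>\<^sub>o D) \<bowtie> \<I> X) = \<I> E \<bowtie> e \<bowtie> \<I> X"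
    using tensor_comp[of "s (X \<otimes>\<^sub>o D)" "e \<bowtie> \<I> E" "\<I> X" "\<I> X"] by (simp add: n1)
  have 4: "(\<I> E \<bowtie> e \<bowtie> \<I> X) \<diamondop> (\<I> (E \<otimes>\<^sub>o X) \<bowtie> b) = \<I> (E \<otimes>\<^sub>o X)"
    using tensor_comp[of "\<I> E" "\<I> E" "\<I> X \<bowtie> b" "e \<bowtie> \<I> X"]
    by (simp add: snake flip: tensor_strict(1))
  have "(?e \<diamondop> ?s \<diamondop> ?b) \<diamondop> s X = ?e \<diamondop> (?s \<diamondop> (s X \<bowtie> \<I> (D \<otimes>\<^sub>o X))) \<diamondop> (\<I> (E \<otimes>\<^sub>o X) \<bowtie> b)"
    by (simp add: 1)
  also have "\<dots> = (?e \<diamondop> (s (X \<otimes>\<^sub>o D) \<bowtie> \<I> X)) \<diamondop> (\<I> (E \<otimes>\<^sub>o X) \<bowtie> b)"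
    unfolding 2 by simp
  also have "\<dots> = \<I> (E \<otimes>\<^sub>o X)"
    unfolding 3 4 ..
  finally have l: "(?e \<diamondop> ?s \<diamondop> ?b) \<diamondop> s X = \<I> (E \<otimes>\<^sub>o X)" .
  have 5: "s X \<diamondop> ?e = (e \<bowtie> \<I> (X \<otimes>\<^sub>o E)) \<diamondop> (\<I> (X \<otimes>\<^sub>o D) \<bowtie> s X)"
    using tensor_comp[of e "\<I> \<one>\<^sub>o" "\<I> (E \<otimes>\<^sub>o X)" "s X"] by (simp add: tensor_comp)
  have 6: "(\<I> (X \<otimes>\<^sub>o D) \<bowtie> s X) \<diamondop> ?s = \<I> X \<bowtie> s (D \<otimes>\<^sub>o X)"
    using tensor_comp[of "\<I> X" "\<I> X" "s D \<bowtie> \<I> X" "\<I> D \<bowtie> s X"]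
    by (simp add: tensor flip: tensor_id)
  have 7: "(\<I> X \<bowtie> s (D \<otimes>\<^sub>o X)) \<diamondop> ?b = \<I> X \<bowtie> b \<bowtie> \<I> E"
    using tensor_comp[of "\<I> X" "\<I> X" "\<I> E \<bowtie> b" "s (D \<otimes>\<^sub>o X)"]
    by (simp add: n2 flip: tensor_id)
  have 8: "(e \<bowtie> \<I> (X \<otimes>\<^sub>o E)) \<diamondop> (\<I> X \<bowtie> b \<bowtie> \<I> E) = \<I> (X \<otimes>\<^sub>o E)"
    using tensor_comp[of "\<I> X \<bowtie> b" "e \<bowtie> \<I> X" "\<I> E" "\<I> E"] by (simp add: snake)
  have "s X \<diamondop> ?e \<diamondop> ?s \<diamondop> ?b = (s X \<diamondop> ?e) \<diamondop> ?s \<diamondop> ?b"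
    by simp
  also have "\<dots> = (e \<bowtie> \<I> (X \<otimes>\<^sub>o E)) \<diamondop> ((\<I> (X \<otimes>\<^sub>o D) \<bowtie> s X) \<diamondop> ?s) \<diamondop> ?b"
    unfolding 5 by simp
  also have "\<dots> = \<I> (X \<otimes>\<^sub>o E)"
    unfolding 6 7 8 ..
  finally have r: "s X \<diamondop> ?e \<diamondop> ?s \<diamondop> ?b = \<I> (X \<otimes>\<^sub>o E)" .
  show ?thesis
    by (rule C.iso_arI(1)[of _ "?e \<diamondop> ?s \<diamondop> ?b"]) (use l r in simp_all)
qed

section \<open>Structure arrows of C-module functors\<close>

definition cstr where
  "cstr F c X m = Ar (fob F (X \<diamond> m)) (c X m) (X \<diamond> fob F m)"

lemma src_tgt_cstr [simp]:
  "src (cstr F c X m) = fob F (X \<diamond> m)" "tgt (cstr F c X m) = X \<diamond> fob F m"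
  by (simp_all add: cstr_def)

lemma module_functor_is_functor: "module_functor C M a F c \<Longrightarrow> is_functor M M F"
  by (simp add: module_functor_def right_exact_def linear_functor_def)

lemma cstr:
  assumes "module_functor C M a F c"
  shows "\<lbrakk>X \<in> Ob C; m \<in> Ob M\<rbrakk> \<Longrightarrow> iso_ar M (cstr F c X m)"
    and "\<lbrakk>is_ar C g; is_ar M f\<rbrakk> \<Longrightarrow>
      cstr F c (tgt g) (tgt f) \<bullet> map_ar F (g \<star> f) = (g \<star> map_ar F f) \<bullet> cstr F c (src g) (src f)"
    and "\<lbrakk>X \<in> Ob C; Y \<in> Ob C; m \<in> Ob M\<rbrakk> \<Longrightarrow>
      ass X Y (fob F m) \<bullet> cstr F c (X \<otimes>\<^sub>o Y) m
        = (\<I> X \<star> cstr F c Y m) \<bullet> cstr F c X (Y \<diamond> m) \<bullet> map_ar F (ass X Y m)"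
    and "m \<in> Ob M \<Longrightarrow> uni (fob F m) \<bullet> cstr F c \<one>\<^sub>o m = map_ar F (uni m)"
proof -
  note F = module_functor_is_functor[OF assms]
  have ob: "fob F m \<in> Ob M" if "m \<in> Ob M" for m
    using is_functor_map(1)[OF F that] .
  show iso: "iso_ar M (cstr F c X m)" if "X \<in> Ob C" "m \<in> Ob M" for X m
    using assms that ob[of m] ob[of "X \<diamond> m"] unfolding iso_ar_def module_functor_def
    by (simp add: cstr_def)
  show "cstr F c (tgt g) (tgt f) \<bullet> map_ar F (g \<star> f) = (g \<star> map_ar F f) \<bullet> cstr F c (src g) (src f)"
    if "is_ar C g" "is_ar M f"
    using assms that unfolding is_ar_def module_functor_def
    by (simp add: cstr_def comp_ar_def map_ar_def act_ar_def)
  show "ass X Y (fob F m) \<bullet> cstr F c (X \<otimes>\<^sub>o Y) m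
        = (\<I> X \<star> cstr F c Y m) \<bullet> cstr F c X (Y \<diamond> m) \<bullet> map_ar F (ass X Y m)"
    if [simp]: "X \<in> Ob C" "Y \<in> Ob C" "m \<in> Ob M"
  proof -
    have "ass X Y (fob F m) \<bullet> cstr F c (X \<otimes>\<^sub>o Y) m
        = ((\<I> X \<star> cstr F c Y m) \<bullet> cstr F c X (Y \<diamond> m)) \<bullet> map_ar F (ass X Y m)"
      using assms that unfolding module_functor_def
      by (simp add: cstr_def comp_ar_def map_ar_def act_ar_def id_ar_def ass_def)
    then show ?thesis
      using iso[of Y m] iso[of X "Y \<diamond> m"] is_functor_map(2)[OF F, of "ass X Y m"] by simp
  qed
  show "uni (fob F m) \<bullet> cstr F c \<one>\<^sub>o m = map_ar F (uni m)" if "m \<in> Ob M"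
    using assms that unfolding module_functor_def
    by (simp add: cstr_def comp_ar_def map_ar_def uni_def)
qed

end

context central_setting
begin

text \<open>With \<open>c\<close> in place of \<open>d\<close>, the associativity axiom of
  \<open>(F, c)\<close> reduces the two sides to values of \<open>c\<close> on
  \<open>X \<otimes> G v\<close> and on \<open>G v \<otimes> X\<close>; naturality of
  \<open>c\<close> along the inverse half-braiding of \<open>G v\<close> identifies them.\<close>

lemma braiding_vtrans:
  assumes mf: "module_functor C M a F c" and A: "(F, d) \<in> Ob EndV"
    and cd: "\<And>v m. \<lbrakk>v \<in> Ob V; m \<in> Ob M\<rbrakk> \<Longrightarrow> c (gob v) m = d v m" and X: "X \<in> Ob C"
  shows "vtrans (ract (F, d) X) (lact X (F, d)) (cstr F c X)"
  unfolding vtrans_def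
proof (intro conjI ballI allI impI)
  note F [simp] = module_functor_is_functor[OF mf]
  note [simp] = X A cstr(1)[OF mf]
  fix f assume "is_ar M f"
  then show "cstr F c X (tgt f) \<bullet> map_ar (fst (ract (F, d) X)) f
      = map_ar (fst (lact X (F, d))) f \<bullet> cstr F c X (src f)"
    using cstr(2)[OF mf, of "\<I> X" f] by simp
next
  note F [simp] = module_functor_is_functor[OF mf]
  note [simp] = X A cstr(1)[OF mf]
  fix v m assume v [simp]: "v \<in> Ob V" "m \<in> Ob M"
  let ?z = "fob G v" and ?Z = "gob v"
  \<comment> \<open>The equality of \<open>c\<close> and \<open>d\<close> enters here. It is needed
    at \<open>m\<close> and at \<open>X \<diamond> m\<close>, hence the local quantification over
    objects.\<close>
  have str: "str (F, d) v m = cstr F c ?Z m" if "m \<in> Ob M" for m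
    using cd[OF v(1) that] by (simp add: str_def cstr_def)
  show "str (lact X (F, d)) v m \<bullet> cstr F c X (?Z \<diamond> m) = (\<I> ?Z \<star> cstr F c X m) \<bullet> str (ract (F, d) X) v m"
  proof (rule M.iso_ar_cancel_right[of _ "map_ar F (ass X ?Z m)"])
    have "(str (lact X (F, d)) v m \<bullet> cstr F c X (?Z \<diamond> m)) \<bullet> map_ar F (ass X ?Z m)
        = sw ?z X (fob F m) \<bullet> ass X ?Z (fob F m) \<bullet> cstr F c (X \<otimes>\<^sub>o ?Z) m"
      using cstr(3)[OF mf, of X ?Z m] by (simp add: str)
    also have "\<dots> = ass ?Z X (fob F m) \<bullet> (hb_inv ?z X \<star> \<J> (fob F m)) \<bullet> cstr F c (X \<otimes>\<^sub>o ?Z) m"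
      by (simp add: sw_ass')
    also have "\<dots> = (ass ?Z X (fob F m) \<bullet> cstr F c (?Z \<otimes>\<^sub>o X) m) \<bullet> map_ar F (hb_inv ?z X \<star> \<J> m)"
      using cstr(2)[OF mf, of "hb_inv ?z X" "\<J> m"] by simp
    also have "\<dots> = (\<I> ?Z \<star> cstr F c X m) \<bullet> cstr F c ?Z (X \<diamond> m) \<bullet>
        map_ar F (ass ?Z X m \<bullet> (hb_inv ?z X \<star> \<J> m))"
      using cstr(3)[OF mf, of ?Z X m] by (simp add: map_comp)
    also have "\<dots> = ((\<I> ?Z \<star> cstr F c X m) \<bullet> str (ract (F, d) X) v m) \<bullet> map_ar F (ass X ?Z m)"
      by (simp add: str map_comp sw_ass)
    finally show "(str (lact X (F, d)) v m \<bullet> cstr F c X (?Z \<diamond> m)) \<bullet> map_ar F (ass X ?Z m) = \<dots>" .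
  qed (simp_all add: str)
qed (use X A cstr(1)[OF mf] in simp_all)

end

lemma full_subcategory_simps:
  "Ob (full_subcategory C P) = {A \<in> Ob C. P A}" "Hom (full_subcategory C P) = Hom C"
  "ident (full_subcategory C P) = ident C" "comp_arr (full_subcategory C P) = comp_arr C"
  by (simp_all add: full_subcategory_def)

section \<open>The half-braiding on \<open>R (F, d)\<close>\<close>

context rhobar_setting
begin

abbreviation CVM where "CVM \<equiv> C_VM V C G M a"
abbreviation Zrb where "Zrb \<equiv> Z_rhobar C G M a H phi R p"

lemma fam_cstr:
  "m \<in> Ob M \<Longrightarrow> fam (ract (F, d) X) (restrict (c X) (Ob M)) (lact X (F, d)) m = cstr F c X m"
  by (simp add: fam_def cstr_def)

lemma vtrans_fam_cstr:
  "vtrans A B (fam (ract (F, d) X) (restrict (c X) (Ob M)) (lact X (F, d)))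
    \<longleftrightarrow> vtrans A B (cstr F c X)"
  by (intro vtrans_cong fam_cstr)

lemma CVM_ob_iff:
  "(F, c, d) \<in> Ob CVM \<longleftrightarrow> (F, d) \<in> Ob EndV \<and> module_functor C M a F c \<and>
     (\<forall>X \<in> Ob C. vtrans (ract (F, d) X) (lact X (F, d)) (cstr F c X)) \<and>
     (\<forall>v \<in> Ob V. \<forall>m \<in> Ob M. c (gob v) m = d v m)"
proof -
  have "(ract (F, d) X, restrict (c X) (Ob M), lact X (F, d)) \<in> Hom EndV (ract (F, d) X) (lact X (F, d))
      \<longleftrightarrow> vtrans (ract (F, d) X) (lact X (F, d)) (cstr F c X)"
    if "(F, d) \<in> Ob EndV" "X \<in> Ob C" for X
    unfolding EndV_hom_iff[OF act_EndV_ob(2)[OF that] act_EndV_ob(1)[OF that]]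
    by (simp add: vtrans_fam_cstr)
  then show ?thesis
    unfolding C_VM_def full_subcategory_simps Z_End_def cat.select_convs by auto
qed

lemma CVM_obD:
  assumes "(F, c, d) \<in> Ob CVM"
  shows "(F, d) \<in> Ob EndV" "module_functor C M a F c" "is_functor M M F"
    "X \<in> Ob C \<Longrightarrow> vtrans (ract (F, d) X) (lact X (F, d)) (cstr F c X)"
    "\<lbrakk>v \<in> Ob V; m \<in> Ob M\<rbrakk> \<Longrightarrow> str (F, d) v m = cstr F c (gob v) m"
  using assms module_functor_is_functor[of F c] by (simp_all add: CVM_ob_iff str_def cstr_def)

definition sig where
  "sig F c d X = inv_ar C (linv X (F, d)) \<diamondop>
     rar (ract (F, d) X) (restrict (c X) (Ob M)) (lact X (F, d)) \<diamondop> rinv (F, d) X"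

lemma src_tgt_sig [simp]:
  "src (sig F c d X) = R (F, d) \<otimes>\<^sub>o X" "tgt (sig F c d X) = X \<otimes>\<^sub>o R (F, d)"
  by (simp_all add: sig_def)

lemma Phi_comp:
  assumes "A \<in> Ob EndV" "X \<in> Ob C" "m \<in> Ob M" "is_ar C u" "is_ar C g" "tgt u = X \<otimes>\<^sub>o R A" "tgt g = src u"
  shows "Phi X A (u \<diamondop> g) m = Phi X A u m \<bullet> (g \<star> \<J> m)"
  using assms by (simp add: Phi_def act_comp)

context
  fixes F :: "('mo, 'mm, 'mo, 'mm) fctr" and c :: "'co \<Rightarrow> 'mo \<Rightarrow> 'mm" and d :: "'vo \<Rightarrow> 'mo \<Rightarrow> 'mm"
  assumes Fcd: "(F, c, d) \<in> Ob CVM"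
begin

abbreviation (input) "A0 \<equiv> (F, d)"
abbreviation (input) "E0 \<equiv> R (F, d)"
abbreviation (input) "s0 \<equiv> sig F c d"

lemmas Fcd_simps [simp] = CVM_obD(1,3)[OF Fcd] cstr(1)[OF CVM_obD(2)[OF Fcd]]

lemma is_ar_rar_c:
  assumes "X \<in> Ob C"
  shows "is_ar C (rar (ract A0 X) (restrict (c X) (Ob M)) (lact X A0))"
    "m \<in> Ob M \<Longrightarrow> eps (lact X A0) m \<bullet>
      (rar (ract A0 X) (restrict (c X) (Ob M)) (lact X A0) \<star> \<J> m)
      = cstr F c X m \<bullet> eps (ract A0 X) m"
proof -
  have "vtrans (ract A0 X) (lact X A0) (fam (ract A0 X) (restrict (c X) (Ob M)) (lact X A0))"
    using CVM_obD(4)[OF Fcd assms] by (simp only: vtrans_fam_cstr)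
  note r = rar[OF _ _ this]
  show "is_ar C (rar (ract A0 X) (restrict (c X) (Ob M)) (lact X A0))"
    using assms by (intro r) simp_all
  show "m \<in> Ob M \<Longrightarrow> eps (lact X A0) m \<bullet>
      (rar (ract A0 X) (restrict (c X) (Ob M)) (lact X A0) \<star> \<J> m)
      = cstr F c X m \<bullet> eps (ract A0 X) m"
    using assms r(2)[of m] fam_cstr[of m F d X c] by simp
qed

lemma is_ar_sig [simp]: "X \<in> Ob C \<Longrightarrow> is_ar C (s0 X)"
  using is_ar_rar_c(1)[of X] iso_linv[of A0 X] rinv(1)[of A0 X] by (simp add: sig_def)

text \<open>The first two factors of \<open>Phi X A0\<close> make up the counit at
  \<open>lact X A0\<close> after \<open>linv\<close>, which cancels the inverse of
  \<open>linv\<close> in the half-braiding. The counit then passes through the image of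
  \<open>c X\<close> and through \<open>rinv\<close>, by the equation that characterises
  each.\<close>

lemma Phi_sig:
  assumes "X \<in> Ob C" "m \<in> Ob M"
  shows "Phi X A0 (s0 X) m = cstr F c X m \<bullet> eps A0 (X \<diamond> m) \<bullet> ass E0 X m"
proof -
  let ?r = "rar (ract A0 X) (restrict (c X) (Ob M)) (lact X A0)"
  note [simp] = assms is_ar_rar_c(1)[OF assms(1)] iso_linv[of A0 X] rinv(1)[of A0 X] linv(1)[of A0 X]
  have "Phi X A0 (s0 X) m = ((\<I> X \<star> eps A0 m) \<bullet> ass X E0 m) \<bullet> (s0 X \<star> \<J> m)"
    by (simp add: Phi_def)
  also have "\<dots> = (eps (lact X A0) m \<bullet> (linv X A0 \<star> \<J> m)) \<bullet> (s0 X \<star> \<J> m)"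
    using linv(2)[of A0 X m] by simp
  also have "\<dots> = eps (lact X A0) m \<bullet> ((linv X A0 \<diamondop> s0 X) \<star> \<J> m)"
    by (simp add: act_comp)
  also have "linv X A0 \<diamondop> s0 X = ?r \<diamondop> rinv A0 X"
    by (simp add: sig_def)
  also have "eps (lact X A0) m \<bullet> ((?r \<diamondop> rinv A0 X) \<star> \<J> m)
      = (eps (lact X A0) m \<bullet> (?r \<star> \<J> m)) \<bullet> (rinv A0 X \<star> \<J> m)"
    by (simp add: act_comp)
  also have "\<dots> = cstr F c X m \<bullet> eps (ract A0 X) m \<bullet> (rinv A0 X \<star> \<J> m)"
    unfolding is_ar_rar_c(2)[OF assms] by simp
  also have "\<dots> = cstr F c X m \<bullet> eps A0 (X \<diamond> m) \<bullet> ass E0 X m"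
    using rinv(2)[of A0 X m] by simp
  finally show ?thesis .
qed

text \<open>Naturality of \<open>c\<close> in its first argument, seen through \<open>Phi\<close>;
  naturality of the counit along \<open>f \<star> \<J> m\<close> carries \<open>f\<close> to the
  other side.\<close>

lemma sig_natural:
  assumes "is_ar C f"
  shows "(f \<bowtie> \<I> E0) \<diamondop> s0 (src f) = s0 (tgt f) \<diamondop> (\<I> E0 \<bowtie> f)"
proof (rule Phi_inject[of "tgt f" A0])
  note [simp] = assms
  let ?X = "src f" and ?Y = "tgt f"
  fix m assume m [simp]: "m \<in> Ob M"
  have "Phi ?Y A0 ((f \<bowtie> \<I> E0) \<diamondop> s0 ?X) m
    = (\<I> ?Y \<star> eps A0 m) \<bullet> ass ?Y E0 m \<bullet> ((f \<bowtie> \<I> E0) \<star> \<J> m) \<bullet> (s0 ?X \<star> \<J> m)"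
    by (simp add: Phi_def act_comp)
  also have "\<dots> = (f \<star> eps A0 m) \<bullet> ass ?X E0 m \<bullet> (s0 ?X \<star> \<J> m)"
    by (simp add: ass_natural' act_comp_extend)
  also have "\<dots> = (f \<star> \<J> (fob F m)) \<bullet> Phi ?X A0 (s0 ?X) m"
    by (simp add: Phi_def act_comp_extend)
  also have "\<dots> = ((f \<star> \<J> (fob F m)) \<bullet> cstr F c ?X m) \<bullet> eps A0 (?X \<diamond> m) \<bullet> ass E0 ?X m"
    by (simp add: Phi_sig)
  also have "(f \<star> \<J> (fob F m)) \<bullet> cstr F c ?X m = cstr F c ?Y m \<bullet> map_ar F (f \<star> \<J> m)"
    using cstr(2)[OF CVM_obD(2)[OF Fcd], of f "\<J> m"] by simp
  also have "(cstr F c ?Y m \<bullet> map_ar F (f \<star> \<J> m)) \<bullet> eps A0 (?X \<diamond> m) \<bullet> ass E0 ?X m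
      = cstr F c ?Y m \<bullet> eps A0 (?Y \<diamond> m) \<bullet> (\<I> E0 \<star> f \<star> \<J> m) \<bullet> ass E0 ?X m"
    using M.comp_ar_extend[OF eps_natural[of A0 "f \<star> \<J> m"], of "ass E0 ?X m"] by simp
  also have "\<dots> = Phi ?Y A0 (s0 ?Y) m \<bullet> ((\<I> E0 \<bowtie> f) \<star> \<J> m)"
    by (simp add: Phi_sig ass_natural)
  also have "\<dots> = Phi ?Y A0 (s0 ?Y \<diamondop> (\<I> E0 \<bowtie> f)) m"
    by (simp add: Phi_comp)
  finally show "Phi ?Y A0 ((f \<bowtie> \<I> E0) \<diamondop> s0 ?X) m = \<dots>" .
qed (use assms in simp_all)

lemma sig_unit: "s0 \<one>\<^sub>o = \<I> E0"
proof (rule Phi_inject[of "\<one>\<^sub>o" A0])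
  fix m assume [simp]: "m \<in> Ob M"
  show "Phi \<one>\<^sub>o A0 (s0 \<one>\<^sub>o) m = Phi \<one>\<^sub>o A0 (\<I> E0) m"
  proof (rule M.iso_ar_cancel_left[of "uni (fob F m)"])
    have "uni (fob F m) \<bullet> Phi \<one>\<^sub>o A0 (s0 \<one>\<^sub>o) m
      = (uni (fob F m) \<bullet> cstr F c \<one>\<^sub>o m) \<bullet> eps A0 (\<one>\<^sub>o \<diamond> m) \<bullet> ass E0 \<one>\<^sub>o m"
      by (simp add: Phi_sig)
    also have "\<dots> = map_ar F (uni m) \<bullet> eps A0 (\<one>\<^sub>o \<diamond> m) \<bullet> ass E0 \<one>\<^sub>o m"
      by (simp only: cstr(4)[OF CVM_obD(2)[OF Fcd] \<open>m \<in> Ob M\<close>])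
    also have "\<dots> = eps A0 m \<bullet> (\<I> E0 \<star> uni m) \<bullet> ass E0 \<one>\<^sub>o m"
      using M.comp_ar_extend[OF eps_natural[of A0 "uni m"], of "ass E0 \<one>\<^sub>o m"] by simp
    also have "\<dots> = eps A0 m \<bullet> uni (E0 \<diamond> m) \<bullet> ass \<one>\<^sub>o E0 m"
      by (simp add: triangle triangle_left)
    also have "\<dots> = uni (fob F m) \<bullet> (\<I> \<one>\<^sub>o \<star> eps A0 m) \<bullet> ass \<one>\<^sub>o E0 m"
      using M.comp_ar_extend[OF uni_natural[of "eps A0 m"], of "ass \<one>\<^sub>o E0 m"] by simp
    also have "\<dots> = uni (fob F m) \<bullet> Phi \<one>\<^sub>o A0 (\<I> E0) m"
      by (simp add: Phi_def)
    finally show "uni (fob F m) \<bullet> Phi \<one>\<^sub>o A0 (s0 \<one>\<^sub>o) m = \<dots>" .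
  qed simp_all
qed simp_all

text \<open>Both sides are brought to \<open>(\<I> X \<star> cstr F c Y m) \<bullet> Phi X A0 (s0 X)
  (Y \<diamond> m)\<close> up to an associator: the left one by the associativity axiom of
  \<open>(F, c)\<close>, the right one by evaluating \<open>Phi\<close> at \<open>s0 Y\<close> under
  the action of \<open>X\<close>.\<close>

lemma sig_tensor:
  assumes "X \<in> Ob C" "Y \<in> Ob C"
  shows "s0 (X \<otimes>\<^sub>o Y) = (\<I> X \<bowtie> s0 Y) \<diamondop> (s0 X \<bowtie> \<I> Y)"
proof (rule Phi_inject[of "X \<otimes>\<^sub>o Y" A0])
  note [simp] = assms
  fix m assume m [simp]: "m \<in> Ob M"
  let ?n = "fob F m" and ?s = "(s0 X \<bowtie> \<I> Y) \<star> \<J> m"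
  show "Phi (X \<otimes>\<^sub>o Y) A0 (s0 (X \<otimes>\<^sub>o Y)) m = Phi (X \<otimes>\<^sub>o Y) A0 ((\<I> X \<bowtie> s0 Y) \<diamondop> (s0 X \<bowtie> \<I> Y)) m"
  proof (rule M.iso_ar_cancel_left[of "ass X Y ?n"])
    have "ass X Y ?n \<bullet> Phi (X \<otimes>\<^sub>o Y) A0 (s0 (X \<otimes>\<^sub>o Y)) m
      = (ass X Y ?n \<bullet> cstr F c (X \<otimes>\<^sub>o Y) m) \<bullet> eps A0 ((X \<otimes>\<^sub>o Y) \<diamond> m) \<bullet> ass E0 (X \<otimes>\<^sub>o Y) m"
      by (simp add: Phi_sig)
    also have "\<dots> = (\<I> X \<star> cstr F c Y m) \<bullet> cstr F c X (Y \<diamond> m) \<bullet> map_ar F (ass X Y m) \<bullet>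
        eps A0 ((X \<otimes>\<^sub>o Y) \<diamond> m) \<bullet> ass E0 (X \<otimes>\<^sub>o Y) m"
      using cstr(3)[OF CVM_obD(2)[OF Fcd], of X Y m] by simp
    also have "\<dots> = (\<I> X \<star> cstr F c Y m) \<bullet> cstr F c X (Y \<diamond> m) \<bullet> eps A0 (X \<diamond> Y \<diamond> m) \<bullet>
        (\<I> E0 \<star> ass X Y m) \<bullet> ass E0 (X \<otimes>\<^sub>o Y) m"
      using M.comp_ar_extend[OF eps_natural[of A0 "ass X Y m"], of "ass E0 (X \<otimes>\<^sub>o Y) m"] by simp
    also have "\<dots> = (\<I> X \<star> cstr F c Y m) \<bullet> (cstr F c X (Y \<diamond> m) \<bullet> eps A0 (X \<diamond> Y \<diamond> m) \<bullet>
        ass E0 X (Y \<diamond> m)) \<bullet> ass (E0 \<otimes>\<^sub>o X) Y m"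
      by (simp add: pentagon)
    also have "\<dots> = (\<I> X \<star> cstr F c Y m) \<bullet> Phi X A0 (s0 X) (Y \<diamond> m) \<bullet> ass (E0 \<otimes>\<^sub>o X) Y m"
      by (simp add: Phi_sig)
    finally have l: "ass X Y ?n \<bullet> Phi (X \<otimes>\<^sub>o Y) A0 (s0 (X \<otimes>\<^sub>o Y)) m = \<dots>" .
    have "ass X Y ?n \<bullet> Phi (X \<otimes>\<^sub>o Y) A0 ((\<I> X \<bowtie> s0 Y) \<diamondop> (s0 X \<bowtie> \<I> Y)) m
      = ass X Y ?n \<bullet> (\<I> (X \<otimes>\<^sub>o Y) \<star> eps A0 m) \<bullet> ass (X \<otimes>\<^sub>o Y) E0 m \<bullet>
        ((\<I> X \<bowtie> s0 Y) \<star> \<J> m) \<bullet> ?s"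
      by (simp add: Phi_def act_comp)
    also have "\<dots> = (\<I> X \<star> \<I> Y \<star> eps A0 m) \<bullet> ass X Y (E0 \<diamond> m) \<bullet> ass (X \<otimes>\<^sub>o Y) E0 m \<bullet>
        ((\<I> X \<bowtie> s0 Y) \<star> \<J> m) \<bullet> ?s"
      using ass_natural'[of "\<I> X" "\<I> Y" "eps A0 m" X Y ?n
          "ass (X \<otimes>\<^sub>o Y) E0 m \<bullet> ((\<I> X \<bowtie> s0 Y) \<star> \<J> m) \<bullet> ?s"] by simp
    also have "\<dots> = (\<I> X \<star> \<I> Y \<star> eps A0 m) \<bullet> (\<I> X \<star> ass Y E0 m) \<bullet> ass X (Y \<otimes>\<^sub>o E0) m \<bullet>
        ((\<I> X \<bowtie> s0 Y) \<star> \<J> m) \<bullet> ?s"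
      by (simp add: pentagon')
    also have "\<dots> = (\<I> X \<star> Phi Y A0 (s0 Y) m) \<bullet> ass X (E0 \<otimes>\<^sub>o Y) m \<bullet> ?s"
      by (simp add: ass_natural' act_comp_extend Phi_def)
    also have "\<dots> = (\<I> X \<star> (cstr F c Y m \<bullet> eps A0 (Y \<diamond> m))) \<bullet> (\<I> X \<star> ass E0 Y m) \<bullet>
        ass X (E0 \<otimes>\<^sub>o Y) m \<bullet> ?s"
      by (simp add: Phi_sig act_comp_extend)
    also have "\<dots> = (\<I> X \<star> (cstr F c Y m \<bullet> eps A0 (Y \<diamond> m))) \<bullet> ass X E0 (Y \<diamond> m) \<bullet>
        ass (X \<otimes>\<^sub>o E0) Y m \<bullet> ?s"
      by (simp add: pentagon')
    also have "\<dots> = (\<I> X \<star> (cstr F c Y m \<bullet> eps A0 (Y \<diamond> m))) \<bullet> ass X E0 (Y \<diamond> m) \<bullet>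
        (s0 X \<star> \<J> (Y \<diamond> m)) \<bullet> ass (E0 \<otimes>\<^sub>o X) Y m"
      using ass_natural[of "s0 X" "\<I> Y" "\<J> m"] by simp
    also have "\<dots> = (\<I> X \<star> cstr F c Y m) \<bullet> Phi X A0 (s0 X) (Y \<diamond> m) \<bullet> ass (E0 \<otimes>\<^sub>o X) Y m"
      by (simp add: Phi_def act_comp_extend)
    finally show "ass X Y ?n \<bullet> Phi (X \<otimes>\<^sub>o Y) A0 (s0 (X \<otimes>\<^sub>o Y)) m
      = ass X Y ?n \<bullet> Phi (X \<otimes>\<^sub>o Y) A0 ((\<I> X \<bowtie> s0 Y) \<diamondop> (s0 X \<bowtie> \<I> Y)) m"
      by (simp only: l)
  qed simp_all
qed (use assms in simp_all)

lemma iso_sig: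
  assumes "X \<in> Ob C"
  shows "iso_ar C (s0 X)"
proof -
  \<comment> \<open>The rotation needs an object \<open>D\<close> of which \<open>X\<close> is the
    left dual; the dual used to invert \<open>linv\<close> has the opposite handedness.\<close>
  obtain D e b where "D \<in> Ob C" "is_left_dual C D X e b"
    using C.right_dual[OF assms] by blast
  then show ?thesis
    using assms by (intro half_braiding_iso[of E0 X D e b s0] sig_natural sig_tensor sig_unit) simp_all
qed

lemma sig_gob:
  assumes "v \<in> Ob V"
  shows "s0 (gob v) = hb_inv (fob G v) E0"
proof (rule Phi_inject[of "gob v" A0])
  note [simp] = assms
  fix m assume m [simp]: "m \<in> Ob M"
  have "Phi (gob v) A0 (s0 (gob v)) m = (str A0 v m \<bullet> eps A0 (gob v \<diamond> m)) \<bullet> ass E0 (gob v) m"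
    using CVM_obD(5)[OF Fcd assms m] by (simp add: Phi_sig)
  also have "str A0 v m \<bullet> eps A0 (gob v \<diamond> m) = (\<I> (gob v) \<star> eps A0 m) \<bullet> sw (fob G v) E0 m"
    using vtransD(5)[OF vtrans_eps[of A0] assms m] by simp
  finally show "Phi (gob v) A0 (s0 (gob v)) m = Phi (gob v) A0 (hb_inv (fob G v) E0) m"
    by (simp add: Phi_def sw_ass)
qed (use assms in simp_all)

lemma Z_rhobar_ob:
  "fob Zrb (F, c, d) = (E0, \<lambda>X \<in> Ob C. arr (s0 X))"
proof -
  have "arr (s0 X) = l_iso C G M a H phi R p X A0 \<cdot>\<^bsub>C\<^esub>
      rhobar_arr C M H phi R p (ract A0 X, restrict (c X) (Ob M), lact X A0) \<cdot>\<^bsub>C\<^esub> r_inv C G M a H phi R p A0 X"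
    if [simp]: "X \<in> Ob C" for X
  proof -
    note [simp] = is_ar_rar_c(1)[of X] iso_linv[of A0 X] rinv(1)[of A0 X]
    have "s0 X = (inv_ar C (linv X A0) \<diamondop> rar (ract A0 X) (restrict (c X) (Ob M)) (lact X A0)) \<diamondop> rinv A0 X"
      by (simp add: sig_def)
    then show ?thesis
      by (simp add: comp_ar_def inv_ar_def linv_def rinv_def rar_def l_iso_def)
  qed
  then show ?thesis
    by (simp add: Z_rhobar_def cong: restrict_cong)
qed

lemma hb_Z_rhobar: "X \<in> Ob C \<Longrightarrow> hb (fob Zrb (F, c, d)) X = s0 X"
  by (rule ar.expand) (simp add: Z_rhobar_ob, simp add: hb_def)

lemma Z_rhobar_center: "fob Zrb (F, c, d) \<in> Ob (center C)"
proof -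
  note hb = hb_Z_rhobar[unfolded Z_rhobar_ob]
  show ?thesis
    unfolding Z_rhobar_ob
    by (rule center_obI) (simp_all add: hb iso_sig sig_natural sig_tensor)
qed

lemma Z_rhobar_relative_center: "fob Zrb (F, c, d) \<in> Ob (relative_center V C G)"
proof -
  have "snd (fob G v) E0 \<cdot>\<^bsub>C\<^esub> arr (s0 (gob v)) = ident C (E0 \<otimes>\<^sub>o gob v)" if "v \<in> Ob V" for v
  proof -
    \<comment> \<open>The double braiding in the relative center condition is thus a half-braiding
      after its own inverse.\<close>
    have "hb (fob G v) E0 \<diamondop> s0 (gob v) = \<I> (E0 \<otimes>\<^sub>o gob v)"
      using that by (simp add: sig_gob)
    then show ?thesis
      by (simp add: hb_def comp_ar_def id_ar_def)
  qed
  then show ?thesis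
    using Z_rhobar_center
    by (simp add: relative_center_def full_subcategory_simps center_braiding_def Z_rhobar_ob)
qed

end

section \<open>Action on arrows and functoriality\<close>

lemma CVM_hom_iff:
  assumes "(F, c, d) \<in> Ob CVM" "(F', c', d') \<in> Ob CVM"
  shows "x \<in> Hom CVM (F, c, d) (F', c', d') \<longleftrightarrow> (\<exists>\<alpha>. x = ((F, c, d), \<alpha>, (F', c', d')) \<and>
    \<alpha> \<in> extensional (Ob M) \<and> vtrans (F, d) (F', d') (fam (F, d) \<alpha> (F', d')) \<and>
    (\<forall>X \<in> Ob C. \<forall>m \<in> Ob M. cstr F' c' X m \<bullet> fam (F, d) \<alpha> (F', d') (X \<diamond> m)
      = (\<I> X \<star> fam (F, d) \<alpha> (F', d') m) \<bullet> cstr F c X m))"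
proof -
  have c: "cstr F' c' X m \<bullet> fam (F, d) \<alpha> (F', d') (X \<diamond> m)
        = (\<I> X \<star> fam (F, d) \<alpha> (F', d') m) \<bullet> cstr F c X m \<longleftrightarrow>
      c' X m \<cdot>\<^bsub>M\<^esub> \<alpha> (X \<diamond> m) = (ident C X \<rhd>\<^sub>a\<^bsub>a\<^esub> \<alpha> m) \<cdot>\<^bsub>M\<^esub> c X m" for \<alpha> X m
    by (simp add: fam_def cstr_def comp_ar_def act_ar_def id_ar_def)
  show ?thesis
    unfolding C_VM_def full_subcategory_simps Z_End_def cat.select_convs c
    using EndV_hom_iff[OF CVM_obD(1)[OF assms(1)] CVM_obD(1)[OF assms(2)]] by auto
qed

lemma far_Z_rhobar:
  "far Zrb ((F, c, d), \<alpha>, (F', c', d')) = rhobar_arr C M H phi R p ((F, d), \<alpha>, (F', d'))"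
  by (simp add: Z_rhobar_def)

text \<open>The point is centrality of the induced arrow. Through \<open>Phi\<close> it becomes the
  compatibility of the family with \<open>c\<close> and \<open>c'\<close>, because the counit is
  natural in the V-module functor.\<close>

lemma Z_rhobar_arr:
  assumes ob: "(F, c, d) \<in> Ob CVM" "(F', c', d') \<in> Ob CVM"
    and \<alpha>: "((F, c, d), \<alpha>, (F', c', d')) \<in> Hom CVM (F, c, d) (F', c', d')"
  shows "far Zrb ((F, c, d), \<alpha>, (F', c', d'))
    \<in> Hom (center C) (fob Zrb (F, c, d)) (fob Zrb (F', c', d'))"
proof -
  let ?A = "(F, d)" and ?B = "(F', d')" and ?z = "fob Zrb (F, c, d)" and ?w = "fob Zrb (F', c', d')"
  let ?t = "fam ?A \<alpha> ?B" and ?u = "rar ?A \<alpha> ?B"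
  have v: "vtrans ?A ?B ?t" and c: "\<And>X m. \<lbrakk>X \<in> Ob C; m \<in> Ob M\<rbrakk> \<Longrightarrow>
      cstr F' c' X m \<bullet> ?t (X \<diamond> m) = (\<I> X \<star> ?t m) \<bullet> cstr F c X m"
    using \<alpha> by (auto simp: CVM_hom_iff[OF ob])
  note [simp] = CVM_obD(1,3)[OF ob(1)] CVM_obD(1,3)[OF ob(2)] vtransD(1)[OF v] is_ar_sig[OF ob(1)]
    is_ar_sig[OF ob(2)] rar(1)[OF CVM_obD(1)[OF ob(1)] CVM_obD(1)[OF ob(2)] v]
    cstr(1)[OF CVM_obD(2)[OF ob(1)]] cstr(1)[OF CVM_obD(2)[OF ob(2)]]
  have eps: "eps ?B m \<bullet> (?u \<star> \<J> m) = ?t m \<bullet> eps ?A m" if "m \<in> Ob M" for m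
    by (rule rar(2)) (use that v in simp_all)
  have "(\<I> X \<bowtie> ?u) \<diamondop> sig F c d X = sig F' c' d' X \<diamondop> (?u \<bowtie> \<I> X)" if [simp]: "X \<in> Ob C" for X
  proof (rule Phi_inject[of X ?B])
    fix m assume [simp]: "m \<in> Ob M"
    have "Phi X ?B ((\<I> X \<bowtie> ?u) \<diamondop> sig F c d X) m
      = (\<I> X \<star> eps ?B m) \<bullet> ass X (R ?B) m \<bullet> ((\<I> X \<bowtie> ?u) \<star> \<J> m) \<bullet> (sig F c d X \<star> \<J> m)"
      by (simp add: Phi_def act_comp)
    also have "\<dots> = (\<I> X \<star> ?t m) \<bullet> Phi X ?A (sig F c d X) m"
      by (simp add: ass_natural' act_comp_extend eps Phi_def)
    also have "\<dots> = ((\<I> X \<star> ?t m) \<bullet> cstr F c X m) \<bullet> eps ?A (X \<diamond> m) \<bullet> ass (R ?A) X m"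
      by (simp add: Phi_sig[OF ob(1)])
    also have "\<dots> = cstr F' c' X m \<bullet> (?t (X \<diamond> m) \<bullet> eps ?A (X \<diamond> m)) \<bullet> ass (R ?A) X m"
      by (simp flip: c)
    also have "\<dots> = cstr F' c' X m \<bullet> eps ?B (X \<diamond> m) \<bullet> (?u \<star> \<J> (X \<diamond> m)) \<bullet> ass (R ?A) X m"
      by (simp flip: eps)
    also have "\<dots> = Phi X ?B (sig F' c' d' X) m \<bullet> ((?u \<bowtie> \<I> X) \<star> \<J> m)"
      using ass_natural[of ?u "\<I> X" "\<J> m"] by (simp add: Phi_sig[OF ob(2)])
    also have "\<dots> = Phi X ?B (sig F' c' d' X \<diamondop> (?u \<bowtie> \<I> X)) m"
      by (simp add: Phi_comp)
    finally show "Phi X ?B ((\<I> X \<bowtie> ?u) \<diamondop> sig F c d X) m = \<dots>" .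
  qed simp_all
  then have "central ?z ?w ?u"
    using Z_rhobar_center[OF ob(1)] Z_rhobar_center[OF ob(2)]
    by (simp add: central_def hb_Z_rhobar[OF ob(1)] hb_Z_rhobar[OF ob(2)])
      (simp add: Z_rhobar_ob[OF ob(1)] Z_rhobar_ob[OF ob(2)])
  then have "central ?z ?w (Ar (fst ?z) (rhobar_arr C M H phi R p (?A, \<alpha>, ?B)) (fst ?w))"
    by (simp add: rar_def Z_rhobar_ob[OF ob(1)] Z_rhobar_ob[OF ob(2)])
  then show ?thesis
    by (simp only: central_iff far_Z_rhobar)
qed

lemma rhobar_arr_id:
  assumes "A \<in> Ob EndV"
  shows "rhobar_arr C M H phi R p (A, \<lambda>m \<in> Ob M. ident M (fob (fst A) m), A) = ident C (R A)"
proof -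
  note [simp] = assms
  let ?\<alpha> = "\<lambda>m \<in> Ob M. ident M (fob (fst A) m)"
  have fam: "fam A ?\<alpha> A m = \<J> (fob (fst A) m)" if "m \<in> Ob M" for m
    using that by (simp add: fam_def id_ar_def)
  have v: "vtrans A A (fam A ?\<alpha> A)"
    using vtrans_id[OF assms] vtrans_cong[OF fam] by simp
  have "rar A ?\<alpha> A = \<I> (R A)"
    by (rule eps_inject[of A]) (use rar[OF assms assms v] fam in simp_all)
  then show ?thesis
    by (simp add: rar_def id_ar_def)
qed

text \<open>The counit passes through the two images one after the other, picking up both families,
  and \<open>eps_inject\<close> shows that this determines the arrow.\<close>

lemma rhobar_arr_comp:
  assumes ob: "A \<in> Ob EndV" "B \<in> Ob EndV" "D \<in> Ob EndV"
    and v: "vtrans A B (fam A \<alpha> B)" "vtrans B D (fam B \<beta> D)"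
  shows "rhobar_arr C M H phi R p (A, \<lambda>m \<in> Ob M. \<beta> m \<cdot>\<^bsub>M\<^esub> \<alpha> m, D)
    = rhobar_arr C M H phi R p (B, \<beta>, D) \<cdot>\<^bsub>C\<^esub> rhobar_arr C M H phi R p (A, \<alpha>, B)"
proof -
  let ?\<gamma> = "\<lambda>m \<in> Ob M. \<beta> m \<cdot>\<^bsub>M\<^esub> \<alpha> m"
  have fam: "fam A ?\<gamma> D m = fam B \<beta> D m \<bullet> fam A \<alpha> B m" if "m \<in> Ob M" for m
    using that by (simp add: fam_def comp_ar_def)
  have w: "vtrans A D (fam A ?\<gamma> D)"
    using vtrans_comp[OF v ob] vtrans_cong[OF fam] by simp
  note r = rar[OF ob(1,2) v(1)] rar[OF ob(2,3) v(2)] rar[OF ob(1,3) w]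
  note [simp] = ob r(1,3,5) vtransD(1)[OF v(1)] vtransD(1)[OF v(2)]
  have "rar A ?\<gamma> D = rar B \<beta> D \<diamondop> rar A \<alpha> B"
  proof (rule eps_inject[of D])
    fix m assume m [simp]: "m \<in> Ob M"
    have "eps D m \<bullet> ((rar B \<beta> D \<diamondop> rar A \<alpha> B) \<star> \<J> m)
        = (eps D m \<bullet> (rar B \<beta> D \<star> \<J> m)) \<bullet> (rar A \<alpha> B \<star> \<J> m)"
      by (simp add: act_comp)
    also have "\<dots> = fam B \<beta> D m \<bullet> eps B m \<bullet> (rar A \<alpha> B \<star> \<J> m)"
      unfolding r(4)[OF m] by simp
    also have "\<dots> = fam A ?\<gamma> D m \<bullet> eps A m"
      using r(2)[OF m] fam[OF m] by simp
    finally show "eps D m \<bullet> (rar A ?\<gamma> D \<star> \<J> m) = eps D m \<bullet> ((rar B \<beta> D \<diamondop> rar A \<alpha> B) \<star> \<J> m)"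
      using r(6)[OF m] by simp
  qed simp_all
  then show ?thesis
    by (simp add: rar_def comp_ar_def)
qed

lemma relative_center_simps [simp]:
  "Hom (relative_center V C G) = Hom (center C)"
  "ident (relative_center V C G) z = ident C (fst z)"
  "comp_arr (relative_center V C G) = comp_arr C"
  by (simp_all add: relative_center_def full_subcategory_simps)

lemma CVM_simps [simp]:
  "ident CVM A = (A, (\<lambda>m \<in> Ob M. ident M (fob (fst A) m)), A)"
  "(B', \<beta>, D) \<cdot>\<^bsub>CVM\<^esub> (A, \<alpha>, B) = (A, (\<lambda>m \<in> Ob M. \<beta> m \<cdot>\<^bsub>M\<^esub> \<alpha> m), D)"
  unfolding C_VM_def full_subcategory_simps Z_End_def cat.select_convs by simp_all

lemma Z_rhobar_functor: "is_functor CVM (relative_center V C G) Zrb"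
  unfolding is_functor_def
proof (intro conjI ballI)
  fix Q assume "Q \<in> Ob CVM"
  then show "fob Zrb Q \<in> Ob (relative_center V C G)"
    by (cases Q) (simp add: Z_rhobar_relative_center)
next
  fix Q Q' x assume x: "Q \<in> Ob CVM" "Q' \<in> Ob CVM" "x \<in> Hom CVM Q Q'"
  obtain F c d F' c' d' where Q: "Q = (F, c, d)" "Q' = (F', c', d')"
    by (cases Q, cases Q')
  show "far Zrb x \<in> Hom (relative_center V C G) (fob Zrb Q) (fob Zrb Q')"
    using x Z_rhobar_arr[of F c d F' c' d'] unfolding Q by (auto simp: CVM_hom_iff)
next
  fix Q assume Q: "Q \<in> Ob CVM"
  obtain F c d where "Q = (F, c, d)"
    by (cases Q)
  then show "far Zrb (ident CVM Q) = ident (relative_center V C G) (fob Zrb Q)"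
    using Q rhobar_arr_id[OF CVM_obD(1), of F c d] by (simp add: Z_rhobar_ob far_Z_rhobar)
next
  fix Q Q' Q'' x y
  assume x: "Q \<in> Ob CVM" "Q' \<in> Ob CVM" "Q'' \<in> Ob CVM" "x \<in> Hom CVM Q Q'" "y \<in> Hom CVM Q' Q''"
  obtain F c d F' c' d' F'' c'' d'' where Q: "Q = (F, c, d)" "Q' = (F', c', d')" "Q'' = (F'', c'', d'')"
    by (cases Q, cases Q', cases Q'')
  note ob = x(1-3)[unfolded Q]
  obtain \<alpha> \<beta> where xy: "x = ((F, c, d), \<alpha>, (F', c', d'))" "y = ((F', c', d'), \<beta>, (F'', c'', d''))"
    and v: "vtrans (F, d) (F', d') (fam (F, d) \<alpha> (F', d'))"
      "vtrans (F', d') (F'', d'') (fam (F', d') \<beta> (F'', d''))"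
    using x(4,5) unfolding Q CVM_hom_iff[OF ob(1,2)] CVM_hom_iff[OF ob(2,3)] by auto
  show "far Zrb (y \<cdot>\<^bsub>CVM\<^esub> x) = far Zrb y \<cdot>\<^bsub>relative_center V C G\<^esub> far Zrb x"
    using rhobar_arr_comp[OF CVM_obD(1)[OF ob(1)] CVM_obD(1)[OF ob(2)] CVM_obD(1)[OF ob(3)] v]
    by (simp add: xy far_Z_rhobar)
qed

end

theorem theorem4p10:
  fixes V :: "('vo, 'vm, 'k::alg_closed_field) tensor_cat"
    and br :: "'vo \<Rightarrow> 'vo \<Rightarrow> 'vm"
    and C :: "('co, 'cm, 'k) tensor_cat"
    and G :: "('vo, 'vm, 'co \<times> ('co \<Rightarrow> 'cm), 'cm) mon_fctr"
    and M :: "('mo, 'mm, 'k) kcat"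
    and a :: "('co, 'cm, 'mo, 'mm) action"
    and H :: "'mo \<Rightarrow> 'mo \<Rightarrow> 'co"
    and phi :: "'co \<Rightarrow> 'mo \<Rightarrow> 'mo \<Rightarrow> 'cm \<Rightarrow> 'mm"
    and R :: "('vo, 'mo, 'mm) vfun \<Rightarrow> 'co"
    and p :: "('vo, 'mo, 'mm) vfun \<Rightarrow> 'mo \<Rightarrow> 'cm"
  assumes "braided_tensor_category V br"
    and "tensor_category C"
    and "central_via V br C G"
    and "right_exact V (center C) G"
    and "module_category C M a"
    and "internal_hom C M a H phi"
    and "\<forall>A \<in> Ob (End_V V C G M a). is_rhobar V C G M a H phi A (R A) (p A)"
  shows "(\<forall>F c d.
            module_functor C M a F c \<and> module_functor V M (V_action V C G M a) F d \<and>
            (\<forall>v \<in> Ob V. \<forall>m \<in> Ob M. c (fst (fob G v)) m = d v m) \<longrightarrow>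
              (F, c, d) \<in> Ob (C_VM V C G M a) \<and>
              fob (Z_rhobar C G M a H phi R p) (F, c, d) \<in> Ob (relative_center V C G)) \<and>
         is_functor (C_VM V C G M a) (relative_center V C G) (Z_rhobar C G M a H phi R p)"
proof -
  interpret V: braided_tensor_category V br by fact
  interpret C: tensor_category C by fact
  interpret M: module_category C M a by fact
  have "monoidal_functor V (center C) G"
    using assms(3) by (simp add: central_via_def braided_functor_def)
  then interpret rhobar_setting V C M a G H phi R p
    using assms by unfold_locales simp_all
  \<comment> \<open>The half-braiding of an object of \<open>Z_End\<close> has to consist of arrows
    of \<open>End_V\<close>; \<open>braiding_vtrans\<close> supplies this from the equality of
    \<open>c\<close> and \<open>d\<close>.\<close>
  have "(F, c, d) \<in> Ob CVM"
    if "module_functor C M a F c" "module_functor V M V_act F d"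
      "\<forall>v \<in> Ob V. \<forall>m \<in> Ob M. c (gob v) m = d v m" for F c d
    using that braiding_vtrans[of F c d] by (simp add: CVM_ob_iff EndV_ob_iff)
  then show ?thesis
    using Z_rhobar_relative_center Z_rhobar_functor by blast
qed

end
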